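(* Let $(\lambda_N)_{N}$ be a sequence of non-trivial conjugacy classes $\lambda_N\subset\mathfrak{S}(N)$ which converges and is evanescent, with limiting data $(\lambda(i))_{i\ge2}$, and for each $N$ let $(S^N_t)_{t\ge 0}$ be a $\lambda_N$-random walk on $\mathfrak{S}(N)$. Put $\lambda(1)=1$. The log-cumulant transform $\mathcal{LR}^\lambda$ of $\big((S^N_t)_{t\ge0}\big)_N$ is characterized by: 1. $\mathcal{LR}^\lambda$ is a $\boxtimes$-infinitesimal character; 2. for any $k\ge1$ and any irreducible partition $p\in\mathcal{P}_k$, if ${\sf H}(p)$ is not a parure then $\mathcal{LR}^\lambda(p)=0$; 3. for any $k\ge1$ and any irreducible partition $p\in\mathcal{P}_k$: if ${\sf H}(p)$ is a necklace then $$\mathcal{LR}^{\lambda}(p)= (-1)^{\# {\sf E}(p)} \lambda( | {\sf H}(p)|),$$ with the convention that the empty partition is a necklace with $|\emptyset|=0$ and $\lambda(0)=1$; and if ${\sf H}(p)$ is a chain then $$\mathcal{LR}^{\lambda}(p)= (-1)^{\# {\sf E}(p)} \Big( 1-\sum_{i=2}^{| {\sf H}(p) |} \lambda(i)\Big).$$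
   Context: Random walks. $\mathfrak{S}(N)$ is the symmetric group; permutations $S$ are identified with $N\times N$ permutation matrices ($S e_j=e_{S(j)}$). For a permutation $\sigma$, the period of $j$ in $\sigma$ is the smallest $n\ge1$ with $\sigma^n(j)=j$. For a conjugacy class $\lambda_N$ of $\mathfrak{S}(N)$, $\lambda_N(i)$ is the number of $j\in\{1,\dots,N\}$ whose period in $\sigma$ equals $i$ (any $\sigma\in\lambda_N$), and $\lambda_N(1^c)=N-\lambda_N(1)$. Classes are assumed non-trivial: $\lambda_N\neq\{id_N\}$ ($N\ge2$). The $\lambda_N$-random walk $(S^N_t)_{t\ge0}$ is the Markov process on $\mathfrak{S}(N)$ with $S^N_0=id_N$ and generator $$H_Nf(\sigma_0)=\frac{N}{\lambda_N(1^c)}\frac{1}{\#\lambda_N}\sum_{\sigma\in\lambda_N}[f(\sigma\sigma_0)-f(\sigma_0)].$$ The sequence $(\lambda_N)_N$ converges if there are $\lambda(i)\ge0$ ($i\ge2$) with $\sum_{i\ge2}\lambda(i)\le1$ and $\lambda_N(i)/\lambda_N(1^c)\to\lambda(i)$ for every $i\ge2$, and there is $\alpha\in[0,1]$ with $\lambda_N(1)/N\to1-\alpha$. It is evanescent if $\alpha=0$. Partitions. $\mathcal{P}_k$ is the set of partitions of $\{1,\dots,k,1',\dots,k'\}$, $id_k=\{\{i,i'\}:1\le i\le k\}$, $p\vee p'$ is the supremum (finest common coarsening), ${\sf nc}(p)$ is the number of blocks; a cycle of $p$ is a block of $p\vee id_k$; $p$ is irreducible if ${\sf nc}(p\vee id_k)=1$;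 $p_1\otimes p_2$ is the juxtaposition of $p_1$ and $p_2$. The extraction of $p$ to a subset $C\subset\{1,\dots,k,1',\dots,k'\}$ stable under $i\leftrightarrow i'$ is the restriction of $p$ to $C$, relabelled in increasing order. For $I=(i_1,\dots,i_k,i_{1'},\dots,i_{k'})\in\{1,\dots,N\}^{2k}$, ${\sf Ker}(I)$ is the partition in which $a,b$ are in the same block iff $i_a=i_b$, and $\rho_N(p)=\sum_{I:\,p\text{ finer than or equal to }{\sf Ker}(I)}E_{i_{1'}}^{i_1}\otimes\dots\otimes E_{i_{k'}}^{i_k}$, where $E_i^j$ maps $e_j$ to $e_i$ and the other basis vectors to $0$. Log-cumulant transform. Let $G_k^N=\frac{d}{dt}|_{t=0}\mathbb{E}[(S^N_t)^{\otimes k}]$. For $N\ge2k$ there are unique numbers $\kappa_p(G^N_k)$ with $G_k^N=\sum_{p\in\mathcal{P}_k}N^{-({\sf nc}(p)-{\sf nc}(p\vee id_k))}\kappa_p(G_k^N)\rho_N(p)$. The log-cumulant transform is the linear form $\mathcal{LR}^\lambda$ on $\bigoplus_k\mathbb{C}[\mathcal{P}_k]$ with $\mathcal{LR}^\lambda(p)=\lim_{N\to\infty}\kappa_p(G^N_k)$ for $p\in\mathcal{P}_k$ (the limits exist). $\boxtimes$-infinitesimal character. With $\epsilon_\boxtimes$ the linear form equal to $1$ on each $id_k$ and $0$ on all other partitions, $E$ is a $\boxtimes$-infinitesimal character if $E(p_1\otimes p_2)=E(p_1)\epsilon_\boxtimes(p_2)+\epsilon_\boxtimes(p_1)E(p_2)$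 for all $p_1,p_2$; in this setting this is understood as equivalent to: (a) $E(id_k)=kE(id_1)$ for all $k\ge1$; (b) if, up to a permutation of the columns (simultaneous permutation of the $i$ and $i'$), $p=p'\otimes id_l$ with $p'$ irreducible (and $p$ not an identity), then $E(p)=E(p')$; (c) $E(p)=0$ for all other $p$. Parures. Let $\{b_1,\dots,b_s\}$ be a partition of $\{1,\dots,k\}$, $\sigma$ an $s$-cycle on $\{1,\dots,s\}$ and $i_0\in\{1,\dots,s\}$; $b'_l=\{i':i\in b_l\}$. The partition $\{b_l\cup b'_{\sigma(l)}:1\le l\le s\}$ is a necklace, and the partition $\{b_l\cup b'_{\sigma(l)}:l\ne i_0\}\cup\{b_{i_0},\,b'_{\sigma(i_0)}\}$ is a chain; in both cases the true-length $|p|$ is $s$. A parure is a partition $p$ whose extraction to each of its cycles is a chain or a necklace. Ears. For $p\in\mathcal{P}_k$, $\{i,i'\}$ is an ear of $p$ if $i$ and $i'$ are in the same block of $p$; ${\sf E}(p)$ is the set of ears; the head ${\sf H}(p)$ is the extraction of $p$ to the complement of the union of its ears. *)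

theory Defs
  imports
    "HOL-Probability.Probability"
    "HOL-Combinatorics.Combinatorics"
begin

section \<open>Partitions of \<open>{1, \<dots>, k, 1', \<dots>, k'}\<close>\<close>

text \<open>The point \<open>i\<close> is encoded as \<open>Inl i\<close> and the point \<open>i'\<close> as \<open>Inr i\<close>.\<close>

type_synonym point = "nat + nat"

definition points :: "nat \<Rightarrow> point set"
  where "points k = {1..k} <+> {1..k}"

definition partitions :: "nat \<Rightarrow> point set set set"
  where "partitions k = {p. partition_on (points k) p}"

definition id_part :: "nat \<Rightarrow> point set set"
  where "id_part k = (\<lambda>i. {Inl i, Inr i}) ` {1..k}"

abbreviation nc :: "point set set \<Rightarrow> nat"
  where "nc p \<equiv> card p"

text \<open>\<open>refines A p r\<close> says that \<open>p\<close> is finer than or equal to \<open>r\<close>.\<close>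

definition sup_part :: "'a set \<Rightarrow> 'a set set \<Rightarrow> 'a set set \<Rightarrow> 'a set set"
  where "sup_part A p q =
    (THE r. refines A p r \<and> refines A q r \<and>
       (\<forall>r'. refines A p r' \<and> refines A q r' \<longrightarrow> refines A r r'))"

lemma sup_part_unique_existence:
  assumes p: "partition_on A p" and q: "partition_on A q"
  shows "\<exists>!r. refines A p r \<and> refines A q r \<and>
       (\<forall>r'. refines A p r' \<and> refines A q r' \<longrightarrow> refines A r r')"
proof -
  define R where "R = {(x, y). \<exists>b \<in> p \<union> q. x \<in> b \<and> y \<in> b}"
  have Ap: "\<Union>p = A" and Aq: "\<Union>q = A"
    using p q by (auto simp: partition_on_def)
  have symR: "sym (R\<^sup>+)" by (rule sym_trancl) (auto simp: R_def sym_def)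
  have RA: "R \<subseteq> A \<times> A" using Ap Aq by (auto simp: R_def)
  then have TA: "R\<^sup>+ \<subseteq> A \<times> A" by (rule trancl_subset_Sigma)
  have reflR: "(x, x) \<in> R\<^sup>+" if "x \<in> A" for x
    using that Ap by (intro r_into_trancl) (auto simp: R_def)
  have eq: "equiv A (R\<^sup>+)"
    using symR TA reflR by (intro equivI) (auto simp: refl_on_def)
  define r where "r = A // R\<^sup>+"
  have r: "partition_on A r" unfolding r_def by (rule partition_on_quotient[OF eq])
  have sub: "\<exists>Y\<in>r. X \<subseteq> Y" if X: "X \<in> p \<union> q" for X
  proof -
    from X p q have "X \<noteq> {}" by (auto simp: partition_on_def)
    then obtain x where x: "x \<in> X" by blast
    then have xA: "x \<in> A" using X Ap Aq by auto
    have "X \<subseteq> R\<^sup>+ `` {x}" using x X by (auto simp: R_def)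
    then show ?thesis using xA by (auto simp: r_def quotient_def)
  qed
  have least: "refines A r r'" if "refines A p r'" "refines A q r'" for r'
  proof -
    have r': "partition_on A r'" using that by (simp add: refines_def)
    have step: "y \<in> b" if xy: "(x, y) \<in> R" "x \<in> b" "b \<in> r'" for x y b
    proof -
      obtain c where c: "c \<in> p \<union> q" "x \<in> c" "y \<in> c" using xy(1) unfolding R_def by blast
      then obtain d where d: "d \<in> r'" "c \<subseteq> d"
        using \<open>refines A p r'\<close> \<open>refines A q r'\<close> by (auto simp: refines_def)
      then have "d = b" using xy c r' by (auto simp: partition_on_def disjoint_def)
      then show ?thesis using c d by auto
    qed
    have steps: "(x, y) \<in> R\<^sup>+ \<Longrightarrow> x \<in> b \<Longrightarrow> b \<in> r' \<Longrightarrow> y \<in> b" for x y b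
      by (induction rule: trancl_induct) (auto intro: step)
    have "\<exists>Y\<in>r'. X \<subseteq> Y" if Xr: "X \<in> r" for X
    proof -
      obtain x where x: "x \<in> A" "X = R\<^sup>+ `` {x}" using Xr by (auto simp: r_def quotient_def)
      then obtain b where "b \<in> r'" "x \<in> b" using r' by (auto simp: partition_on_def)
      moreover have "X \<subseteq> b" using steps[OF _ \<open>x \<in> b\<close> \<open>b \<in> r'\<close>] x(2) by auto
      ultimately show ?thesis by blast
    qed
    then show ?thesis unfolding refines_def using r r' by simp
  qed
  have up: "refines A p r" "refines A q r"
    unfolding refines_def using sub r p q by simp_all
  show ?thesis
  proof (rule ex1I[of _ r])
    show "refines A p r \<and> refines A q r \<and>
       (\<forall>r'. refines A p r' \<and> refines A q r' \<longrightarrow> refines A r r')"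
      using up least by simp
  next
    fix r' assume r': "refines A p r' \<and> refines A q r' \<and>
       (\<forall>s. refines A p s \<and> refines A q s \<longrightarrow> refines A r' s)"
    then have "refines A r' r" using up by simp
    moreover have "refines A r r'" using least r' by simp
    ultimately show "r' = r" by (rule refines_asym)
  qed
qed

definition cycles_of :: "nat \<Rightarrow> point set set \<Rightarrow> point set set"
  where "cycles_of k p = sup_part (points k) p (id_part k)"

definition irreducible_part :: "nat \<Rightarrow> point set set \<Rightarrow> bool"
  where "irreducible_part k p \<longleftrightarrow> p \<in> partitions k \<and> nc (cycles_of k p) = 1"

text \<open>Juxtaposition of \<open>p \<in> \<P>\<^sub>k\<close> and an arbitrary \<open>q\<close>; only the size of the first factor matters.\<close>

definition tensor_part :: "nat \<Rightarrow> point set set \<Rightarrow> point set set \<Rightarrow> point set set"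
  where "tensor_part k p q = p \<union> (\<lambda>b. map_sum (\<lambda>i. k + i) (\<lambda>i. k + i) ` b) ` q"

definition permute_columns :: "(nat \<Rightarrow> nat) \<Rightarrow> point set set \<Rightarrow> point set set"
  where "permute_columns \<pi> p = (\<lambda>b. map_sum \<pi> \<pi> ` b) ` p"

definition columns :: "point set \<Rightarrow> nat set"
  where "columns C = {i. Inl i \<in> C}"

definition rank_in :: "point set \<Rightarrow> nat \<Rightarrow> nat"
  where "rank_in C i = card {j \<in> columns C. j \<le> i}"

text \<open>Extraction to a set \<open>C\<close> stable under \<open>i \<leftrightarrow> i'\<close>; the result lies in
  \<open>\<P>\<^sub>m\<close> with \<open>m = card (columns C)\<close>.\<close>

definition extraction :: "point set \<Rightarrow> point set set \<Rightarrow> point set set"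
  where "extraction C p =
    (\<lambda>b. map_sum (rank_in C) (rank_in C) ` b) ` ((\<lambda>b. b \<inter> C) ` p - {{}})"

subsection \<open>Necklaces, chains, parures\<close>

definition necklace_block :: "(nat \<Rightarrow> nat set) \<Rightarrow> (nat \<Rightarrow> nat) \<Rightarrow> nat \<Rightarrow> point set"
  where "necklace_block b \<sigma> l = Inl ` b l \<union> Inr ` b (\<sigma> l)"

definition necklace_data :: "nat \<Rightarrow> nat \<Rightarrow> (nat \<Rightarrow> nat set) \<Rightarrow> (nat \<Rightarrow> nat) \<Rightarrow> bool"
  where "necklace_data k s b \<sigma> \<longleftrightarrow>
    inj_on b {1..s} \<and> partition_on {1..k} (b ` {1..s}) \<and>
    \<sigma> permutes {1..s} \<and> cyclic_on \<sigma> {1..s}"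

text \<open>\<open>necklace k p s\<close> and \<open>chain k p s\<close> say that \<open>p \<in> \<P>\<^sub>k\<close> is a necklace, respectively a
  chain, of true-length \<open>s\<close>. The first disjunct is the convention that the empty partition is a
  necklace of true-length \<open>0\<close>; \<^const>\<open>cyclic_on\<close> forces \<open>s \<ge> 1\<close> in all other cases.\<close>

definition necklace :: "nat \<Rightarrow> point set set \<Rightarrow> nat \<Rightarrow> bool"
  where "necklace k p s \<longleftrightarrow>
    (k = 0 \<and> p = {} \<and> s = 0) \<or>
    (\<exists>b \<sigma>. necklace_data k s b \<sigma> \<and> p = necklace_block b \<sigma> ` {1..s})"

definition chain :: "nat \<Rightarrow> point set set \<Rightarrow> nat \<Rightarrow> bool"
  where "chain k p s \<longleftrightarrow>
    (\<exists>b \<sigma> i0. necklace_data k s b \<sigma> \<and> i0 \<in> {1..s} \<and>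
       p = necklace_block b \<sigma> ` ({1..s} - {i0}) \<union> {Inl ` b i0, Inr ` b (\<sigma> i0)})"

definition parure :: "nat \<Rightarrow> point set set \<Rightarrow> bool"
  where "parure k p \<longleftrightarrow> p \<in> partitions k \<and>
    (\<forall>c \<in> cycles_of k p. \<exists>s.
       chain (card (columns c)) (extraction c p) s \<or>
       necklace (card (columns c)) (extraction c p) s)"

definition ears :: "point set set \<Rightarrow> point set set"
  where "ears p = {{Inl i, Inr i} | i. \<exists>b \<in> p. Inl i \<in> b \<and> Inr i \<in> b}"

definition head :: "nat \<Rightarrow> point set set \<Rightarrow> point set set"
  where "head k p = extraction (points k - \<Union>(ears p)) p"

definition head_size :: "nat \<Rightarrow> point set set \<Rightarrow> nat"
  where "head_size k p = card (columns (points k - \<Union>(ears p)))"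

section \<open>Infinitesimal characters\<close>

text \<open>Since \<open>k\<close> is determined by \<open>p \<in> \<P>\<^sub>k\<close>, the sets \<open>\<P>\<^sub>k\<close> are pairwise disjoint, and a linear
  form on \<open>\<Oplus>\<^sub>k \<complex>[\<P>\<^sub>k]\<close> is given by its values on the basis, that is, by a function on partitions
  (whose values outside of \<open>\<Union>\<^sub>k \<P>\<^sub>k\<close> are irrelevant).\<close>

definition eps_box :: "point set set \<Rightarrow> complex"
  where "eps_box p = (if \<exists>k. p = id_part k then 1 else 0)"

definition stabilizes :: "nat \<Rightarrow> point set set \<Rightarrow> nat \<Rightarrow> point set set \<Rightarrow> bool"
  where "stabilizes k p k' p' \<longleftrightarrow>
    (\<exists>l \<pi>. k = k' + l \<and> \<pi> permutes {1..k} \<and>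
       p = permute_columns \<pi> (tensor_part k' p' (id_part l)))"

text \<open>The first condition alone only constrains the values on honest juxtapositions; the three
  others, which imply it, also fix the behaviour under permutations of the columns.\<close>

definition infinitesimal_character :: "(point set set \<Rightarrow> complex) \<Rightarrow> bool"
  where "infinitesimal_character E \<longleftrightarrow>
    (\<forall>k l. \<forall>p \<in> partitions k. \<forall>q \<in> partitions l.
       E (tensor_part k p q) = E p * eps_box q + eps_box p * E q) \<and>
    (\<forall>k\<ge>1. E (id_part k) = of_nat k * E (id_part 1)) \<and>
    (\<forall>k k' p p'. p \<in> partitions k \<and> p \<noteq> id_part k \<and>
       irreducible_part k' p' \<and> stabilizes k p k' p' \<longrightarrow> E p = E p') \<and>
    (\<forall>k p. p \<in> partitions k \<and> p \<noteq> id_part k \<and>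
       \<not> (\<exists>k' p'. irreducible_part k' p' \<and> stabilizes k p k' p') \<longrightarrow> E p = 0)"

section \<open>Tensor operators\<close>

text \<open>A matrix has the row index first. An operator on \<open>(\<complex>\<^sup>N)\<^sup>\<otimes>\<^sup>k\<close> is a matrix whose rows and columns
  are indexed by \<open>{1..k} \<rightarrow>\<^sub>E {1..N}\<close>.\<close>

type_synonym matrix_fun = "nat \<Rightarrow> nat \<Rightarrow> complex"
type_synonym tensor_op = "(nat \<Rightarrow> nat) \<Rightarrow> (nat \<Rightarrow> nat) \<Rightarrow> complex"

definition tensor_indices :: "nat \<Rightarrow> nat \<Rightarrow> (nat \<Rightarrow> nat) set"
  where "tensor_indices N k = {1..k} \<rightarrow>\<^sub>E {1..N}"

definition tensor_product :: "nat \<Rightarrow> (nat \<Rightarrow> matrix_fun) \<Rightarrow> tensor_op"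
  where "tensor_product k A J I = (\<Prod>m\<in>{1..k}. A m (J m) (I m))"

text \<open>\<open>elementary i j\<close> maps \<open>e\<^sub>j\<close> to \<open>e\<^sub>i\<close>.\<close>

definition elementary :: "nat \<Rightarrow> nat \<Rightarrow> matrix_fun"
  where "elementary i j a b = (if a = i \<and> b = j then 1 else 0)"

definition perm_matrix :: "(nat \<Rightarrow> nat) \<Rightarrow> matrix_fun"
  where "perm_matrix \<sigma> a b = (if a = \<sigma> b then 1 else 0)"

definition Ker :: "nat \<Rightarrow> (point \<Rightarrow> nat) \<Rightarrow> point set set"
  where "Ker k I = (\<lambda>a. {b \<in> points k. I b = I a}) ` points k"

definition rho :: "nat \<Rightarrow> nat \<Rightarrow> point set set \<Rightarrow> tensor_op"
  where "rho N k p J K =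
    (\<Sum>I \<in> {I \<in> points k \<rightarrow>\<^sub>E {1..N}. refines (points k) p (Ker k I)}.
       tensor_product k (\<lambda>m. elementary (I (Inr m)) (I (Inl m))) J K)"

definition kappa :: "nat \<Rightarrow> nat \<Rightarrow> tensor_op \<Rightarrow> point set set \<Rightarrow> complex"
  where "kappa N k G =
    (THE c. c \<in> extensional (partitions k) \<and>
       (\<forall>J \<in> tensor_indices N k. \<forall>K \<in> tensor_indices N k.
          G J K = (\<Sum>p\<in>partitions k.
            of_nat N powi (- (int (nc p) - int (nc (cycles_of k p)))) * c p * rho N k p J K)))"

section \<open>Conjugacy classes and random walks\<close>

definition Sym :: "nat \<Rightarrow> (nat \<Rightarrow> nat) set"
  where "Sym N = {\<sigma>. \<sigma> permutes {1..N}}"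

definition conjugacy_class :: "nat \<Rightarrow> (nat \<Rightarrow> nat) set \<Rightarrow> bool"
  where "conjugacy_class N C \<longleftrightarrow> (\<exists>\<sigma>\<in>Sym N. C = (\<lambda>\<tau>. \<tau> \<circ> \<sigma> \<circ> inv \<tau>) ` Sym N)"

definition nontrivial_class :: "nat \<Rightarrow> (nat \<Rightarrow> nat) set \<Rightarrow> bool"
  where "nontrivial_class N C \<longleftrightarrow> conjugacy_class N C \<and> C \<noteq> {id}"

text \<open>\<open>least_power \<sigma> j\<close> is the period of \<open>j\<close> in \<open>\<sigma>\<close>; the count is the same for all elements of a
  conjugacy class.\<close>

definition class_count :: "nat \<Rightarrow> (nat \<Rightarrow> nat) set \<Rightarrow> nat \<Rightarrow> nat"
  where "class_count N C i = card {j \<in> {1..N}. least_power (SOME \<sigma>. \<sigma> \<in> C) j = i}"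

definition class_support :: "nat \<Rightarrow> (nat \<Rightarrow> nat) set \<Rightarrow> nat"
  where "class_support N C = N - class_count N C 1"

definition classes_converge ::
    "(nat \<Rightarrow> (nat \<Rightarrow> nat) set) \<Rightarrow> (nat \<Rightarrow> real) \<Rightarrow> real \<Rightarrow> bool"
  where "classes_converge C lam \<alpha> \<longleftrightarrow>
    (\<forall>i\<ge>2. lam i \<ge> 0) \<and> lam summable_on {2..} \<and> infsum lam {2..} \<le> 1 \<and>
    (\<forall>i\<ge>2. (\<lambda>N. real (class_count N (C N) i) / real (class_support N (C N)))
       \<longlonglongrightarrow> lam i) \<and>
    \<alpha> \<in> {0..1} \<and> (\<lambda>N. real (class_count N (C N) 1) / real N) \<longlonglongrightarrow> 1 - \<alpha>"

definition generator ::
    "nat \<Rightarrow> (nat \<Rightarrow> nat) set \<Rightarrow> ((nat \<Rightarrow> nat) \<Rightarrow> real) \<Rightarrow> (nat \<Rightarrow> nat) \<Rightarrow> real"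
  where "generator N C f \<sigma>0 =
    real N / real (class_support N C) * (1 / real (card C)) *
    (\<Sum>\<sigma>\<in>C. f (\<sigma> \<circ> \<sigma>0) - f \<sigma>0)"

text \<open>Continuous-time Markov processes on a finite state space \<open>X\<close>: \<open>P t x y\<close> is the probability
  to go from \<open>x\<close> to \<open>y\<close> in time \<open>t\<close>.\<close>

definition transition_semigroup :: "'s set \<Rightarrow> (real \<Rightarrow> 's \<Rightarrow> 's \<Rightarrow> real) \<Rightarrow> bool"
  where "transition_semigroup X P \<longleftrightarrow>
    (\<forall>t\<ge>0. \<forall>x\<in>X. (\<forall>y\<in>X. P t x y \<ge> 0) \<and> (\<Sum>y\<in>X. P t x y) = 1) \<and>
    (\<forall>x\<in>X. \<forall>y\<in>X. P 0 x y = (if x = y then 1 else 0)) \<and>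
    (\<forall>s\<ge>0. \<forall>t\<ge>0. \<forall>x\<in>X. \<forall>y\<in>X. P (s + t) x y = (\<Sum>z\<in>X. P s x z * P t z y))"

definition has_generator ::
    "'s set \<Rightarrow> (real \<Rightarrow> 's \<Rightarrow> 's \<Rightarrow> real) \<Rightarrow> (('s \<Rightarrow> real) \<Rightarrow> 's \<Rightarrow> real) \<Rightarrow> bool"
  where "has_generator X P H \<longleftrightarrow>
    (\<forall>f. \<forall>x\<in>X. ((\<lambda>t. ((\<Sum>y\<in>X. P t x y * f y) - f x) / t) \<longlongrightarrow> H f x) (at_right 0))"

definition markov_process ::
    "'a measure \<Rightarrow> (real \<Rightarrow> 'a \<Rightarrow> 's) \<Rightarrow> 's set \<Rightarrow> (real \<Rightarrow> 's \<Rightarrow> 's \<Rightarrow> real) \<Rightarrow> bool"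
  where "markov_process M S X P \<longleftrightarrow>
    prob_space M \<and> transition_semigroup X P \<and>
    (\<forall>t\<ge>0. S t \<in> measurable M (count_space X)) \<and>
    (\<forall>n (t :: nat \<Rightarrow> real) x. 0 \<le> t 0 \<and> (\<forall>i\<le>n. t i \<le> t (Suc i)) \<and> (\<forall>i\<le>Suc n. x i \<in> X) \<longrightarrow>
       measure M {\<omega> \<in> space M. \<forall>i\<le>Suc n. S (t i) \<omega> = x i} =
       measure M {\<omega> \<in> space M. \<forall>i\<le>n. S (t i) \<omega> = x i} *
         P (t (Suc n) - t n) (x n) (x (Suc n)))"

definition class_random_walk ::
    "nat \<Rightarrow> (nat \<Rightarrow> nat) set \<Rightarrow> 'a measure \<Rightarrow> (real \<Rightarrow> 'a \<Rightarrow> nat \<Rightarrow> nat) \<Rightarrow> bool"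
  where "class_random_walk N C M S \<longleftrightarrow>
    (\<exists>P. markov_process M S (Sym N) P \<and> has_generator (Sym N) P (generator N C)) \<and>
    (AE \<omega> in M. S 0 \<omega> = id)"

section \<open>Log-cumulant transform\<close>

definition mean_derivative ::
    "'a measure \<Rightarrow> (real \<Rightarrow> 'a \<Rightarrow> nat \<Rightarrow> nat) \<Rightarrow> nat \<Rightarrow> tensor_op"
  where "mean_derivative M S k J K =
    vector_derivative (\<lambda>t. \<integral>\<omega>. tensor_product k (\<lambda>_. perm_matrix (S t \<omega>)) J K \<partial>M)
      (at 0 within {0..})"

definition log_kappa ::
    "(nat \<Rightarrow> 'a measure) \<Rightarrow> (nat \<Rightarrow> real \<Rightarrow> 'a \<Rightarrow> nat \<Rightarrow> nat) \<Rightarrow> nat \<Rightarrow> nat \<Rightarrow>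
      point set set \<Rightarrow> complex"
  where "log_kappa M S N k p = kappa N k (mean_derivative (M N) (S N) k) p"

text \<open>For \<open>p \<in> \<P>\<^sub>k\<close> the size \<open>k\<close> is recovered as the number of columns of \<open>\<Union>p\<close>.\<close>

definition log_cumulant ::
    "(nat \<Rightarrow> 'a measure) \<Rightarrow> (nat \<Rightarrow> real \<Rightarrow> 'a \<Rightarrow> nat \<Rightarrow> nat) \<Rightarrow> point set set \<Rightarrow> complex"
  where "log_cumulant M S p = lim (\<lambda>N. log_kappa M S N (card (columns (\<Union>p))) p)"

end

theory Submission
  imports Defs
begin

text \<open>By conjugation invariance, the entry \<open>(J, K)\<close> of \<open>G\<^sub>k\<^sup>N\<close> depends only on the kernel \<open>q\<close> of \<open>(J, K)\<close>:
  it is \<open>N / \<lambda>\<^sub>N(1\<^sup>c)\<close> times the proportion of injective labellings of the blocks of \<open>q\<close> that are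
  compatible with a fixed permutation of the class, minus the same quantity for the identity. With
  \<open>rank p = nc p - nc (p \<or> id\<^sub>k)\<close> the coefficients \<open>\<kappa>\<^sub>p\<close> solve the triangular system
  \<open>\<Sum>\<^bsub>p \<le> q\<^esub> N\<^bsup>- rank p\<^esup> \<kappa>\<^sub>p = g\<^sub>q\<close>, where \<open>N\<^bsup>rank q\<^esup> g\<^sub>q\<close> converges to some \<open>m\<^sub>q\<close>. As merging
  blocks cannot increase the rank, the coefficients converge, and their limits are the only solution of the
  system \<open>\<Sum> L\<^sub>p = m\<^sub>q\<close>, the sum being over the \<open>p \<le> q\<close> with the rank of \<open>q\<close>. That the claimed values
  solve it comes down to an alternating sum over the sets of ears of \<open>q\<close> attached to its head, which
  vanishes unless there is no such ear.\<close>

section \<open>Partitions as equivalence relations\<close>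

text \<open>In a compatible colouring the two points of a column carry \<open>x\<close> and
  \<open>\<sigma> x\<close>, so a column is an ear exactly when its label is a fixed point. Hence
  the head is coloured by moved points, and if it lies in one cycle these form a whole orbit
  (necklace) or a segment of an orbit (chain). A segment of length \<open>s\<close> can start at the
  points of period greater than \<open>s\<close>, whence the value
  \<open>1 - (\<Sum>i=2..s. lam i)\<close>. Evanescence acts twice. It makes almost all labels fixed
  points, so that a block outside the head contributes a full factor \<open>N\<close>. And if the
  head of \<open>q\<close> meets two of its \<open>c\<close> cycles, with \<open>n\<close> moved
  points there are at most \<open>n^2 * N^(c-2)\<close> compatible colourings; the normalisation by
  \<open>N / n\<close> and \<open>N^c\<close> leaves \<open>n / N\<close>, which tends to 0. When
  all columns of \<open>q\<close> are ears there is no head and the identity enters the sum. Its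
  value \<open>- k\<close> is forced: \<open>m_q\<close> is \<open>- nc q\<close>, because each
  block loses a proportion \<open>n / N\<close> of its labels, while the other \<open>p\<close>
  contribute, for each block with \<open>y\<close> columns, the signed number \<open>y - 1\<close>
  of its sets of at least two columns.\<close>

definition joined :: "'a set set \<Rightarrow> 'a \<Rightarrow> 'a \<Rightarrow> bool"
  where "joined p a b \<longleftrightarrow> (\<exists>X\<in>p. a \<in> X \<and> b \<in> X)"

text \<open>Meaningful when \<open>R\<close> is an equivalence relation on \<open>A\<close>.
  Partitions are built and compared through their relations, so that equalities of partitions become
  pointwise statements about \<open>joined\<close>.\<close>

definition classes :: "'a set \<Rightarrow> ('a \<Rightarrow> 'a \<Rightarrow> bool) \<Rightarrow> 'a set set"
  where "classes A R = (\<lambda>a. {b \<in> A. R a b}) ` A"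

lemma joined_sym: "joined p a b \<Longrightarrow> joined p b a"
  by (auto simp: joined_def)

lemma joined_commute: "joined p a b \<longleftrightarrow> joined p b a"
  by (auto simp: joined_def)

lemma block_eqI:
  assumes "partition_on A p" "X \<in> p" "Y \<in> p" "a \<in> X" "a \<in> Y"
  shows "X = Y"
  using assms by (auto simp: partition_on_def disjoint_def)

lemma block_subset: "partition_on A p \<Longrightarrow> X \<in> p \<Longrightarrow> X \<subseteq> A"
  by (auto simp: partition_on_def)

lemma joined_trans:
  assumes "partition_on A p" "joined p a b" "joined p b c"
  shows "joined p a c"
  using assms block_eqI[OF assms(1)] unfolding joined_def by metis

lemma joined_refl: "partition_on A p \<Longrightarrow> a \<in> A \<Longrightarrow> joined p a a"
  by (auto simp: partition_on_def joined_def)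

lemma joined_in: "partition_on A p \<Longrightarrow> joined p a b \<Longrightarrow> a \<in> A \<and> b \<in> A"
  by (auto simp: partition_on_def joined_def)

lemma joined_in_block:
  assumes "partition_on A p" "X \<in> p" "a \<in> X"
  shows "joined p a b \<longleftrightarrow> b \<in> X"
  using assms block_eqI[OF assms(1)] unfolding joined_def by metis

lemma block_eq_joined:
  assumes "partition_on A p" "X \<in> p" "a \<in> X"
  shows "X = {b. joined p a b}"
  using joined_in_block[OF assms] by auto

lemma obtain_block:
  assumes "partition_on A p" "a \<in> A"
  obtains X where "X \<in> p" "a \<in> X"
  using assms by (auto simp: partition_on_def)

lemma obtain_element:
  assumes "partition_on A p" "X \<in> p"
  obtains a where "a \<in> X" "a \<in> A"
  using assms block_subset[OF assms] that by (metis partition_onD3 equals0I subsetD)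

lemma joined_block_in:
  assumes "partition_on A p" "a \<in> A"
  shows "{b. joined p a b} \<in> p"
  using assms by (metis block_eq_joined obtain_block)

lemma partition_subsetI:
  assumes "partition_on A p" "partition_on A q" "\<And>a b. joined p a b \<longleftrightarrow> joined q a b"
  shows "p \<subseteq> q"
proof
  fix X assume X: "X \<in> p"
  then obtain a where a: "a \<in> X" "a \<in> A" using assms(1) obtain_element by blast
  then have "X = {b. joined q a b}" using block_eq_joined[OF assms(1) X] assms(3) by blast
  then show "X \<in> q" using joined_block_in[OF assms(2)] a by auto
qed

lemma partition_eqI:
  assumes "partition_on A p" "partition_on A q" "\<And>a b. joined p a b \<longleftrightarrow> joined q a b"
  shows "p = q"
  using partition_subsetI[OF assms] partition_subsetI[OF assms(2,1)] assms(3) by blast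

lemma refines_iff:
  assumes "partition_on A p" "partition_on A q"
  shows "refines A p q \<longleftrightarrow> (\<forall>a b. joined p a b \<longrightarrow> joined q a b)"
proof
  assume "refines A p q"
  then show "\<forall>a b. joined p a b \<longrightarrow> joined q a b"
    unfolding refines_def joined_def by (metis subsetD)
next
  assume *: "\<forall>a b. joined p a b \<longrightarrow> joined q a b"
  have "\<exists>Y\<in>q. X \<subseteq> Y" if X: "X \<in> p" for X
  proof -
    obtain a where a: "a \<in> X" "a \<in> A" using assms(1) X obtain_element by blast
    then have "X \<subseteq> {b. joined q a b}" using block_eq_joined[OF assms(1) X] * by blast
    then show ?thesis using joined_block_in[OF assms(2)] a by auto
  qed
  then show "refines A p q" using assms by (simp add: refines_def)
qed

lemma refinesD: "refines A p q \<Longrightarrow> joined p a b \<Longrightarrow> joined q a b"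
  unfolding refines_def joined_def by (metis subsetD)

lemma partition_on_classes:
  assumes "\<And>a. a \<in> A \<Longrightarrow> R a a"
    and "\<And>a b. a \<in> A \<Longrightarrow> b \<in> A \<Longrightarrow> R a b \<Longrightarrow> R b a"
    and "\<And>a b c. a \<in> A \<Longrightarrow> b \<in> A \<Longrightarrow> c \<in> A \<Longrightarrow> R a b \<Longrightarrow> R b c \<Longrightarrow> R a c"
  shows "partition_on A (classes A R)"
    and "joined (classes A R) a b \<longleftrightarrow> a \<in> A \<and> b \<in> A \<and> R a b"
proof -
  have iff: "R a c \<longleftrightarrow> R b c" if "a \<in> A" "b \<in> A" "c \<in> A" "R a b" for a b c
    using assms(3)[of a b c] assms(3)[of b a c] assms(2)[of a b] that by auto
  show "partition_on A (classes A R)"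
  proof (rule partition_onI)
    show "\<Union> (classes A R) = A" using assms(1) by (auto simp: classes_def)
    show "{} \<notin> classes A R"
      using assms(1) by (auto simp: classes_def)
    show "disjnt X Y" if XY: "X \<in> classes A R" "Y \<in> classes A R" "X \<noteq> Y" for X Y
    proof (rule ccontr)
      assume "\<not> disjnt X Y"
      then obtain c where c: "c \<in> X" "c \<in> Y" by (auto simp: disjnt_def)
      obtain a b where ab: "a \<in> A" "X = {z \<in> A. R a z}" "b \<in> A" "Y = {z \<in> A. R b z}"
        using XY unfolding classes_def by blast
      have "R a z \<longleftrightarrow> R b z" if "z \<in> A" for z
        using iff[of a c z] iff[of b c z] c ab that by simp
      then show False using XY(3) ab by blast
    qed
  qed
  show "joined (classes A R) a b \<longleftrightarrow> a \<in> A \<and> b \<in> A \<and> R a b"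
  proof
    assume "joined (classes A R) a b"
    then obtain c where "c \<in> A" "a \<in> A" "b \<in> A" "R c a" "R c b"
      unfolding joined_def classes_def by blast
    then show "a \<in> A \<and> b \<in> A \<and> R a b" using iff[of c a b] by simp
  next
    assume "a \<in> A \<and> b \<in> A \<and> R a b"
    then show "joined (classes A R) a b" using assms(1)
      unfolding joined_def classes_def by (intro bexI[of _ "{b \<in> A. R a b}"]) auto
  qed
qed

section \<open>The point set, its columns and the identity partition\<close>

lemma finite_points: "finite (points k)"
  by (simp add: points_def)

lemma finite_partition: "partition_on (points k) p \<Longrightarrow> finite p"
  using finite_elements finite_points by blast

lemma partitionsD: "p \<in> partitions k \<Longrightarrow> partition_on (points k) p"
  by (simp add: partitions_def)

lemma finite_partitions: "finite (partitions k)"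
  unfolding partitions_def using finitely_many_partition_on[OF finite_points] by simp

abbreviation col :: "point \<Rightarrow> nat"
  where "col \<equiv> case_sum id id"

lemma in_points_iff: "a \<in> points k \<longleftrightarrow> col a \<in> {1..k}"
  by (cases a) (auto simp: points_def)

lemma Inl_in_points [simp]: "Inl i \<in> points k \<longleftrightarrow> i \<in> {1..k}"
  and Inr_in_points [simp]: "Inr i \<in> points k \<longleftrightarrow> i \<in> {1..k}"
  by (auto simp: points_def)

lemma joined_id_part: "joined (id_part k) a b \<longleftrightarrow> a \<in> points k \<and> b \<in> points k \<and> col a = col b"
  by (cases a; cases b) (auto simp: joined_def id_part_def)

lemma id_part_eq_classes: "id_part k = classes (points k) (\<lambda>a b. col a = col b)"
proof -
  have "{b \<in> points k. col a = col b} = {Inl (col a), Inr (col a)}" if "a \<in> points k" for a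
  proof -
    have "b \<in> points k \<and> col a = col b \<longleftrightarrow> b = Inl (col a) \<or> b = Inr (col a)" for b
      using that by (cases a; cases b) auto
    then show ?thesis by blast
  qed
  moreover have "col ` points k = {1..k}"
    by (force simp: points_def)
  ultimately have "classes (points k) (\<lambda>a b. col a = col b) = (\<lambda>i. {Inl i, Inr i}) ` col ` points k"
    unfolding classes_def image_image by (intro image_cong) auto
  then show ?thesis using \<open>col ` points k = {1..k}\<close> by (simp add: id_part_def)
qed

lemma partition_on_id_part: "partition_on (points k) (id_part k)"
  unfolding id_part_eq_classes by (rule partition_on_classes) auto

lemma id_part_in_partitions: "id_part k \<in> partitions k"
  by (simp add: partitions_def partition_on_id_part)

text \<open>Replaces the definite description in \<open>sup_part\<close> by the universal property
  of the join.\<close>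

lemma cycles_of_props:
  assumes "p \<in> partitions k"
  shows "refines (points k) p (cycles_of k p)"
    and "refines (points k) (id_part k) (cycles_of k p)"
    and "refines (points k) p r \<Longrightarrow> refines (points k) (id_part k) r \<Longrightarrow> refines (points k) (cycles_of k p) r"
  using theI'[OF sup_part_unique_existence[OF partitionsD[OF assms] partition_on_id_part[of k]]]
  unfolding cycles_of_def sup_part_def by blast+

lemma cycles_of_eqI:
  assumes "p \<in> partitions k" "refines (points k) p c" "refines (points k) (id_part k) c"
    "\<And>r. refines (points k) p r \<Longrightarrow> refines (points k) (id_part k) r \<Longrightarrow> refines (points k) c r"
  shows "cycles_of k p = c"
  using cycles_of_props[OF assms(1)] assms by (meson refines_asym)

lemma partition_on_cycles_of: "p \<in> partitions k \<Longrightarrow> partition_on (points k) (cycles_of k p)"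
  using cycles_of_props(1) by (auto simp: refines_def)

section \<open>The rank of a partition\<close>

definition part_rank :: "nat \<Rightarrow> point set set \<Rightarrow> int"
  where "part_rank k p = int (nc p) - int (nc (cycles_of k p))"

text \<open>The unions of blocks, described without reference to the blocks. The join of two
  partitions corresponds to the intersection of these families, which makes \<open>cycles_of\<close>
  accessible to counting.\<close>

definition saturated :: "'a set \<Rightarrow> 'a set set \<Rightarrow> 'a set set"
  where "saturated A p = {S. S \<subseteq> A \<and> (\<forall>a b. joined p a b \<longrightarrow> a \<in> S \<longrightarrow> b \<in> S)}"

lemma saturatedD: "S \<in> saturated A p \<Longrightarrow> joined p a b \<Longrightarrow> a \<in> S \<Longrightarrow> b \<in> S"
  unfolding saturated_def by simp

lemma saturated_mono:
  assumes "\<And>a b. joined p a b \<Longrightarrow> joined q a b"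
  shows "saturated A q \<subseteq> saturated A p"
  unfolding saturated_def using assms by (intro Collect_mono) metis

text \<open>A saturated set is the union of the blocks that it contains, and distinct families of
  blocks have distinct unions.\<close>

lemma card_saturated:
  assumes "finite A" "partition_on A p"
  shows "card (saturated A p) = 2 ^ card p"
proof -
  have "bij_betw Union (Pow p) (saturated A p)"
  proof (rule bij_betwI')
    fix P Q assume PQ: "P \<in> Pow p" "Q \<in> Pow p"
    have sub: "P \<subseteq> Q" if PQ: "P \<subseteq> p" "Q \<subseteq> p" "\<Union>P = \<Union>Q" for P Q
    proof
      fix X assume X: "X \<in> P"
      then have "X \<in> p" using PQ(1) by blast
      then obtain a where a: "a \<in> X" using obtain_element[OF assms(2)] by metis
      then obtain Y where "Y \<in> Q" "a \<in> Y" using PQ(3) X a by blast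
      then show "X \<in> Q" using block_eqI[OF assms(2)] a X PQ by blast
    qed
    show "(\<Union>P = \<Union>Q) = (P = Q)"
      using sub[of P Q] sub[of Q P] PQ by (metis PowD subset_antisym)
  next
    fix P assume P: "P \<in> Pow p"
    have "\<forall>a b. joined p a b \<longrightarrow> a \<in> \<Union>P \<longrightarrow> b \<in> \<Union>P"
      using P joined_in_block[OF assms(2)] by (metis PowD UnionE UnionI subsetD)
    moreover have "\<Union>P \<subseteq> A" using P block_subset[OF assms(2)] by (meson PowD Sup_least subsetD)
    ultimately show "\<Union>P \<in> saturated A p" unfolding saturated_def by simp
  next
    fix S assume S: "S \<in> saturated A p"
    have SA: "S \<subseteq> A" using S by (simp add: saturated_def)
    have "a \<in> \<Union>{X\<in>p. X \<subseteq> S}" if a: "a \<in> S" for a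
    proof -
      have "a \<in> A" using SA a by blast
      then obtain X where X: "X \<in> p" "a \<in> X" by (rule obtain_block[OF assms(2)])
      have "X \<subseteq> S"
      proof
        fix b assume "b \<in> X"
        then have "joined p a b" using joined_in_block[OF assms(2) X] by simp
        then show "b \<in> S" using saturatedD[OF S] a by blast
      qed
      then show ?thesis using X by blast
    qed
    then have "S = \<Union>{X\<in>p. X \<subseteq> S}" by blast
    then show "\<exists>P\<in>Pow p. S = \<Union>P" by (intro bexI[of _ "{X\<in>p. X \<subseteq> S}"]) auto
  qed
  then show ?thesis
    using finite_elements[OF assms] by (simp add: bij_betw_same_card[symmetric] card_Pow)
qed

lemma saturated_cycles_of:
  assumes p: "p \<in> partitions k"
  shows "saturated (points k) (cycles_of k p) = saturated (points k) p \<inter> saturated (points k) (id_part k)"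
proof (intro equalityI subsetI)
  fix S assume "S \<in> saturated (points k) (cycles_of k p)"
  then show "S \<in> saturated (points k) p \<inter> saturated (points k) (id_part k)"
    using saturated_mono[OF refinesD[OF cycles_of_props(1)[OF p]]]
      saturated_mono[OF refinesD[OF cycles_of_props(2)[OF p]]] by (meson IntI subsetD)
next
  let ?A = "points k"
  fix S assume S: "S \<in> saturated ?A p \<inter> saturated ?A (id_part k)"
  \<comment> \<open>The partition into \<open>S\<close> and its complement lies above
    \<open>p\<close> and above the identity, hence above their join.\<close>
  define r where "r = classes ?A (\<lambda>a b. a \<in> S \<longleftrightarrow> b \<in> S)"
  have r: "partition_on ?A r" "\<And>a b. joined r a b \<longleftrightarrow> a \<in> ?A \<and> b \<in> ?A \<and> (a \<in> S \<longleftrightarrow> b \<in> S)"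
    unfolding r_def by (rule partition_on_classes; auto)+
  have ref: "refines ?A q r" if q: "partition_on ?A q" "S \<in> saturated ?A q" for q
    unfolding refines_iff[OF q(1) r(1)] r(2)
    using joined_in[OF q(1)] joined_sym[of q] saturatedD[OF q(2)] by meson
  have "refines ?A (cycles_of k p) r"
    by (intro cycles_of_props(3)[OF p] ref) (use S partitionsD[OF p] partition_on_id_part in auto)
  then show "S \<in> saturated ?A (cycles_of k p)"
    using S refinesD[of ?A "cycles_of k p" r] r(2) unfolding saturated_def by auto
qed

text \<open>The saturated sets of \<open>p\<close> form a vector space of dimension \<open>nc p\<close> over the field with two
  elements, so this is the dimension formula for the sum of two subspaces.\<close>

lemma rank_antimono:
  assumes p: "p \<in> partitions k" and q: "q \<in> partitions k" and le: "refines (points k) p q"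
  shows "part_rank k q \<le> part_rank k p"
proof -
  let ?A = "points k" and ?xor = "\<lambda>S T :: point set. (S - T) \<union> (T - S)"
  let ?V = "saturated (points k)"
  have P: "partition_on ?A p" and Q: "partition_on ?A q"
    using p q partitionsD by auto
  have fin: "finite (?V r)" for r
    by (rule finite_subset[of _ "Pow ?A"]) (auto simp: saturated_def finite_points)
  have xor: "?xor S T \<in> ?V r" if "S \<in> ?V r" "T \<in> ?V r" for S T r
  proof -
    have "a \<in> S \<longleftrightarrow> b \<in> S" "a \<in> T \<longleftrightarrow> b \<in> T" if "joined r a b" for a b
      using saturatedD[OF \<open>S \<in> ?V r\<close>] saturatedD[OF \<open>T \<in> ?V r\<close>] that joined_sym[OF that] by blast+
    then show ?thesis using that unfolding saturated_def by simp blast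
  qed
  have sub: "?V q \<subseteq> ?V p" by (rule saturated_mono) (rule refinesD[OF le])
  let ?X = "?V (cycles_of k p) \<times> ?V q" and ?Y = "?V p \<times> ?V (cycles_of k q)"
  define f where "f = (\<lambda>(S, T). ?xor S T)"
  define g where "g = (\<lambda>U. SOME z. z \<in> ?X \<and> f z = U)"
  have g: "g (f z) \<in> ?X \<and> f (g (f z)) = f z" if "z \<in> ?X" for z
    unfolding g_def by (rule someI[of _ z]) (use that in auto)
  \<comment> \<open>Two members \<open>(S, T)\<close> and \<open>(S', T')\<close> of one fibre of
    \<open>f\<close> satisfy \<open>?xor S S' = ?xor T T'\<close>. This set is saturated for the
    identity and for \<open>q\<close>, hence for the cycles of \<open>q\<close>. Recording the value
    of \<open>f\<close> together with this difference from a chosen member of the fibre is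
    injective, which replaces the count of image and kernel.\<close>
  define F where "F = (\<lambda>z. (f z, ?xor (fst z) (fst (g (f z)))))"
  have "inj_on F ?X"
  proof (rule inj_onI)
    fix z w assume "z \<in> ?X" "w \<in> ?X" "F z = F w"
    then have e: "f z = f w" "?xor (fst z) (fst (g (f z))) = ?xor (fst w) (fst (g (f z)))"
      by (auto simp: F_def)
    have "fst z = fst w" using e(2) by blast
    moreover have "snd z = snd w"
      using e(1) \<open>fst z = fst w\<close> unfolding f_def by (cases z; cases w; simp) blast
    ultimately show "z = w" by (simp add: prod_eq_iff)
  qed
  moreover have "F ` ?X \<subseteq> ?Y"
  proof
    fix y assume "y \<in> F ` ?X"
    then obtain z where z: "z \<in> ?X" "y = F z" by blast
    obtain S T where ST: "z = (S, T)" by (cases z)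
    obtain S' T' where ST': "g (f z) = (S', T')" by (cases "g (f z)")
    have m: "S \<in> ?V (cycles_of k p)" "T \<in> ?V q" "S' \<in> ?V (cycles_of k p)" "T' \<in> ?V q"
      using z(1) ST g[OF z(1)] ST' by auto
    have eq: "?xor S' T' = ?xor S T"
      using g[OF z(1)] ST' ST by (simp add: f_def)
    have S: "S \<in> ?V p" "S' \<in> ?V p" "S \<in> ?V (id_part k)" "S' \<in> ?V (id_part k)"
      using m saturated_cycles_of[OF p] by auto
    have "f z \<in> ?V p" unfolding f_def ST prod.case using xor S m sub by blast
    moreover have "?xor S S' = ?xor T T'" using eq by blast
    then have "?xor S S' \<in> ?V (cycles_of k q)"
      using saturated_cycles_of[OF q] xor[OF m(2) m(4)] xor[OF S(3) S(4)] by auto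
    ultimately show "y \<in> ?Y" using z(2) ST ST' by (auto simp: F_def)
  qed
  ultimately have "card ?X \<le> card ?Y"
    by (intro card_inj_on_le) (auto simp: fin)
  then have "(2::nat) ^ (nc (cycles_of k p) + nc q) \<le> 2 ^ (nc p + nc (cycles_of k q))"
    using P Q partition_on_cycles_of[OF p] partition_on_cycles_of[OF q]
    by (simp add: card_cartesian_product card_saturated finite_points power_add)
  then have "nc (cycles_of k p) + nc q \<le> nc p + nc (cycles_of k q)"
    by (rule power_le_imp_le_exp[rotated]) simp
  then show ?thesis by (simp add: part_rank_def)
qed

section \<open>Cycles, ears and labelled heads\<close>

text \<open>No block leads out of \<open>D\<close>: among the columns of \<open>p\<close>, the set
  \<open>D\<close> is a union of cycles. This expresses connectedness without the join.\<close>

definition closed_cols :: "point set set \<Rightarrow> nat set \<Rightarrow> bool"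
  where "closed_cols p D \<longleftrightarrow> (\<forall>a b. joined p a b \<longrightarrow> col a \<in> D \<longrightarrow> col b \<in> D)"

text \<open>All columns in \<open>A\<close> lie in the same cycle of \<open>p\<close>.\<close>

definition single_cycle :: "point set set \<Rightarrow> nat set \<Rightarrow> bool"
  where "single_cycle p A \<longleftrightarrow> (\<forall>D. closed_cols p D \<longrightarrow> A \<subseteq> D \<or> A \<inter> D = {})"

text \<open>The columns on which \<open>p\<close> differs from the identity. An ear that shares its
  block with other columns is active; an ear that is a block on its own is not.\<close>

definition active :: "nat \<Rightarrow> point set set \<Rightarrow> nat set"
  where "active k p = {i \<in> {1..k}. {Inl i, Inr i} \<notin> p}"

text \<open>The columns of the head, in their original numbering.\<close>

definition nonears :: "nat \<Rightarrow> point set set \<Rightarrow> nat set"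
  where "nonears k p = {i \<in> {1..k}. \<not> joined p (Inl i) (Inr i)}"

definition touching :: "point set set \<Rightarrow> nat set \<Rightarrow> point set set"
  where "touching p A = {X \<in> p. \<exists>a\<in>X. col a \<in> A}"

lemma closed_colsD: "closed_cols p D \<Longrightarrow> joined p a b \<Longrightarrow> col a \<in> D \<Longrightarrow> col b \<in> D"
  unfolding closed_cols_def by blast

lemma closed_cols_refines: "refines A p q \<Longrightarrow> closed_cols q D \<Longrightarrow> closed_cols p D"
  unfolding closed_cols_def using refinesD by metis

lemma single_cycle_refines: "refines A p q \<Longrightarrow> single_cycle p B \<Longrightarrow> single_cycle q B"
  unfolding single_cycle_def using closed_cols_refines by metis

lemma single_cycle_subset: "single_cycle p A \<Longrightarrow> B \<subseteq> A \<Longrightarrow> single_cycle p B"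
  unfolding single_cycle_def by blast

lemma finite_active: "finite (active k p)"
  and finite_nonears: "finite (nonears k p)"
  by (simp_all add: active_def nonears_def)

lemma nonears_subset: "nonears k p \<subseteq> {1..k}"
  by (auto simp: nonears_def)

lemma nonears_subset_active: "nonears k p \<subseteq> active k p"
proof
  fix i assume i: "i \<in> nonears k p"
  have "joined p (Inl i) (Inr i)" if "{Inl i, Inr i} \<in> p"
    unfolding joined_def using that by (intro bexI[of _ "{Inl i, Inr i}"]) auto
  then show "i \<in> active k p" using i by (auto simp: nonears_def active_def)
qed

lemma nonears_antimono: "refines A p q \<Longrightarrow> nonears k q \<subseteq> nonears k p"
proof
  fix i assume "refines A p q" "i \<in> nonears k q"
  then show "i \<in> nonears k p" using refinesD[of A p q "Inl i" "Inr i"] by (auto simp: nonears_def)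
qed

lemma joined_inactive:
  assumes p: "p \<in> partitions k" and a: "a \<in> points k" "col a \<notin> active k p"
  shows "joined p a b \<longleftrightarrow> b \<in> points k \<and> col b = col a"
proof -
  have "{Inl (col a), Inr (col a)} \<in> p"
    using a by (auto simp: active_def in_points_iff)
  moreover have "a \<in> {Inl (col a), Inr (col a)}" by (cases a) auto
  ultimately have "joined p a b \<longleftrightarrow> b \<in> {Inl (col a), Inr (col a)}"
    by (rule joined_in_block[OF partitionsD[OF p]])
  also have "\<dots> \<longleftrightarrow> b \<in> points k \<and> col b = col a"
    using a by (cases b) (auto simp: in_points_iff)
  finally show ?thesis .
qed

lemma active_empty_iff:
  assumes p: "p \<in> partitions k"
  shows "active k p = {} \<longleftrightarrow> p = id_part k"
proof
  assume e: "active k p = {}"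
  show "p = id_part k"
  proof (rule partition_eqI[OF partitionsD[OF p] partition_on_id_part])
    fix a b
    show "joined p a b = joined (id_part k) a b"
      using joined_inactive[OF p, of a b] joined_in[OF partitionsD[OF p], of a b] e
      by (auto simp: joined_id_part)
  qed
next
  assume "p = id_part k"
  then show "active k p = {}" by (auto simp: active_def id_part_def)
qed

lemma joined_ear: "i \<in> {1..k} \<Longrightarrow> i \<notin> nonears k p \<Longrightarrow> joined p (Inl i) (Inr i)"
  by (simp add: nonears_def)

lemma joined_ear_col:
  assumes p: "p \<in> partitions k" and a: "a \<in> points k" "col a \<notin> nonears k p" "col b = col a"
  shows "joined p a b"
proof -
  have i: "col a \<in> {1..k}" using a by (simp add: in_points_iff)
  have "joined p (Inl (col a)) (Inr (col a))" using joined_ear[OF i a(2)] .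
  then show ?thesis
    using a i joined_sym joined_refl[OF partitionsD[OF p]] by (cases a; cases b) auto
qed

text \<open>Outside \<open>A\<close> all columns are ears, so their two points are in one block
  already and the join with the identity changes nothing there. Over \<open>A\<close> it merges all
  the blocks that touch \<open>A\<close>, because no closed set of columns separates
  \<open>A\<close>.\<close>

lemma cycles_of_single:
  assumes p: "p \<in> partitions k" and A: "A \<noteq> {}" "A \<subseteq> {1..k}"
    and single: "single_cycle p A" and ears: "nonears k p \<subseteq> A"
  shows "cycles_of k p = insert (\<Union>(touching p A)) (p - touching p A)"
    and "\<Union>(touching p A) \<notin> p - touching p A"
proof -
  let ?t = "touching p A"
  define c where "c = insert (\<Union>?t) (p - ?t)"
  note P = partitionsD[OF p]
  have t: "?t \<subseteq> p" by (auto simp: touching_def)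
  have disj: "X \<inter> Y = {}" if "X \<in> p" "Y \<in> p" "X \<noteq> Y" for X Y
    using block_eqI[OF P] that by blast
  have inC: "a \<in> \<Union>?t" if a: "a \<in> points k" "col a \<in> A" for a
  proof -
    obtain X where "X \<in> p" "a \<in> X" using obtain_block[OF P a(1)] by blast
    then show ?thesis using a by (auto simp: touching_def)
  qed
  obtain i0 where i0: "i0 \<in> A" using A by blast
  have "Inl i0 \<in> \<Union>?t" by (rule inC) (use i0 A in auto)
  then have ne: "\<Union>?t \<noteq> {}" by blast
  show notin: "\<Union>?t \<notin> p - ?t"
  proof
    assume *: "\<Union>?t \<in> p - ?t"
    obtain X where X: "X \<in> ?t" "Inl i0 \<in> X" using \<open>Inl i0 \<in> \<Union>?t\<close> by blast
    then have "X = \<Union>?t" using block_eqI[OF P, of X "\<Union>?t" "Inl i0"] * t by blast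
    then show False using X * by simp
  qed
  have c: "partition_on (points k) c"
  proof (rule partition_onI)
    have "\<Union>c = \<Union>p" unfolding c_def using t by blast
    then show "\<Union>c = points k" using P by (simp add: partition_on_def)
    show "{} \<notin> c" using ne P by (auto simp: c_def partition_on_def)
    have d: "disjnt (\<Union>?t) Y" if Y: "Y \<in> p - ?t" for Y
    proof -
      have "X \<inter> Y = {}" if "X \<in> ?t" for X using disj[of X Y] that Y t by (metis DiffE subsetD)
      then show ?thesis unfolding disjnt_def by blast
    qed
    fix X Y assume "X \<in> c" "Y \<in> c" "X \<noteq> Y"
    then consider "X \<in> p - ?t" "Y \<in> p - ?t" | "X = \<Union>?t" "Y \<in> p - ?t" | "Y = \<Union>?t" "X \<in> p - ?t"
      unfolding c_def by blast
    then show "disjnt X Y"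
    proof cases
      case 1 then show ?thesis using disj[of X Y] \<open>X \<noteq> Y\<close> by (auto simp: disjnt_def)
    next
      case 2 then show ?thesis using d by simp
    next
      case 3 then show ?thesis using d by (simp add: disjnt_sym)
    qed
  qed
  have pc: "refines (points k) p c"
    unfolding refines_def using P c by (auto simp: c_def)
  have ic: "refines (points k) (id_part k) c"
    unfolding refines_iff[OF partition_on_id_part c]
  proof (intro allI impI)
    fix a b assume ab: "joined (id_part k) a b"
    then have ab': "a \<in> points k" "b \<in> points k" "col a = col b" by (auto simp: joined_id_part)
    show "joined c a b"
    proof (cases "col a \<in> A")
      case True
      then have "a \<in> \<Union>?t" "b \<in> \<Union>?t" using inC ab' by auto
      then show ?thesis unfolding joined_def c_def by (intro bexI[of _ "\<Union>?t"]) simp_all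
    next
      case False
      then have "joined p a b" using joined_ear_col[OF p ab'(1)] ears ab' by auto
      then show ?thesis using refinesD[OF pc] by blast
    qed
  qed
  have "cycles_of k p = c"
  proof (rule cycles_of_eqI[OF p pc ic])
    fix r assume r: "refines (points k) p r" "refines (points k) (id_part k) r"
    then have R: "partition_on (points k) r" by (simp add: refines_def)
    have i0p: "Inl i0 \<in> points k" using i0 A by auto
    obtain Y where Y: "Y \<in> r" "Inl i0 \<in> Y" by (rule obtain_block[OF R i0p])
    note jY = joined_in_block[OF R Y(1)]
    have same: "a \<in> Y \<longleftrightarrow> Inl (col a) \<in> Y" if "a \<in> points k" for a
    proof -
      have "joined r a (Inl (col a))"
        by (rule refinesD[OF r(2)]) (use that in \<open>auto simp: joined_id_part in_points_iff\<close>)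
      then show ?thesis using jY joined_sym by metis
    qed
    \<comment> \<open>The columns over the block \<open>Y\<close> of an arbitrary upper bound
      \<open>r\<close>. They are closed for \<open>p\<close> and contain \<open>i0\<close>, so they
      contain all of \<open>A\<close>.\<close>
    define D where "D = {i. Inl i \<in> Y}"
    have "closed_cols p D"
      unfolding closed_cols_def
    proof (intro allI impI)
      fix a b assume ab: "joined p a b" "col a \<in> D"
      have pts: "a \<in> points k" "b \<in> points k" using joined_in[OF P ab(1)] by auto
      have "a \<in> Y" using ab same[OF pts(1)] by (simp add: D_def)
      then have "b \<in> Y" using refinesD[OF r(1) ab(1)] jY by blast
      then show "col b \<in> D" using same[OF pts(2)] by (simp add: D_def)
    qed
    then have AD: "A \<subseteq> D" using single i0 Y unfolding single_cycle_def D_def by blast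
    have "\<Union>?t \<subseteq> Y"
    proof
      fix x assume "x \<in> \<Union>?t"
      then obtain X b where X: "X \<in> p" "x \<in> X" "b \<in> X" "col b \<in> A" by (auto simp: touching_def)
      then have "joined p b x" "b \<in> points k" using block_subset[OF P] by (auto simp: joined_def)
      moreover have "b \<in> Y" using X(4) AD same[OF \<open>b \<in> points k\<close>] by (auto simp: D_def)
      ultimately show "x \<in> Y" using refinesD[OF r(1)] jY by blast
    qed
    then have "\<forall>X\<in>c. \<exists>Y\<in>r. X \<subseteq> Y" using Y r(1) by (auto simp: c_def refines_def)
    then show "refines (points k) c r" using R c by (simp add: refines_def)
  qed
  then show "cycles_of k p = insert (\<Union>?t) (p - ?t)" by (simp add: c_def)
qed

lemma rank_single:
  assumes p: "p \<in> partitions k" and A: "A \<noteq> {}" "A \<subseteq> {1..k}"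
    and "single_cycle p A" "nonears k p \<subseteq> A"
  shows "part_rank k p = int (card (touching p A)) - 1"
proof -
  have fin: "finite p" "touching p A \<subseteq> p"
    using finite_partition[OF partitionsD[OF p]] by (auto simp: touching_def)
  have "card (touching p A) \<le> card p" using fin by (rule card_mono)
  moreover have "card (p - touching p A) = card p - card (touching p A)"
    using fin finite_subset by (metis card_Diff_subset)
  ultimately show ?thesis
    unfolding part_rank_def cycles_of_single(1)[OF assms]
    using cycles_of_single(2)[OF assms] fin by simp
qed

text \<open>The points over closed columns form a set that is saturated for \<open>p\<close> and for
  the identity, hence for their join.\<close>

lemma closed_cols_cycles_of:
  assumes p: "p \<in> partitions k" and D: "closed_cols p D" and ab: "joined (cycles_of k p) a b" "col a \<in> D"
  shows "col b \<in> D"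
proof -
  let ?S = "{c \<in> points k. col c \<in> D}"
  have "?S \<in> saturated (points k) p"
    using closed_colsD[OF D] joined_in[OF partitionsD[OF p]] unfolding saturated_def by simp
  moreover have "?S \<in> saturated (points k) (id_part k)"
    by (auto simp: saturated_def joined_id_part)
  ultimately have "?S \<in> saturated (points k) (cycles_of k p)"
    using saturated_cycles_of[OF p] by simp
  moreover have "a \<in> ?S" using ab joined_in[OF partition_on_cycles_of[OF p] ab(1)] by simp
  ultimately have "b \<in> ?S" by (rule saturatedD[OF _ ab(1)])
  then show ?thesis by simp
qed

text \<open>The bound \<open>k \<ge> 1\<close> has to be stated because the empty partition has no
  cycle at all, while \<open>single_cycle\<close> holds vacuously for it.\<close>

lemma irreducible_iff:
  "irreducible_part k p \<longleftrightarrow> p \<in> partitions k \<and> k \<ge> 1 \<and> single_cycle p {1..k}"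
proof
  assume irr: "irreducible_part k p"
  then have p: "p \<in> partitions k" and "nc (cycles_of k p) = 1"
    by (auto simp: irreducible_part_def)
  then obtain Z where Z: "cycles_of k p = {Z}" using card_1_singletonE by blast
  then have c: "partition_on (points k) {Z}" using partition_on_cycles_of[OF p] by simp
  then have Z': "Z = points k" "Z \<noteq> {}" by (auto simp: partition_on_def)
  have "k \<ge> 1" using Z' by (cases k) (auto simp: points_def)
  moreover have "{1..k} \<subseteq> D" if D: "closed_cols p D" "i \<in> D" "i \<in> {1..k}" for D i
  proof
    fix j assume "j \<in> {1..k}"
    then have "joined (cycles_of k p) (Inl i) (Inl j)"
      unfolding Z Z' joined_def using D by auto
    then show "j \<in> D" using closed_cols_cycles_of[OF p D(1)] D(2) by force
  qed
  ultimately show "p \<in> partitions k \<and> k \<ge> 1 \<and> single_cycle p {1..k}"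
    using p unfolding single_cycle_def by blast
next
  assume a: "p \<in> partitions k \<and> k \<ge> 1 \<and> single_cycle p {1..k}"
  have t: "touching p {1..k} = p"
  proof -
    have "\<exists>a\<in>X. col a \<in> {1..k}" if "X \<in> p" for X
      using obtain_element[OF partitionsD that] a in_points_iff by metis
    then show ?thesis by (auto simp: touching_def)
  qed
  have "cycles_of k p = insert (\<Union>(touching p {1..k})) (p - touching p {1..k})"
    by (rule cycles_of_single) (use a nonears_subset in auto)
  then have "cycles_of k p = {\<Union>p}" unfolding t by simp
  then show "irreducible_part k p" using a by (simp add: irreducible_part_def)
qed

lemma cycles_of_irreducible:
  assumes "irreducible_part k p"
  shows "cycles_of k p = {points k}"
proof -
  have p: "p \<in> partitions k" and "nc (cycles_of k p) = 1"
    using assms by (auto simp: irreducible_part_def)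
  then obtain Z where Z: "cycles_of k p = {Z}" using card_1_singletonE by blast
  then have "partition_on (points k) {Z}" using partition_on_cycles_of[OF p] by simp
  then show ?thesis using Z by (auto simp: partition_on_def)
qed

text \<open>A necklace (chain) without reference to the numbering of its columns: the columns carry their
  position along the cycle (path), and the block of the point \<open>i\<close> is that of the points \<open>j'\<close> for
  which \<open>j\<close> is one position earlier.\<close>

definition labelling :: "(nat \<Rightarrow> nat) \<Rightarrow> point set set \<Rightarrow> nat set \<Rightarrow> nat \<Rightarrow> (nat \<Rightarrow> nat) \<Rightarrow> bool"
  where "labelling step p B s h \<longleftrightarrow> s \<ge> 1 \<and> h ` B = {0..<s} \<and>
    (\<forall>i\<in>B. \<forall>j\<in>B. (joined p (Inl i) (Inl j) \<longleftrightarrow> h i = h j) \<and>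
       (joined p (Inr i) (Inr j) \<longleftrightarrow> h i = h j) \<and>
       (joined p (Inl i) (Inr j) \<longleftrightarrow> h i = step (h j)))"

definition necklace_like :: "point set set \<Rightarrow> nat set \<Rightarrow> nat \<Rightarrow> bool"
  where "necklace_like p B s \<longleftrightarrow> (\<exists>h. labelling (\<lambda>x. Suc x mod s) p B s h)"

definition chain_like :: "point set set \<Rightarrow> nat set \<Rightarrow> nat \<Rightarrow> bool"
  where "chain_like p B s \<longleftrightarrow> (\<exists>h. labelling Suc p B s h)"

text \<open>The fibres of both labellings are the classes of \<open>joined\<close> on the unprimed
  points, so \<open>s\<close> and \<open>t\<close> count the same classes, whatever the two step
  functions are.\<close>

lemma labelling_unique:
  assumes "labelling f p B s h" "labelling g p B t h'"
  shows "s = t"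
proof -
  have eq: "h i = h j \<longleftrightarrow> h' i = h' j" if "i \<in> B" "j \<in> B" for i j
    using assms that by (auto simp: labelling_def)
  define f where "f = (\<lambda>x. h' (SOME i. i \<in> B \<and> h i = x))"
  have f: "f (h i) = h' i" if "i \<in> B" for i
  proof -
    have "(SOME j. j \<in> B \<and> h j = h i) \<in> B \<and> h (SOME j. j \<in> B \<and> h j = h i) = h i"
      by (rule someI[of _ i]) (use that in auto)
    then show ?thesis using eq that by (auto simp: f_def)
  qed
  have "bij_betw f (h ` B) (h' ` B)"
    unfolding bij_betw_def inj_on_def using f eq by (auto simp: image_image)
  then have "card (h ` B) = card (h' ` B)" by (rule bij_betw_same_card)
  then show ?thesis using assms by (simp add: labelling_def)
qed

lemma necklace_like_unique: "necklace_like p B s \<Longrightarrow> necklace_like p B t \<Longrightarrow> s = t"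
  and chain_like_unique: "chain_like p B s \<Longrightarrow> chain_like p B t \<Longrightarrow> s = t"
  unfolding necklace_like_def chain_like_def by (elim exE, rule labelling_unique, assumption+)+

text \<open>An unprimed point at position 0 of a chain is joined with no primed point over
  \<open>B\<close>, whereas every position of a necklace has a predecessor. Adding
  \<open>t - 1\<close> modulo \<open>t\<close> is the passage to that predecessor.\<close>

lemma chain_not_necklace: "chain_like p B s \<Longrightarrow> \<not> necklace_like p B t"
proof
  assume "chain_like p B s" "necklace_like p B t"
  then obtain h h' where h: "labelling Suc p B s h" and h': "labelling (\<lambda>x. Suc x mod t) p B t h'"
    by (auto simp: chain_like_def necklace_like_def)
  have "0 \<in> h ` B" using h by (auto simp: labelling_def)
  then obtain i where i: "i \<in> B" "h i = 0" by auto
  have "h' i < t" using h' i by (auto simp: labelling_def)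
  moreover have "(h' i + (t - 1)) mod t \<in> h' ` B" using h' by (auto simp: labelling_def)
  then obtain j where j: "j \<in> B" "h' j = (h' i + (t - 1)) mod t" by auto
  ultimately have "h' i = Suc (h' j) mod t" by (simp add: mod_Suc_eq)
  then have "joined p (Inl i) (Inr j)" using h' i j by (simp add: labelling_def)
  then show False using h i j by (simp add: labelling_def)
qed

text \<open>The value claimed for a partition with head on the columns \<open>B\<close>, up to the
  sign from the ears; the value 1 for an empty head is \<open>lam 0\<close>. The definite
  descriptions are well defined because the length of a labelling is unique.\<close>

definition weight :: "(nat \<Rightarrow> real) \<Rightarrow> point set set \<Rightarrow> nat set \<Rightarrow> real"
  where "weight lam p B =
    (if B = {} then 1
     else if \<exists>s. necklace_like p B s then lam (THE s. necklace_like p B s)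
     else if \<exists>s. chain_like p B s then 1 - (\<Sum>i=2..(THE s. chain_like p B s). lam i)
     else 0)"

lemma like_nonempty:
  "necklace_like p B s \<Longrightarrow> B \<noteq> {}" "chain_like p B s \<Longrightarrow> B \<noteq> {}"
  by (auto simp: necklace_like_def chain_like_def labelling_def)

lemma weight_necklace: "necklace_like p B s \<Longrightarrow> weight lam p B = lam s"
proof -
  assume a: "necklace_like p B s"
  then have "(THE s. necklace_like p B s) = s" using necklace_like_unique by blast
  then show ?thesis using a like_nonempty(1)[OF a] unfolding weight_def by auto
qed

lemma weight_chain:
  assumes "chain_like p B s"
  shows "weight lam p B = 1 - (\<Sum>i=2..s. lam i)"
proof -
  have "(THE s. chain_like p B s) = s" using assms chain_like_unique by blast
  then show ?thesis
    using assms chain_not_necklace[OF assms] like_nonempty(2)[OF assms] unfolding weight_def by auto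
qed

section \<open>Transport of labellings along bijections of columns\<close>

lemma labelling_transfer:
  assumes h: "labelling f p B s h" and bij: "bij_betw r B B'"
    and j: "\<And>a b. col a \<in> B \<Longrightarrow> col b \<in> B \<Longrightarrow> joined p' (map_sum r r a) (map_sum r r b) \<longleftrightarrow> joined p a b"
  shows "labelling f p' B' s (h \<circ> inv_into B r)"
proof -
  have B': "B' = r ` B" and inj: "inj_on r B" using bij by (auto simp: bij_betw_def)
  have "(h \<circ> inv_into B r) ` B' = h ` B"
    unfolding B' image_image using inj by (intro image_cong) auto
  moreover have "joined p' (Inl (r i)) (Inl (r j)) = joined p (Inl i) (Inl j)"
    "joined p' (Inr (r i)) (Inr (r j)) = joined p (Inr i) (Inr j)"
    "joined p' (Inl (r i)) (Inr (r j)) = joined p (Inl i) (Inr j)" if "i \<in> B" "j \<in> B" for i j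
    using j[of "Inl i" "Inl j"] j[of "Inr i" "Inr j"] j[of "Inl i" "Inr j"] that by auto
  ultimately show ?thesis
    using h inj unfolding labelling_def B' by auto
qed

lemma like_transfer:
  assumes bij: "bij_betw r B B'"
    and j: "\<And>a b. col a \<in> B \<Longrightarrow> col b \<in> B \<Longrightarrow> joined p' (map_sum r r a) (map_sum r r b) \<longleftrightarrow> joined p a b"
  shows "necklace_like p' B' s \<longleftrightarrow> necklace_like p B s" "chain_like p' B' s \<longleftrightarrow> chain_like p B s"
proof -
  have bij': "bij_betw (inv_into B r) B' B" using bij by (rule bij_betw_inv_into)
  have j': "joined p (map_sum (inv_into B r) (inv_into B r) a) (map_sum (inv_into B r) (inv_into B r) b)
      \<longleftrightarrow> joined p' a b" if "col a \<in> B'" "col b \<in> B'" for a b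
  proof -
    let ?g = "inv_into B r"
    have "r (?g i) = i" "?g i \<in> B" if "i \<in> B'" for i
      using that bij by (auto simp: bij_betw_def f_inv_into_f inv_into_into)
    then show ?thesis
      using j[of "map_sum ?g ?g a" "map_sum ?g ?g b"] that by (cases a; cases b) auto
  qed
  show "necklace_like p' B' s \<longleftrightarrow> necklace_like p B s" "chain_like p' B' s \<longleftrightarrow> chain_like p B s"
    unfolding necklace_like_def chain_like_def
    using labelling_transfer[OF _ bij j] labelling_transfer[OF _ bij' j'] by blast+
qed

lemma weight_transfer:
  assumes bij: "bij_betw r B B'"
    and j: "\<And>a b. col a \<in> B \<Longrightarrow> col b \<in> B \<Longrightarrow> joined p' (map_sum r r a) (map_sum r r b) \<longleftrightarrow> joined p a b"
  shows "weight lam p' B' = weight lam p B"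
proof -
  have "B' = {} \<longleftrightarrow> B = {}" using bij by (auto simp: bij_betw_def)
  moreover have "necklace_like p' B' = necklace_like p B" "chain_like p' B' = chain_like p B"
    using like_transfer[OF assms] by auto
  ultimately show ?thesis unfolding weight_def by (simp only:)
qed

lemma weight_cong:
  assumes "\<And>a b. col a \<in> B \<Longrightarrow> col b \<in> B \<Longrightarrow> joined p' a b \<longleftrightarrow> joined p a b"
  shows "weight lam p' B = weight lam p B"
  by (rule weight_transfer[of id]) (use assms in \<open>auto simp: map_sum.id\<close>)

section \<open>The limiting log-cumulants and their sums over the geodesic lower sets\<close>

text \<open>The claimed limit in one formula for all partitions, irreducible or not. Columns that
  are blocks on their own are ignored; the remaining ears, \<open>active k p - nonears k p\<close>,
  carry the sign. The identity is the one case in which the value depends on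
  \<open>k\<close>.\<close>

definition log_cumulant_value :: "(nat \<Rightarrow> real) \<Rightarrow> nat \<Rightarrow> point set set \<Rightarrow> real"
  where "log_cumulant_value lam k p =
    (if p = id_part k then - real k
     else if single_cycle p (active k p)
       then (-1) ^ card (active k p - nonears k p) * weight lam p (nonears k p)
     else 0)"

text \<open>The limit called \<open>m_q\<close> in the overview. For a non-empty head, a block
  shared by the head and an ear would need a label that is both moved and fixed, so the limit is 0;
  a head spread over several cycles is too rare to be seen in the limit.\<close>

definition moment_limit :: "(nat \<Rightarrow> real) \<Rightarrow> nat \<Rightarrow> point set set \<Rightarrow> real"
  where "moment_limit lam k q =
    (if nonears k q = {} then - real (nc q)
     else if single_cycle q (nonears k q) \<and> closed_cols q (nonears k q)
       then weight lam q (nonears k q)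
     else 0)"

text \<open>Equal to \<open>q\<close> on the columns \<open>A\<close> and to the identity elsewhere.
  The partitions below \<open>q\<close> that have its rank and at most one non-trivial cycle turn
  out to be of this form, so they are indexed by sets of columns.\<close>

definition detach :: "nat \<Rightarrow> point set set \<Rightarrow> nat set \<Rightarrow> point set set"
  where "detach k q A = classes (points k)
    (\<lambda>a b. if col a \<in> A then col b \<in> A \<and> joined q a b else col a = col b)"

lemma
  assumes q: "q \<in> partitions k"
  shows partition_on_detach: "partition_on (points k) (detach k q A)"
    and joined_detach: "joined (detach k q A) a b \<longleftrightarrow> a \<in> points k \<and> b \<in> points k \<and>
      (if col a \<in> A then col b \<in> A \<and> joined q a b else col a = col b)"
proof -
  note Q = partitionsD[OF q]
  let ?R = "\<lambda>a b. if col a \<in> A then col b \<in> A \<and> joined q a b else col a = col b"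
  have 1: "?R a a" if "a \<in> points k" for a using joined_refl[OF Q that] by simp
  have 2: "?R b a" if "?R a b" for a b
    using that joined_sym[of q a b] by (simp split: if_splits)
  have 3: "?R a c" if "?R a b" "?R b c" for a b c
    using that joined_trans[OF Q, of a b c] by (simp split: if_splits)
  show "partition_on (points k) (detach k q A)"
    unfolding detach_def by (rule partition_on_classes(1)) (use 1 2 3 in blast)+
  show "joined (detach k q A) a b \<longleftrightarrow> a \<in> points k \<and> b \<in> points k \<and>
      (if col a \<in> A then col b \<in> A \<and> joined q a b else col a = col b)"
    unfolding detach_def by (rule partition_on_classes(2)) (use 1 2 3 in blast)+
qed

lemma detach_in_partitions: "q \<in> partitions k \<Longrightarrow> detach k q A \<in> partitions k"
  by (simp add: partitions_def partition_on_detach)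

lemma detach_refines:
  assumes q: "q \<in> partitions k" and A: "nonears k q \<subseteq> A"
  shows "refines (points k) (detach k q A) q"
  unfolding refines_iff[OF partition_on_detach[OF q] partitionsD[OF q]]
proof (intro allI impI)
  fix a b assume ab: "joined (detach k q A) a b"
  show "joined q a b"
  proof (cases "col a \<in> A")
    case True then show ?thesis using ab by (simp add: joined_detach[OF q])
  next
    case False
    then have "a \<in> points k" "col b = col a" "col a \<notin> nonears k q"
      using ab A by (auto simp: joined_detach[OF q])
    then show ?thesis by (intro joined_ear_col[OF q])
  qed
qed

lemma nonears_detach:
  assumes q: "q \<in> partitions k" and A: "nonears k q \<subseteq> A"
  shows "nonears k (detach k q A) = nonears k q"
  using A by (auto simp: nonears_def joined_detach[OF q])

lemma touching_refines_map:
  assumes "refines S p q"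
  obtains f where "\<And>X. X \<in> touching p A \<Longrightarrow> f X \<in> touching q A \<and> X \<subseteq> f X"
proof -
  have "\<forall>X\<in>touching p A. \<exists>Y. Y \<in> touching q A \<and> X \<subseteq> Y"
  proof
    fix X assume X: "X \<in> touching p A"
    then obtain Y where "Y \<in> q" "X \<subseteq> Y" using assms unfolding refines_def touching_def by blast
    then show "\<exists>Y. Y \<in> touching q A \<and> X \<subseteq> Y" using X unfolding touching_def by blast
  qed
  then show ?thesis using that by metis
qed

lemma touching_refines_surj:
  assumes r: "refines S p q" and f: "\<And>X. X \<in> touching p A \<Longrightarrow> f X \<in> touching q A \<and> X \<subseteq> f X"
  shows "f ` touching p A = touching q A"
proof (intro equalityI subsetI)
  fix Y assume Y: "Y \<in> touching q A"
  have P: "partition_on S p" and Q: "partition_on S q" using r by (auto simp: refines_def)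
  obtain a where a: "a \<in> Y" "col a \<in> A" and Yq: "Y \<in> q" using Y by (auto simp: touching_def)
  have "a \<in> S" using a Yq block_subset[OF Q] by blast
  then obtain X where X: "X \<in> p" "a \<in> X" by (rule obtain_block[OF P])
  then have Xt: "X \<in> touching p A" using a by (auto simp: touching_def)
  then have "f X \<in> q" "a \<in> f X" using f[OF Xt] X by (auto simp: touching_def)
  then have "f X = Y" using block_eqI[OF Q] a Yq by blast
  then show "Y \<in> f ` touching p A" using Xt by blast
qed (use f in auto)

lemma finite_touching: "p \<in> partitions k \<Longrightarrow> finite (touching p A)"
  using finite_partition[OF partitionsD] by (simp add: touching_def)

text \<open>A partition \<open>p \<le> q\<close> with at most one non-trivial cycle and the same rank as \<open>q\<close> has as many
  blocks touching that cycle as \<open>q\<close>, so that \<open>p\<close> and \<open>q\<close> agree on it.\<close>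

lemma geodesic_single_cycle:
  assumes p: "p \<in> partitions k" and q: "q \<in> partitions k" and pq: "refines (points k) p q"
    and rank: "part_rank k p = part_rank k q" and ne: "p \<noteq> id_part k" and single: "single_cycle p (active k p)"
  shows "p = detach k q (active k p)"
proof -
  let ?A = "active k p"
  note P = partitionsD[OF p] and Q = partitionsD[OF q]
  have A: "?A \<noteq> {}" "?A \<subseteq> {1..k}" using active_empty_iff[OF p] ne by (auto simp: active_def)
  have nA: "nonears k p \<subseteq> ?A" "nonears k q \<subseteq> ?A"
    using nonears_subset_active nonears_antimono[OF pq] by blast+
  have "int (card (touching p ?A)) - 1 = int (card (touching q ?A)) - 1"
    using rank_single[OF p A single nA(1)] rank_single[OF q A single_cycle_refines[OF pq single] nA(2)] rank
    by simp
  then have card: "card (touching p ?A) = card (touching q ?A)" by simp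
  obtain f where f: "\<And>X. X \<in> touching p ?A \<Longrightarrow> f X \<in> touching q ?A \<and> X \<subseteq> f X"
    using touching_refines_map[OF pq] by blast
  have "inj_on f (touching p ?A)"
    using eq_card_imp_inj_on[OF finite_touching[OF p], of f ?A] touching_refines_surj[OF pq f] card
    by simp
  then have agree: "joined p a b" if ab: "joined q a b" "col a \<in> ?A" "col b \<in> ?A" for a b
  proof -
    have pts: "a \<in> points k" "b \<in> points k" using joined_in[OF Q ab(1)] by auto
    obtain X where X: "X \<in> p" "a \<in> X" by (rule obtain_block[OF P pts(1)])
    obtain X' where X': "X' \<in> p" "b \<in> X'" by (rule obtain_block[OF P pts(2)])
    have t: "X \<in> touching p ?A" "X' \<in> touching p ?A" using X X' ab by (auto simp: touching_def)
    have "f X \<in> q" "f X' \<in> q" "a \<in> f X" "b \<in> f X'" using f[OF t(1)] f[OF t(2)] X X' by (auto simp: touching_def)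
    then have "f X = f X'" using block_eqI[OF Q] joined_in_block[OF Q] ab(1) by metis
    then have "X = X'" using inj_onD[OF \<open>inj_on f (touching p ?A)\<close>] t by blast
    then show ?thesis using X X' joined_in_block[OF P] by blast
  qed
  show ?thesis
  proof (rule partition_eqI[OF P partition_on_detach[OF q]])
    fix a b
    show "joined p a b = joined (detach k q ?A) a b"
    proof (cases "a \<in> points k \<and> b \<in> points k")
      case False
      then show ?thesis using joined_in[OF P] by (auto simp: joined_detach[OF q])
    next
      case pts: True
      show ?thesis
      proof (cases "col a \<in> ?A")
        case False
        then show ?thesis using joined_inactive[OF p, of a b] pts by (auto simp: joined_detach[OF q])
      next
        case True
        have "col b \<in> ?A" if "joined p a b"
        proof (rule ccontr)
          assume "col b \<notin> ?A"
          then have "col a = col b"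
            using joined_inactive[OF p, of b a] joined_sym[OF that] pts by auto
          then show False using \<open>col b \<notin> ?A\<close> True by simp
        qed
        then show ?thesis
          using True pts agree refinesD[OF pq] by (auto simp: joined_detach[OF q])
      qed
    qed
  qed
qed

text \<open>Distinct blocks of \<open>detach k q A\<close> that touch \<open>A\<close> lie in
  distinct blocks of \<open>q\<close>, so there are at most as many of them as for \<open>q\<close>.
  The opposite inequality between the ranks is \<open>rank_antimono\<close>.\<close>

lemma rank_detach:
  assumes q: "q \<in> partitions k" and A: "nonears k q \<subseteq> A" "A \<noteq> {}" "A \<subseteq> {1..k}"
    and single: "single_cycle (detach k q A) A"
  shows "part_rank k (detach k q A) = part_rank k q"
proof -
  let ?p = "detach k q A"
  note p = detach_in_partitions[OF q, of A] and pq = detach_refines[OF q A(1)]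
  note P = partitionsD[OF p] and Q = partitionsD[OF q]
  have rp: "part_rank k ?p = int (card (touching ?p A)) - 1"
    by (rule rank_single[OF p A(2,3) single]) (simp add: nonears_detach[OF q A(1)] A(1))
  have rq: "part_rank k q = int (card (touching q A)) - 1"
    by (rule rank_single[OF q A(2,3) single_cycle_refines[OF pq single] A(1)])
  obtain f where f: "\<And>X. X \<in> touching ?p A \<Longrightarrow> f X \<in> touching q A \<and> X \<subseteq> f X"
    using touching_refines_map[OF pq] by blast
  have "inj_on f (touching ?p A)"
  proof (rule inj_onI)
    fix X X' assume t: "X \<in> touching ?p A" "X' \<in> touching ?p A" "f X = f X'"
    obtain a b where ab: "a \<in> X" "col a \<in> A" "b \<in> X'" "col b \<in> A" "X \<in> ?p" "X' \<in> ?p"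
      using t by (auto simp: touching_def)
    have "a \<in> f X" "b \<in> f X" "f X \<in> q" using f[OF t(1)] f[OF t(2)] t(3) ab by (auto simp: touching_def)
    then have "joined q a b" by (auto simp: joined_def)
    then have "joined ?p a b" using ab joined_in[OF Q] by (auto simp: joined_detach[OF q])
    then have "b \<in> X" using joined_in_block[OF P ab(5,1)] by blast
    then show "X = X'" using block_eqI[OF P] ab by blast
  qed
  then have "card (touching ?p A) \<le> card (touching q A)"
    using f finite_touching[OF q] by (intro card_inj_on_le[of f]) auto
  then show ?thesis using rp rq rank_antimono[OF p q pq] by simp
qed

lemma refines_id_part_iff:
  assumes q: "q \<in> partitions k"
  shows "refines (points k) (id_part k) q \<longleftrightarrow> nonears k q = {}"
proof
  assume "refines (points k) (id_part k) q"
  then show "nonears k q = {}"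
    using refinesD[of "points k" "id_part k" q] by (auto simp: nonears_def joined_id_part)
next
  assume e: "nonears k q = {}"
  show "refines (points k) (id_part k) q"
    unfolding refines_iff[OF partition_on_id_part partitionsD[OF q]]
    using joined_ear_col[OF q] e by (auto simp: joined_id_part)
qed

lemma rank_no_nonears:
  assumes q: "q \<in> partitions k" and "nonears k q = {}"
  shows "part_rank k q = 0"
proof -
  have "refines (points k) (id_part k) q" using assms refines_id_part_iff by blast
  then have "cycles_of k q = q"
    by (intro cycles_of_eqI[OF q]) (use refines_refl[OF partitionsD[OF q]] in auto)
  then show ?thesis by (simp add: part_rank_def)
qed

lemma nonears_id_part: "nonears k (id_part k) = {}"
  by (auto simp: nonears_def joined_id_part)

lemma sum_minus_one_power_card_Pow:
  assumes "finite T"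
  shows "(\<Sum>F\<in>Pow T. (-1) ^ card F :: real) = (if T = {} then 1 else 0)"
proof (cases "T = {}")
  case False
  then obtain x where x: "x \<in> T" by blast
  let ?S = "Pow (T - {x})"
  have T: "Pow T = ?S \<union> insert x ` ?S"
    using x by (metis Pow_insert insert_Diff)
  have "(\<Sum>F\<in>Pow T. (-1) ^ card F :: real) = (\<Sum>F\<in>?S. (-1) ^ card F) + (\<Sum>F\<in>insert x ` ?S. (-1) ^ card F)"
    unfolding T using assms by (intro sum.union_disjoint) auto
  also have "(\<Sum>F\<in>insert x ` ?S. (-1) ^ card F :: real) = (\<Sum>F\<in>?S. (-1) ^ card (insert x F))"
    by (rule sum.reindex_cong[of "insert x"]) (auto simp: inj_on_def)
  also have "\<dots> = (\<Sum>F\<in>?S. - ((-1) ^ card F))"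
  proof (rule sum.cong)
    fix F assume "F \<in> ?S"
    then have "x \<notin> F" "finite F" using assms finite_subset by auto
    then show "(-1 :: real) ^ card (insert x F) = - ((-1) ^ card F)" by simp
  qed simp
  finally show ?thesis using False by (simp add: sum_negf)
qed simp

text \<open>The \<open>p\<close> below \<open>q\<close> for which the factor
  \<open>N^(rank q - rank p)\<close> does not tend to 0.\<close>

definition geodesic_below :: "nat \<Rightarrow> point set set \<Rightarrow> point set set set"
  where "geodesic_below k q = {p \<in> partitions k. refines (points k) p q \<and> part_rank k p = part_rank k q}"

text \<open>Both points of an ear lie in one block, so a block whose columns are all ears is
  connected to nothing else.\<close>

lemma closed_cols_ear_block:
  assumes p: "p \<in> partitions k" and ears: "\<And>c. joined p a c \<Longrightarrow> col c \<notin> nonears k p"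
  shows "closed_cols p {col c | c. joined p a c}"
  unfolding closed_cols_def
proof (intro allI impI)
  note P = partitionsD[OF p]
  fix b d assume bd: "joined p b d" "col b \<in> {col c | c. joined p a c}"
  then obtain c where c: "col b = col c" "joined p a c" by auto
  have "c \<in> points k" using joined_in[OF P c(2)] by simp
  then have "joined p c b" using joined_ear_col[OF p, of c b] ears[OF c(2)] c(1) by simp
  then have "joined p a d" using c(2) bd(1) joined_trans[OF P] by metis
  then show "col d \<in> {col c | c. joined p a c}" by blast
qed

lemma active_detach_subset:
  assumes q: "q \<in> partitions k"
  shows "active k (detach k q A) \<subseteq> A"
proof
  fix i assume i: "i \<in> active k (detach k q A)"
  show "i \<in> A"
  proof (rule ccontr)
    assume iA: "i \<notin> A"
    have ik: "Inl i \<in> points k" using i by (auto simp: active_def)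
    have "b \<in> points k \<and> i = col b \<longleftrightarrow> b = Inl i \<or> b = Inr i" for b
      using ik by (cases b) auto
    then have "{b. joined (detach k q A) (Inl i) b} = {Inl i, Inr i}"
      using iA ik unfolding joined_detach[OF q] by auto
    then have "{Inl i, Inr i} \<in> detach k q A"
      using joined_block_in[OF partition_on_detach[OF q] ik, of A] by simp
    then show False using i by (simp add: active_def)
  qed
qed

lemma in_activeI:
  assumes p: "p \<in> partitions k" and "i \<in> {1..k}" "joined p (Inl i) c" "col c \<noteq> i"
  shows "i \<in> active k p"
  using joined_inactive[OF p, of "Inl i" c] assms(2-4) by (auto simp: in_points_iff)

text \<open>Cutting off ears does not disconnect \<open>X\<close>: a path entering and leaving
  through an ear stays within one block, so it can skip the ear.\<close>

lemma single_cycle_detach: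
  assumes q: "q \<in> partitions k" and A: "nonears k q \<subseteq> A" and X: "X \<subseteq> A" and single: "single_cycle q X"
  shows "single_cycle (detach k q A) X"
  unfolding single_cycle_def
proof (intro allI impI)
  note Q = partitionsD[OF q]
  let ?p = "detach k q A"
  fix D assume D: "closed_cols ?p D"
  \<comment> \<open>Extends \<open>D\<close> over the ears that were cut off: such an ear joins
    \<open>D'\<close> when its block contains a point over \<open>D \<inter> A\<close>. The result
    is closed for \<open>q\<close>.\<close>
  define D' where "D' = {i. (i \<in> A \<and> i \<in> D) \<or> (i \<notin> A \<and> (\<exists>c. col c \<in> D \<inter> A \<and> joined q (Inl i) c))}"
  have pj: "joined ?p a b" if "joined q a b" "col a \<in> A" "col b \<in> A" for a b
    using that joined_in[OF Q that(1)] by (simp add: joined_detach[OF q])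
  have "closed_cols q D'"
    unfolding closed_cols_def
  proof (intro allI impI)
    fix a b assume ab: "joined q a b" "col a \<in> D'"
    have pts: "a \<in> points k" "b \<in> points k" using joined_in[OF Q ab(1)] by auto
    have ear: "joined q (Inl (col x)) x" if "x \<in> points k" "col x \<notin> A" for x
      using joined_ear_col[OF q, of "Inl (col x)" x] that A by (auto simp: in_points_iff)
    obtain c where c: "col c \<in> D \<inter> A" "joined q a c"
    proof (cases "col a \<in> A")
      case True
      then show ?thesis using that[of a] ab(2) joined_refl[OF Q pts(1)] by (auto simp: D'_def)
    next
      case False
      then obtain c where c: "col c \<in> D \<inter> A" "joined q (Inl (col a)) c"
        using ab(2) by (auto simp: D'_def)
      then have "joined q a c"
        using ear[OF pts(1) False] joined_sym joined_trans[OF Q] by metis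
      then show ?thesis using that c by blast
    qed
    then have bc: "joined q c b" using ab(1) joined_sym joined_trans[OF Q] by metis
    show "col b \<in> D'"
    proof (cases "col b \<in> A")
      case True
      then have "col b \<in> D" using closed_colsD[OF D pj[OF bc]] c(1) by simp
      then show ?thesis using True by (simp add: D'_def)
    next
      case False
      have "joined q (Inl (col b)) c"
        using ear[OF pts(2) False] bc joined_sym joined_trans[OF Q] by metis
      then show ?thesis using False c(1) by (auto simp: D'_def)
    qed
  qed
  then have "X \<subseteq> D' \<or> X \<inter> D' = {}" using single by (simp add: single_cycle_def)
  then show "X \<subseteq> D \<or> X \<inter> D = {}" using X by (auto simp: D'_def)
qed

context
  fixes k q
  assumes q: "q \<in> partitions k"
begin

lemma geodesic_belowD:
  assumes "p \<in> geodesic_below k q" "p \<noteq> id_part k" "single_cycle p (active k p)"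
  shows "p = detach k q (active k p)" "nonears k p = nonears k q" "nonears k q \<subseteq> active k p"
    "active k p \<noteq> {}" "active k p \<subseteq> {1..k}" "p \<in> partitions k"
proof -
  have p: "p \<in> partitions k" and pq: "refines (points k) p q" "part_rank k p = part_rank k q"
    using assms by (auto simp: geodesic_below_def)
  show "p \<in> partitions k" by (rule p)
  show d: "p = detach k q (active k p)" using geodesic_single_cycle[OF p q pq assms(2,3)] .
  show A: "nonears k q \<subseteq> active k p"
    using nonears_antimono[OF pq(1)] nonears_subset_active by blast
  show "nonears k p = nonears k q"
    using nonears_detach[OF q A] d by simp
  show "active k p \<noteq> {}" using active_empty_iff[OF p] assms by simp
  show "active k p \<subseteq> {1..k}" by (auto simp: active_def)
qed

lemma detach_in_geodesic_below:
  assumes "nonears k q \<subseteq> A" "A \<noteq> {}" "A \<subseteq> {1..k}" "single_cycle (detach k q A) A"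
  shows "detach k q A \<in> geodesic_below k q"
  unfolding geodesic_below_def
  using detach_in_partitions[OF q] detach_refines[OF q assms(1)] rank_detach[OF q assms] by simp

text \<open>The contributing partitions are \<open>detach k q (B \<union> F)\<close>, where
  \<open>B\<close> is the set of non-ear columns and \<open>F\<close> any set of ears attached to
  \<open>B\<close>. All of them have the head of \<open>q\<close>, so they differ only by the sign
  \<open>(-1) ^ card F\<close>. If the head of \<open>q\<close> is spread over several cycles there
  are none, because a single cycle of \<open>p\<close> stays a single cycle in the coarser
  \<open>q\<close>.\<close>

lemma sum_log_cumulant_value_nonears:
  assumes B: "nonears k q \<noteq> {}"
  shows "(\<Sum>p\<in>geodesic_below k q. log_cumulant_value lam k p) = moment_limit lam k q"
proof -
  let ?B = "nonears k q"
  let ?G = "{p \<in> geodesic_below k q. single_cycle p (active k p)}"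
  define T where "T = {i \<in> {1..k} - ?B. \<exists>c. col c \<in> ?B \<and> joined q (Inl i) c}"
  have T: "finite T" "?B \<inter> T = {}" "T \<subseteq> {1..k}" by (auto simp: T_def)
  note Q = partitionsD[OF q]
  have ne: "p \<noteq> id_part k" if "p \<in> geodesic_below k q" for p
    using that refines_id_part_iff[OF q] B by (auto simp: geodesic_below_def)
  have fin: "finite (geodesic_below k q)"
    using finite_partitions by (simp add: geodesic_below_def)
  have sumG: "(\<Sum>p\<in>geodesic_below k q. log_cumulant_value lam k p) = (\<Sum>p\<in>?G. log_cumulant_value lam k p)"
    by (rule sum.mono_neutral_right[OF fin]) (use ne in \<open>auto simp: log_cumulant_value_def\<close>)
  show ?thesis
  proof (cases "single_cycle q ?B")
    case False
    have "\<not> single_cycle p (active k p)" if p: "p \<in> geodesic_below k q" for p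
    proof
      assume s: "single_cycle p (active k p)"
      have "single_cycle q (active k p)"
        by (rule single_cycle_refines[OF _ s]) (use p in \<open>auto simp: geodesic_below_def\<close>)
      then have "single_cycle q ?B"
        by (rule single_cycle_subset) (rule geodesic_belowD(3)[OF p ne[OF p] s])
      then show False using False by simp
    qed
    then have G: "?G = {}" by blast
    show ?thesis using sumG False B unfolding G by (simp add: moment_limit_def)
  next
    case single: True
    have sc: "single_cycle (detach k q (?B \<union> F)) (?B \<union> F)" if F: "F \<subseteq> T" for F
      unfolding single_cycle_def
    proof (intro allI impI)
      let ?A = "?B \<union> F" let ?p = "detach k q ?A"
      fix D assume D: "closed_cols ?p D"
      have pj: "joined ?p a b" if "joined q a b" "col a \<in> ?A" "col b \<in> ?A" for a b
        using that joined_in[OF Q that(1)] by (simp add: joined_detach[OF q])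
      have BD: "?B \<subseteq> D \<or> ?B \<inter> D = {}"
        using single_cycle_detach[OF q, of ?A ?B] single D unfolding single_cycle_def by blast
      have FD: "\<exists>j\<in>?B. i \<in> D \<longleftrightarrow> j \<in> D" if i: "i \<in> F" for i
      proof -
        obtain c where c: "col c \<in> ?B" "joined q (Inl i) c" using i F by (auto simp: T_def)
        then have "joined ?p (Inl i) c" using pj i by simp
        then have "i \<in> D \<longleftrightarrow> col c \<in> D"
          using closed_colsD[OF D, of "Inl i" c] closed_colsD[OF D, of c "Inl i"]
            joined_commute[of ?p c "Inl i"] by auto
        then show ?thesis using c by blast
      qed
      show "?A \<subseteq> D \<or> ?A \<inter> D = {}" using BD FD by blast
    qed
    have act: "active k (detach k q (?B \<union> F)) = ?B \<union> F" if F: "F \<subseteq> T" for F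
    proof
      let ?A = "?B \<union> F" let ?p = "detach k q ?A"
      show "active k ?p \<subseteq> ?A" by (rule active_detach_subset[OF q])
      have "?B \<subseteq> active k ?p" using nonears_subset_active[of k ?p] nonears_detach[OF q, of ?A] by simp
      moreover have "i \<in> active k ?p" if i: "i \<in> F" for i
      proof -
        obtain c where c: "col c \<in> ?B" "joined q (Inl i) c" "i \<in> {1..k}" "i \<notin> ?B"
          using i F by (auto simp: T_def)
        then have "joined ?p (Inl i) c"
          using i joined_in[OF Q c(2)] by (simp add: joined_detach[OF q])
        then show ?thesis using in_activeI[OF detach_in_partitions[OF q] c(3)] c by metis
      qed
      ultimately show "?A \<subseteq> active k ?p" by blast
    qed
    have G: "?G = (\<lambda>F. detach k q (?B \<union> F)) ` Pow T"
    proof (intro equalityI subsetI)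
      fix p assume "p \<in> ?G"
      then have p: "p \<in> geodesic_below k q" "single_cycle p (active k p)" by auto
      note g = geodesic_belowD[OF p(1) ne[OF p(1)] p(2)]
      have pq: "refines (points k) p q" using p by (simp add: geodesic_below_def)
      have "active k p - ?B \<subseteq> T"
      proof
        fix i assume i: "i \<in> active k p - ?B"
        show "i \<in> T"
        proof (rule ccontr)
          assume iT: "i \<notin> T"
          have notB: "col c \<notin> ?B" if "joined p (Inl i) c" for c
            using iT i g(5) refinesD[OF pq that] by (auto simp: T_def)
          \<comment> \<open>If the ear \<open>i\<close> met no head column, its block would be a
            cycle by itself. This cycle would contain all active columns, and so the non-empty
            head.\<close>
          have "closed_cols p {col c | c. joined p (Inl i) c}"
            by (rule closed_cols_ear_block[OF g(6)]) (use notB g(2) in simp)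
          moreover have "i \<in> {col c | c. joined p (Inl i) c}"
          proof -
            have "joined p (Inl i) (Inl i)"
              by (rule joined_refl[OF partitionsD[OF g(6)]]) (use i g(5) in auto)
            then show ?thesis by force
          qed
          ultimately have "active k p \<subseteq> {col c | c. joined p (Inl i) c}"
            using p(2) i unfolding single_cycle_def by blast
          then show False using notB B g(3) by blast
        qed
      qed
      then have "active k p = ?B \<union> (active k p - ?B)" "active k p - ?B \<in> Pow T" using g(3) by auto
      then show "p \<in> (\<lambda>F. detach k q (?B \<union> F)) ` Pow T" using g(1) by (metis image_eqI)
    next
      fix p assume "p \<in> (\<lambda>F. detach k q (?B \<union> F)) ` Pow T"
      then obtain F where F: "F \<subseteq> T" "p = detach k q (?B \<union> F)" by auto
      have "p \<in> geodesic_below k q" unfolding F(2)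
        by (rule detach_in_geodesic_below) (use B T F sc[OF F(1)] nonears_subset in auto)
      then show "p \<in> ?G" using sc[OF F(1)] act[OF F(1)] F(2) by simp
    qed
    have inj: "inj_on (\<lambda>F. detach k q (?B \<union> F)) (Pow T)"
    proof (rule inj_onI)
      fix F F' assume *: "F \<in> Pow T" "F' \<in> Pow T" "detach k q (?B \<union> F) = detach k q (?B \<union> F')"
      have "?B \<union> F = active k (detach k q (?B \<union> F))" using act[of F] *(1) by blast
      also have "\<dots> = active k (detach k q (?B \<union> F'))" by (rule arg_cong[OF *(3)])
      also have "\<dots> = ?B \<union> F'" using act[of F'] *(2) by blast
      finally have "?B \<union> F = ?B \<union> F'" .
      moreover have "?B \<inter> F = {}" "?B \<inter> F' = {}" using * T(2) by blast+
      ultimately show "F = F'" by blast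
    qed
    have val: "log_cumulant_value lam k (detach k q (?B \<union> F)) = (-1) ^ card F * weight lam q ?B"
      if F: "F \<subseteq> T" for F
    proof -
      let ?p = "detach k q (?B \<union> F)"
      have "?p \<in> geodesic_below k q"
        by (rule detach_in_geodesic_below) (use B T F sc[OF F] nonears_subset in auto)
      then have "?p \<noteq> id_part k" by (rule ne)
      moreover have "nonears k ?p = ?B" by (rule nonears_detach[OF q]) simp
      moreover have "?B \<union> F - ?B = F" using F T(2) by blast
      moreover have "weight lam ?p ?B = weight lam q ?B"
        by (rule weight_cong) (use joined_in[OF Q] in \<open>auto simp: joined_detach[OF q]\<close>)
      ultimately show ?thesis using sc[OF F] act[OF F] by (simp add: log_cumulant_value_def)
    qed
    have "(\<Sum>p\<in>?G. log_cumulant_value lam k p) = (\<Sum>F\<in>Pow T. (-1) ^ card F * weight lam q ?B)"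
      unfolding G by (subst sum.reindex[OF inj]) (auto intro!: sum.cong val)
    also have "\<dots> = (if T = {} then 1 else 0) * weight lam q ?B"
      using sum_minus_one_power_card_Pow[OF T(1)] by (simp flip: sum_distrib_right)
    also have "T = {} \<longleftrightarrow> closed_cols q ?B"
    proof
      assume T0: "T = {}"
      show "closed_cols q ?B" unfolding closed_cols_def
      proof (intro allI impI, rule ccontr)
        fix a b assume ab: "joined q a b" "col a \<in> ?B" "col b \<notin> ?B"
        have b: "b \<in> points k" using joined_in[OF Q ab(1)] by simp
        have "joined q b (Inl (col b))" using joined_ear_col[OF q b ab(3)] by simp
        then have "joined q (Inl (col b)) a" using ab(1) joined_sym joined_trans[OF Q] by metis
        then have "col b \<in> T" using ab b by (auto simp: T_def in_points_iff)
        then show False using T0 by simp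
      qed
    next
      assume cl: "closed_cols q ?B"
      have "i \<in> ?B" if "col c \<in> ?B" "joined q (Inl i) c" for i c
        using closed_colsD[OF cl joined_sym[OF that(2)] that(1)] by simp
      then show "T = {}" by (auto simp: T_def)
    qed
    finally show ?thesis using sumG B single by (simp add: moment_limit_def)
  qed
qed

text \<open>The active columns of a contributing \<open>p\<close> other than the identity lie in one
  block of \<open>q\<close>, and every set of at least two columns of a block occurs. The signs of
  all subsets of the \<open>y\<close> columns of a block sum to 0; without the empty set and the
  singletons \<open>y - 1\<close> is left. Over all blocks this gives \<open>k - nc q\<close>, and
  the identity adds \<open>- k\<close>.\<close>

lemma sum_log_cumulant_value_ears:
  assumes B: "nonears k q = {}"
  shows "(\<Sum>p\<in>geodesic_below k q. log_cumulant_value lam k p) = moment_limit lam k q"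
proof -
  let ?G = "{p \<in> geodesic_below k q. p \<noteq> id_part k \<and> single_cycle p (active k p)}"
  define S where "S X = {A. A \<subseteq> col ` X \<and> card A \<ge> 2}" for X :: "point set"
  note Q = partitionsD[OF q]
  have fin: "finite (geodesic_below k q)"
    using finite_partitions by (simp add: geodesic_below_def)
  have finq: "finite q" by (rule finite_partition[OF Q])
  have finX: "finite X" if "X \<in> q" for X
    using block_subset[OF Q that] finite_points finite_subset by blast
  have id: "id_part k \<in> geodesic_below k q"
    using id_part_in_partitions refines_id_part_iff[OF q] B rank_no_nonears[OF q B]
      rank_no_nonears[OF id_part_in_partitions nonears_id_part] by (simp add: geodesic_below_def)
  have inX: "Inl i \<in> X" if X: "X \<in> q" "i \<in> col ` X" for i X
  proof -
    obtain a where a: "a \<in> X" "i = col a" using X by auto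
    have "a \<in> points k" using a X block_subset[OF Q] by blast
    then have "joined q a (Inl i)" using joined_ear_col[OF q, of a "Inl i"] B a by simp
    then show ?thesis using joined_in_block[OF Q X(1) a(1)] by simp
  qed
  have colX: "col ` X \<subseteq> {1..k}" if "X \<in> q" for X
    using block_subset[OF Q that] by (auto simp: in_points_iff)
  have sc: "single_cycle (detach k q A) A" "active k (detach k q A) = A" if X: "X \<in> q" "A \<in> S X" for X A
  proof -
    let ?p = "detach k q A"
    have A: "A \<subseteq> col ` X" "card A \<ge> 2" using X by (auto simp: S_def)
    have j: "joined ?p (Inl i) (Inl j)" if "i \<in> A" "j \<in> A" for i j
    proof -
      have "Inl i \<in> X" "Inl j \<in> X" using inX[OF X(1)] A that by auto
      then show ?thesis
        using that joined_in_block[OF Q X(1)] block_subset[OF Q X(1)] by (auto simp: joined_detach[OF q])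
    qed
    show "single_cycle ?p A"
      unfolding single_cycle_def
    proof (intro allI impI)
      fix D assume D: "closed_cols ?p D"
      have "i \<in> D \<longleftrightarrow> i' \<in> D" if "i \<in> A" "i' \<in> A" for i i'
        using closed_colsD[OF D j[OF that]] closed_colsD[OF D j[OF that(2,1)]] by auto
      then show "A \<subseteq> D \<or> A \<inter> D = {}" by blast
    qed
    have "i \<in> active k ?p" if i: "i \<in> A" for i
    proof -
      have "A \<noteq> {i}" using A(2) by auto
      then obtain i' where "i' \<in> A" "i' \<noteq> i" using i by blast
      moreover have "i \<in> {1..k}" using i A colX[OF X(1)] by blast
      ultimately show ?thesis using in_activeI[OF detach_in_partitions[OF q] _ j[OF i]] by simp
    qed
    then show "active k ?p = A" using active_detach_subset[OF q] by blast
  qed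
  have geo: "detach k q A \<in> ?G" if X: "X \<in> q" "A \<in> S X" for X A
  proof -
    have A: "A \<subseteq> {1..k}" "A \<noteq> {}" using X colX[OF X(1)] by (auto simp: S_def)
    have "detach k q A \<in> geodesic_below k q"
      by (rule detach_in_geodesic_below) (use B A sc[OF X] in auto)
    moreover have "detach k q A \<noteq> id_part k"
      using active_empty_iff[OF detach_in_partitions[OF q]] sc(2)[OF X] A by metis
    ultimately show ?thesis using sc[OF X] by simp
  qed
  have G: "?G = detach k q ` (\<Union>X\<in>q. S X)"
  proof (intro equalityI subsetI)
    fix p assume "p \<in> ?G"
    then have p: "p \<in> geodesic_below k q" "p \<noteq> id_part k" "single_cycle p (active k p)" by auto
    note g = geodesic_belowD[OF p]
    note P = partitionsD[OF g(6)]
    have pq: "refines (points k) p q" using p by (simp add: geodesic_below_def)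
    obtain i where i: "i \<in> active k p" using g(4) by blast
    then have ip: "Inl i \<in> points k" using g(5) by auto
    have "closed_cols p {col c | c. joined p (Inl i) c}"
      by (rule closed_cols_ear_block[OF g(6)]) (use B g(2) in simp)
    moreover have "i \<in> {col c | c. joined p (Inl i) c}" using joined_refl[OF P ip] by force
    ultimately have AD: "active k p \<subseteq> {col c | c. joined p (Inl i) c}"
      using p(3) i unfolding single_cycle_def by blast
    obtain X where X: "X \<in> q" "Inl i \<in> X" by (rule obtain_block[OF Q ip])
    have "{c. joined p (Inl i) c} \<subseteq> X"
      using refinesD[OF pq] joined_in_block[OF Q X] by auto
    then have AX: "active k p \<subseteq> col ` X" using AD by blast
    \<comment> \<open>A single column detached from the rest is again the block of an identity,
      hence not active. This is why \<open>S\<close> starts at two columns.\<close>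
    have "card (active k p) \<noteq> 1"
    proof
      assume "card (active k p) = 1"
      then have A: "active k p = {i}" using i by (metis card_1_singletonE singletonD)
      have colb: "col b = i" if "joined p (Inl i) b" for b
        using that g(1) joined_detach[OF q, of "active k p" "Inl i" b] A by simp
      have "b = Inl i \<or> b = Inr i" if "joined p (Inl i) b" for b
        using colb[OF that] by (cases b) auto
      moreover have "joined p (Inl i) (Inr i)"
        using joined_ear_col[OF g(6) ip] g(2) B by simp
      ultimately have "{b. joined p (Inl i) b} = {Inl i, Inr i}"
        using joined_refl[OF P ip] by blast
      then show False using joined_block_in[OF P ip] i by (simp add: active_def)
    qed
    moreover have "card (active k p) \<noteq> 0" using g(4) finite_active by simp
    ultimately have "card (active k p) \<ge> 2" by linarith
    then have "active k p \<in> S X" using AX by (simp add: S_def)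
    then show "p \<in> detach k q ` (\<Union>X\<in>q. S X)" using g(1) X by blast
  qed (use geo in blast)
  have inj: "inj_on (detach k q) (\<Union>X\<in>q. S X)"
    by (rule inj_on_inverseI[of _ "active k"]) (metis sc(2) UN_E)
  have "(\<Sum>p\<in>geodesic_below k q. log_cumulant_value lam k p)
      = log_cumulant_value lam k (id_part k) + (\<Sum>p\<in>geodesic_below k q - {id_part k}. log_cumulant_value lam k p)"
    by (rule sum.remove[OF fin id])
  also have "(\<Sum>p\<in>geodesic_below k q - {id_part k}. log_cumulant_value lam k p)
      = (\<Sum>p\<in>?G. log_cumulant_value lam k p)"
    by (rule sum.mono_neutral_right) (use fin in \<open>auto simp: log_cumulant_value_def\<close>)
  also have "\<dots> = (\<Sum>A\<in>(\<Union>X\<in>q. S X). log_cumulant_value lam k (detach k q A))"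
    unfolding G by (subst sum.reindex[OF inj]) simp
  also have "\<dots> = (\<Sum>A\<in>(\<Union>X\<in>q. S X). (-1) ^ card A)"
  proof (rule sum.cong)
    fix A assume "A \<in> (\<Union>X\<in>q. S X)"
    then obtain X where X: "X \<in> q" "A \<in> S X" by blast
    have "nonears k (detach k q A) = {}" using nonears_detach[OF q] B by simp
    then show "log_cumulant_value lam k (detach k q A) = (-1) ^ card A"
      using geo[OF X] sc[OF X] by (simp add: log_cumulant_value_def weight_def)
  qed simp
  also have "\<dots> = (\<Sum>X\<in>q. \<Sum>A\<in>S X. (-1) ^ card A)"
  proof (rule sum.UNION_disjoint[OF finq])
    show "\<forall>X\<in>q. finite (S X)" using finX by (simp add: S_def)
    show "\<forall>X\<in>q. \<forall>Y\<in>q. X \<noteq> Y \<longrightarrow> S X \<inter> S Y = {}"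
    proof (intro ballI impI, rule ccontr)
      fix X Y assume XY: "X \<in> q" "Y \<in> q" "X \<noteq> Y" "S X \<inter> S Y \<noteq> {}"
      then obtain A where A: "A \<subseteq> col ` X" "A \<subseteq> col ` Y" "card A \<ge> 2" by (auto simp: S_def)
      then obtain i where "i \<in> A" by fastforce
      then have "Inl i \<in> X" "Inl i \<in> Y" using inX XY A by auto
      then show False using block_eqI[OF Q XY(1,2)] XY(3) by blast
    qed
  qed
  also have "\<dots> = (\<Sum>X\<in>q. real (card (col ` X)) - 1)"
  proof (rule sum.cong)
    fix X assume X: "X \<in> q"
    let ?Y = "col ` X"
    have Y: "finite ?Y" "?Y \<noteq> {}" using finX[OF X] obtain_element[OF Q X] by auto
    have "Pow ?Y = S X \<union> insert {} ((\<lambda>i. {i}) ` ?Y)"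
    proof (intro equalityI subsetI)
      fix A assume A: "A \<in> Pow ?Y"
      then have fA: "finite A" using Y finite_subset by blast
      show "A \<in> S X \<union> insert {} ((\<lambda>i. {i}) ` ?Y)"
      proof (cases "card A \<ge> 2")
        case True then show ?thesis using A by (simp add: S_def)
      next
        case False
        then consider "card A = 0" | "card A = 1" by linarith
        then show ?thesis using A fA by cases (auto simp: card_1_singleton_iff)
      qed
    qed (auto simp: S_def)
    moreover have "S X \<inter> insert {} ((\<lambda>i. {i}) ` ?Y) = {}" by (auto simp: S_def)
    moreover have "finite (S X)" using Y by (simp add: S_def)
    moreover have "finite (insert {} ((\<lambda>i. {i}) ` ?Y))" using Y by simp
    ultimately have "(\<Sum>A\<in>Pow ?Y. (-1) ^ card A :: real)
        = (\<Sum>A\<in>S X. (-1) ^ card A) + (\<Sum>A\<in>insert {} ((\<lambda>i. {i}) ` ?Y). (-1) ^ card A)"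
      using sum.union_disjoint by metis
    moreover have "(\<Sum>A\<in>insert {} ((\<lambda>i. {i}) ` ?Y). (-1) ^ card A :: real) = 1 - real (card ?Y)"
    proof -
      have "(\<Sum>A\<in>(\<lambda>i. {i}) ` ?Y. (-1) ^ card A :: real) = (\<Sum>i\<in>?Y. - 1)"
        by (subst sum.reindex) auto
      moreover have "{} \<notin> (\<lambda>i. {i}) ` ?Y" by auto
      ultimately show ?thesis using Y by (simp add: sum.insert)
    qed
    ultimately show "(\<Sum>A\<in>S X. (-1) ^ card A :: real) = real (card ?Y) - 1"
      using sum_minus_one_power_card_Pow[OF Y(1)] Y(2) by simp
  qed simp
  also have "\<dots> = real (\<Sum>X\<in>q. card (col ` X)) - real (nc q)"
    by (simp add: sum_subtractf)
  also have "(\<Sum>X\<in>q. card (col ` X)) = card (\<Union>X\<in>q. col ` X)"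
  proof (rule card_UN_disjoint[symmetric, OF finq])
    show "\<forall>X\<in>q. finite (col ` X)" using finX by simp
    show "\<forall>X\<in>q. \<forall>Y\<in>q. X \<noteq> Y \<longrightarrow> col ` X \<inter> col ` Y = {}"
    proof (intro ballI impI, rule ccontr)
      fix X Y assume XY: "X \<in> q" "Y \<in> q" "X \<noteq> Y" "col ` X \<inter> col ` Y \<noteq> {}"
      then obtain i where "i \<in> col ` X" "i \<in> col ` Y" by blast
      then have "Inl i \<in> X" "Inl i \<in> Y" using inX XY by auto
      then show False using block_eqI[OF Q XY(1,2)] XY(3) by blast
    qed
  qed
  also have "(\<Union>X\<in>q. col ` X) = {1..k}"
  proof -
    have "(\<Union>X\<in>q. col ` X) = col ` (\<Union>q)" by blast
    also have "\<Union>q = points k" using Q by (simp add: partition_on_def)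
    also have "col ` points k = {1..k}" by (force simp: points_def)
    finally show ?thesis .
  qed
  finally show ?thesis using B by (simp add: log_cumulant_value_def moment_limit_def)
qed

lemma sum_log_cumulant_value:
  "(\<Sum>p\<in>geodesic_below k q. log_cumulant_value lam k p) = moment_limit lam k q"
  using sum_log_cumulant_value_ears sum_log_cumulant_value_nonears by blast

end

section \<open>Coefficients in the basis of partition operators\<close>

text \<open>Row indices belong to the primed points and column indices to the unprimed ones, in
  accordance with \<open>rho\<close>.\<close>

definition pair_index :: "(nat \<Rightarrow> nat) \<Rightarrow> (nat \<Rightarrow> nat) \<Rightarrow> point \<Rightarrow> nat"
  where "pair_index J K = case_sum K J"

lemma Ker_eq_classes: "Ker k I = classes (points k) (\<lambda>a b. I a = I b)"
  by (auto simp: Ker_def classes_def intro!: image_cong)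

lemma partition_on_Ker: "partition_on (points k) (Ker k I)"
  unfolding Ker_eq_classes by (rule partition_on_classes) auto

lemma joined_Ker: "joined (Ker k I) a b \<longleftrightarrow> a \<in> points k \<and> b \<in> points k \<and> I a = I b"
  unfolding Ker_eq_classes by (rule partition_on_classes) auto

lemma Ker_in_partitions: "Ker k I \<in> partitions k"
  by (simp add: partitions_def partition_on_Ker)

lemma Ker_cong: "(\<And>a. a \<in> points k \<Longrightarrow> I a = I' a) \<Longrightarrow> Ker k I = Ker k I'"
  by (rule partition_eqI[OF partition_on_Ker partition_on_Ker]) (auto simp: joined_Ker)

text \<open>The product of elementary matrices has a non-zero entry at \<open>(J, K)\<close> for
  exactly one labelling, the one read off from \<open>J\<close> and \<open>K\<close>. So the sum in
  \<open>rho\<close> only tests whether \<open>p\<close> lies below its kernel.\<close>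

lemma rho_eq:
  assumes J: "J \<in> tensor_indices N k" and K: "K \<in> tensor_indices N k"
  shows "rho N k p J K = (if refines (points k) p (Ker k (pair_index J K)) then 1 else 0)"
proof -
  define I0 where "I0 = restrict (pair_index J K) (points k)"
  have I0: "I0 \<in> points k \<rightarrow>\<^sub>E {1..N}"
  proof -
    have "pair_index J K a \<in> {1..N}" if "a \<in> points k" for a
      using that J K by (cases a) (auto simp: pair_index_def tensor_indices_def PiE_iff)
    then show ?thesis by (auto simp: I0_def)
  qed
  have KerI0: "Ker k I0 = Ker k (pair_index J K)"
    by (rule Ker_cong) (simp add: I0_def)
  have val: "tensor_product k (\<lambda>m. elementary (I (Inr m)) (I (Inl m))) J K = (if I = I0 then 1 else 0)"
    if I: "I \<in> points k \<rightarrow>\<^sub>E {1..N}" for I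
  proof (cases "I = I0")
    case True
    then show ?thesis
      unfolding tensor_product_def elementary_def True I0_def
      by (auto simp: pair_index_def intro!: prod.neutral)
  next
    case False
    then obtain a where a: "a \<in> points k" "I a \<noteq> I0 a"
      using I I0 by (metis PiE_ext)
    then have "\<exists>m\<in>{1..k}. elementary (I (Inr m)) (I (Inl m)) (J m) (K m) = 0"
      by (intro bexI[of _ "col a"]; cases a) (auto simp: I0_def pair_index_def elementary_def)
    then have "tensor_product k (\<lambda>m. elementary (I (Inr m)) (I (Inl m))) J K = 0"
      unfolding tensor_product_def by (intro prod_zero) auto
    then show ?thesis using False by simp
  qed
  let ?S = "{I \<in> points k \<rightarrow>\<^sub>E {1..N}. refines (points k) p (Ker k I)}"
  have fin: "finite ?S"
    by (rule finite_subset[of _ "points k \<rightarrow>\<^sub>E {1..N}"]) (auto intro!: finite_PiE finite_points)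
  have "rho N k p J K = (\<Sum>I\<in>?S. if I = I0 then 1 else 0)"
    unfolding rho_def by (rule sum.cong[OF refl]) (rule val, blast)
  also have "\<dots> = (if I0 \<in> ?S then 1 else 0)" using fin by simp
  also have "I0 \<in> ?S \<longleftrightarrow> refines (points k) p (Ker k (pair_index J K))"
    using I0 KerI0 by simp
  finally show ?thesis .
qed

text \<open>A partition of the \<open>2 * k\<close> points has at most \<open>2 * k\<close> blocks,
  so there are enough indices to label them differently. Thus the entries of an operator see the
  whole triangular system, which makes its coefficients unique.\<close>

lemma Ker_realizable:
  assumes q: "q \<in> partitions k" and N: "2 * k \<le> N"
  obtains J K where "J \<in> tensor_indices N k" "K \<in> tensor_indices N k" "Ker k (pair_index J K) = q"
proof -
  note Q = partitionsD[OF q]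
  have "card (points k) = 2 * k" unfolding points_def by (subst card_Plus) auto
  moreover have "card q \<le> card (points k)"
  proof -
    have "q = (\<lambda>a. {b. joined q a b}) ` points k"
    proof (intro equalityI subsetI)
      fix X assume X: "X \<in> q"
      obtain a where "a \<in> X" "a \<in> points k" by (rule obtain_element[OF Q X])
      then show "X \<in> (\<lambda>a. {b. joined q a b}) ` points k" using block_eq_joined[OF Q X] by blast
    qed (use joined_block_in[OF Q] in auto)
    then show ?thesis using card_image_le[OF finite_points] by metis
  qed
  ultimately have "card q \<le> card {1..N}" using N by simp
  then obtain f where f: "f ` q \<subseteq> {1..N}" "inj_on f q"
    using card_le_inj[OF finite_partition[OF Q]] by blast
  define I where "I a = f {b. joined q a b}" for a
  have I: "I a \<in> {1..N}" if "a \<in> points k" for a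
    using joined_block_in[OF Q that] f by (auto simp: I_def)
  define J where "J = restrict (\<lambda>m. I (Inr m)) {1..k}"
  define K where "K = restrict (\<lambda>m. I (Inl m)) {1..k}"
  have "pair_index J K a = I a" if "a \<in> points k" for a
    using that by (cases a) (auto simp: pair_index_def J_def K_def)
  then have "Ker k (pair_index J K) = Ker k I" by (rule Ker_cong)
  also have "\<dots> = q"
  proof (rule partition_eqI[OF partition_on_Ker Q])
    fix a b
    have "I a = I b \<longleftrightarrow> joined q a b" if ab: "a \<in> points k" "b \<in> points k"
    proof
      assume "I a = I b"
      then have "{c. joined q a c} = {c. joined q b c}"
        using inj_onD[OF f(2)] joined_block_in[OF Q] ab by (simp add: I_def)
      then show "joined q a b" using joined_refl[OF Q ab(2)] by auto
    next
      assume ab: "joined q a b"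
      have "joined q a c \<longleftrightarrow> joined q b c" for c
        using joined_trans[OF Q ab, of c] joined_trans[OF Q joined_sym[OF ab], of c] by blast
      then have "{c. joined q a c} = {c. joined q b c}" by simp
      then show "I a = I b" by (simp add: I_def)
    qed
    then show "joined (Ker k I) a b = joined q a b"
      using joined_in[OF Q] by (auto simp: joined_Ker)
  qed
  finally have "Ker k (pair_index J K) = q" .
  moreover have "J \<in> tensor_indices N k" "K \<in> tensor_indices N k"
    using I by (auto simp: J_def K_def tensor_indices_def)
  ultimately show ?thesis using that by blast
qed

text \<open>The size of the lower set is the induction measure for the triangular systems.\<close>

lemma lower_set_strict_subset:
  assumes "refines (points k) p q" "p \<noteq> q" "p \<in> partitions k" "q \<in> partitions k"
  shows "card {r \<in> partitions k. refines (points k) r p} < card {r \<in> partitions k. refines (points k) r q}"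
proof (rule psubset_card_mono)
  show "finite {r \<in> partitions k. refines (points k) r q}" using finite_partitions by simp
  have "q \<notin> {r \<in> partitions k. refines (points k) r p}" using assms refines_asym by blast
  moreover have "q \<in> {r \<in> partitions k. refines (points k) r q}"
    using assms refines_refl[OF partitionsD] by simp
  ultimately show "{r \<in> partitions k. refines (points k) r p} \<subset> {r \<in> partitions k. refines (points k) r q}"
    using refines_trans[OF _ assms(1)] by blast
qed

lemma lower_sum_split:
  fixes F :: "point set set \<Rightarrow> 'a::comm_monoid_add"
  assumes q: "q \<in> partitions k"
  shows "(\<Sum>p\<in>{p \<in> partitions k. refines (points k) p q}. F p) =
    F q + (\<Sum>p\<in>{p \<in> partitions k. refines (points k) p q \<and> p \<noteq> q}. F p)"
proof -
  have "{p \<in> partitions k. refines (points k) p q} =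
      insert q {p \<in> partitions k. refines (points k) p q \<and> p \<noteq> q}"
    using q refines_refl[OF partitionsD] by blast
  then show ?thesis using finite_partitions by simp
qed

section \<open>Inversion of sums over lower sets\<close>

lemma lower_sum_inversion_unique:
  fixes c d w :: "point set set \<Rightarrow> complex"
  assumes w: "\<And>p. p \<in> partitions k \<Longrightarrow> w p \<noteq> 0"
    and eq: "\<And>q. q \<in> partitions k \<Longrightarrow>
      (\<Sum>p\<in>{p \<in> partitions k. refines (points k) p q}. w p * c p) =
      (\<Sum>p\<in>{p \<in> partitions k. refines (points k) p q}. w p * d p)"
    and q: "q \<in> partitions k"
  shows "c q = d q"
  using q
proof (induction "card {r \<in> partitions k. refines (points k) r q}" arbitrary: q rule: less_induct)
  case less
  have "(\<Sum>p\<in>{p \<in> partitions k. refines (points k) p q \<and> p \<noteq> q}. w p * c p) =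
      (\<Sum>p\<in>{p \<in> partitions k. refines (points k) p q \<and> p \<noteq> q}. w p * d p)"
    by (rule sum.cong) (use less lower_set_strict_subset in auto)
  then have "w q * c q = w q * d q"
    using eq[OF less.prems] unfolding lower_sum_split[OF less.prems] by simp
  then show ?case using w[OF less.prems] by simp
qed

lemma lower_sum_inversion_exists:
  fixes g w :: "point set set \<Rightarrow> complex"
  assumes w: "\<And>p. p \<in> partitions k \<Longrightarrow> w p \<noteq> 0"
  shows "\<exists>c. \<forall>q\<in>partitions k.
    (\<Sum>p\<in>{p \<in> partitions k. refines (points k) p q}. w p * c p) = g q"
proof -
  let ?h = "\<lambda>q. card {r \<in> partitions k. refines (points k) r q}"
  have "\<exists>c. \<forall>q\<in>partitions k. ?h q < n \<longrightarrow>
    (\<Sum>p\<in>{p \<in> partitions k. refines (points k) p q}. w p * c p) = g q" for n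
  proof (induction n)
    case (Suc n)
    then obtain c where c: "\<And>q. q \<in> partitions k \<Longrightarrow> ?h q < n \<Longrightarrow>
      (\<Sum>p\<in>{p \<in> partitions k. refines (points k) p q}. w p * c p) = g q" by blast
    \<comment> \<open>The earlier solution is kept on the smaller lower sets; at a new
      \<open>q\<close> the equation is solved for its top coefficient.\<close>
    define c' where "c' q = (if ?h q < n then c q
      else (g q - (\<Sum>p\<in>{p \<in> partitions k. refines (points k) p q \<and> p \<noteq> q}. w p * c p)) / w q)" for q
    have "(\<Sum>p\<in>{p \<in> partitions k. refines (points k) p q}. w p * c' p) = g q"
      if q: "q \<in> partitions k" "?h q < Suc n" for q
    proof -
      have "(\<Sum>p\<in>{p \<in> partitions k. refines (points k) p q \<and> p \<noteq> q}. w p * c' p) =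
        (\<Sum>p\<in>{p \<in> partitions k. refines (points k) p q \<and> p \<noteq> q}. w p * c p)"
      proof (rule sum.cong)
        fix p assume "p \<in> {p \<in> partitions k. refines (points k) p q \<and> p \<noteq> q}"
        then have "?h p < ?h q" using lower_set_strict_subset q by blast
        then show "w p * c' p = w p * c p" using q by (simp add: c'_def)
      qed simp
      then show ?thesis
        using c[OF q(1)] w[OF q(1)] unfolding lower_sum_split[OF q(1)] by (simp add: c'_def)
    qed
    then show ?case by blast
  qed auto
  from this[of "Suc (card (partitions k))"] obtain c where
    c: "\<forall>q\<in>partitions k. ?h q < Suc (card (partitions k)) \<longrightarrow>
      (\<Sum>p\<in>{p \<in> partitions k. refines (points k) p q}. w p * c p) = g q" by blast
  moreover have "?h q < Suc (card (partitions k))" for q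
    using card_mono[OF finite_partitions, of "{r \<in> partitions k. refines (points k) r q}" k]
    by (simp add: less_Suc_eq_le subset_iff)
  ultimately show ?thesis by blast
qed

text \<open>By \<open>rho_eq\<close> the entries of the expansion are sums over lower sets, and
  every \<open>q\<close> occurs as a kernel. So the condition in \<open>kappa\<close> is the
  triangular system, whose solution is unique on \<open>partitions k\<close> and, by extensionality,
  also outside.\<close>

lemma kappa_lower_sum:
  assumes N: "2 * k \<le> N" "1 \<le> N"
    and G: "\<And>J K. J \<in> tensor_indices N k \<Longrightarrow> K \<in> tensor_indices N k \<Longrightarrow>
      G J K = g (Ker k (pair_index J K))"
    and q: "q \<in> partitions k"
  shows "(\<Sum>p\<in>{p \<in> partitions k. refines (points k) p q}.
    of_nat N powi (- part_rank k p) * kappa N k G p) = g q"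
proof -
  define w where "w p = (of_nat N powi (- part_rank k p) :: complex)" for p
  define low where "low q = {p \<in> partitions k. refines (points k) p q}" for q
  have w: "w p \<noteq> 0" for p using N by (simp add: w_def)
  let ?P = "\<lambda>c. c \<in> extensional (partitions k) \<and>
       (\<forall>J \<in> tensor_indices N k. \<forall>K \<in> tensor_indices N k.
          G J K = (\<Sum>p\<in>partitions k.
            of_nat N powi (- (int (nc p) - int (nc (cycles_of k p)))) * c p * rho N k p J K))"
  have sum_eq: "(\<Sum>p\<in>partitions k. of_nat N powi (- (int (nc p) - int (nc (cycles_of k p)))) * c p * rho N k p J K)
      = (\<Sum>p\<in>low (Ker k (pair_index J K)). w p * c p)"
    if "J \<in> tensor_indices N k" "K \<in> tensor_indices N k" for J K c
    unfolding low_def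
    by (rule sum.mono_neutral_cong_right)
      (use rho_eq[OF that] finite_partitions in \<open>auto simp: w_def part_rank_def\<close>)
  have P_iff: "?P c \<longleftrightarrow> c \<in> extensional (partitions k) \<and>
      (\<forall>q\<in>partitions k. (\<Sum>p\<in>low q. w p * c p) = g q)" for c
  proof
    assume P: "?P c"
    have "(\<Sum>p\<in>low q. w p * c p) = g q" if q: "q \<in> partitions k" for q
    proof -
      obtain J K where JK: "J \<in> tensor_indices N k" "K \<in> tensor_indices N k" "Ker k (pair_index J K) = q"
        by (rule Ker_realizable[OF q N(1)])
      then show ?thesis using P G[OF JK(1,2)] sum_eq[OF JK(1,2), of c] by simp
    qed
    then show "c \<in> extensional (partitions k) \<and> (\<forall>q\<in>partitions k. (\<Sum>p\<in>low q. w p * c p) = g q)"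
      using P by blast
  next
    assume "c \<in> extensional (partitions k) \<and> (\<forall>q\<in>partitions k. (\<Sum>p\<in>low q. w p * c p) = g q)"
    then show "?P c" using G sum_eq[of _ _ c] Ker_in_partitions by simp
  qed
  obtain c where c: "\<And>q. q \<in> partitions k \<Longrightarrow> (\<Sum>p\<in>low q. w p * c p) = g q"
    using lower_sum_inversion_exists[of k w g] w unfolding low_def by blast
  define c0 where "c0 = restrict c (partitions k)"
  have "?P c0" unfolding P_iff
  proof (intro conjI ballI)
    show "c0 \<in> extensional (partitions k)" by (simp add: c0_def)
    fix q assume q: "q \<in> partitions k"
    have "(\<Sum>p\<in>low q. w p * c0 p) = (\<Sum>p\<in>low q. w p * c p)"
      by (rule sum.cong) (auto simp: c0_def low_def)
    then show "(\<Sum>p\<in>low q. w p * c0 p) = g q" using c[OF q] by simp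
  qed
  moreover have "c' = c0" if P': "?P c'" for c'
  proof (rule extensionalityI)
    show "c' \<in> extensional (partitions k)" "c0 \<in> extensional (partitions k)"
      using P' \<open>?P c0\<close> by blast+
    have s: "(\<Sum>p\<in>low q. w p * c' p) = (\<Sum>p\<in>low q. w p * c0 p)" if "q \<in> partitions k" for q
      using P'[unfolded P_iff] \<open>?P c0\<close>[unfolded P_iff] that by simp
    fix q assume "q \<in> partitions k"
    then show "c' q = c0 q"
      using lower_sum_inversion_unique[of k w c' c0, OF w s[unfolded low_def]] by blast
  qed
  ultimately have "?P (kappa N k G)"
    unfolding kappa_def by (rule theI)
  then show ?thesis using q unfolding P_iff w_def low_def by blast
qed

text \<open>Multiplied by \<open>N^rank q\<close>, the equation for \<open>q\<close> expresses
  \<open>kap N q\<close> through strictly finer partitions, with factors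
  \<open>N^(rank q - rank p)\<close>. By \<open>rank_antimono\<close> the exponents are at most 0,
  so only the terms of equal rank survive, and the induction hypothesis gives their limits.\<close>

lemma lower_sum_limit:
  fixes kap :: "nat \<Rightarrow> point set set \<Rightarrow> complex" and L m :: "point set set \<Rightarrow> complex"
  assumes eq: "\<And>q. q \<in> partitions k \<Longrightarrow> \<forall>\<^sub>F N in sequentially.
      (\<Sum>p\<in>{p \<in> partitions k. refines (points k) p q}. of_nat N powi (- part_rank k p) * kap N p) = g N q"
    and g: "\<And>q. q \<in> partitions k \<Longrightarrow> (\<lambda>N. of_nat N powi part_rank k q * g N q) \<longlonglongrightarrow> m q"
    and L: "\<And>q. q \<in> partitions k \<Longrightarrow> (\<Sum>p\<in>geodesic_below k q. L p) = m q"
    and q: "q \<in> partitions k"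
  shows "(\<lambda>N. kap N q) \<longlonglongrightarrow> L q"
  using q
proof (induction "card {r \<in> partitions k. refines (points k) r q}" arbitrary: q rule: less_induct)
  case (less q)
  note q = less.prems
  let ?low = "{p \<in> partitions k. refines (points k) p q \<and> p \<noteq> q}"
  have IH: "(\<lambda>N. kap N p) \<longlonglongrightarrow> L p" if "p \<in> ?low" for p
    using less that lower_set_strict_subset by blast
  have pw: "(\<lambda>N. of_nat N powi (part_rank k q - part_rank k p) :: complex) \<longlonglongrightarrow> (if part_rank k p = part_rank k q then 1 else 0)"
    if p: "p \<in> ?low" for p
  proof (cases "part_rank k p = part_rank k q")
    case False
    then have less: "part_rank k q - part_rank k p < 0" using rank_antimono[of p k q] p q by simp
    define n where "n = nat (part_rank k p - part_rank k q)"
    have n: "part_rank k q - part_rank k p = - int n" "n > 0" using less by (simp_all add: n_def)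
    have "(\<lambda>N. inverse (of_nat N ^ n) :: complex) \<longlonglongrightarrow> 0"
    proof -
      have "(\<lambda>N. inverse (of_nat N) ^ n :: complex) \<longlonglongrightarrow> 0 ^ n"
        by (intro tendsto_power lim_inverse_n)
      moreover have "(0::complex) ^ n = 0" using n(2) by simp
      ultimately show ?thesis by (simp only: power_inverse)
    qed
    then show ?thesis using False unfolding n(1) by (simp add: power_int_minus)
  qed simp
  have "(\<lambda>N. of_nat N powi part_rank k q * g N q - (\<Sum>p\<in>?low. of_nat N powi (part_rank k q - part_rank k p) * kap N p))
      \<longlonglongrightarrow> m q - (\<Sum>p\<in>?low. (if part_rank k p = part_rank k q then 1 else 0) * L p)"
    by (intro tendsto_diff g[OF q] tendsto_sum tendsto_mult pw IH)
  also have "m q - (\<Sum>p\<in>?low. (if part_rank k p = part_rank k q then 1 else 0) * L p) = L q"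
  proof -
    let ?E = "{p \<in> ?low. part_rank k p = part_rank k q}"
    have 1: "(\<Sum>p\<in>?low. (if part_rank k p = part_rank k q then 1 else 0) * L p) = sum L ?E"
      by (rule sum.mono_neutral_cong_right) (use finite_partitions in auto)
    have 2: "geodesic_below k q = insert q ?E"
      using q refines_refl[OF partitionsD[OF q]] by (auto simp: geodesic_below_def)
    have "m q = L q + sum L ?E"
      unfolding L[OF q, symmetric] 2 by (rule sum.insert) (use finite_partitions in auto)
    then show ?thesis unfolding 1 by (rule ssubst) (rule add_diff_cancel_right')
  qed
  finally show ?case
  proof (rule Lim_transform_eventually)
    have "\<forall>\<^sub>F N in sequentially. N \<ge> (1::nat)" by (rule eventually_ge_at_top)
    with eq[OF q] show "\<forall>\<^sub>F N in sequentially. of_nat N powi part_rank k q * g N q -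
        (\<Sum>p\<in>?low. of_nat N powi (part_rank k q - part_rank k p) * kap N p) = kap N q"
    proof eventually_elim
      case (elim N)
      have N0: "(of_nat N :: complex) \<noteq> 0" using elim(2) by simp
      have "of_nat N powi part_rank k q * g N q = kap N q +
          (\<Sum>p\<in>?low. of_nat N powi part_rank k q * (of_nat N powi (- part_rank k p) * kap N p))"
        unfolding elim(1)[symmetric] lower_sum_split[OF q] distrib_left sum_distrib_left
        using N0 by (simp flip: power_int_add mult.assoc)
      also have "(\<Sum>p\<in>?low. of_nat N powi part_rank k q * (of_nat N powi (- part_rank k p) * kap N p)) =
          (\<Sum>p\<in>?low. of_nat N powi (part_rank k q - part_rank k p) * kap N p)"
        using N0 by (intro sum.cong) (simp_all add: power_int_diff power_int_minus field_simps)
      finally show ?case by simp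
    qed
  qed
qed

section \<open>Counting the colourings compatible with a permutation\<close>

definition colourings :: "nat \<Rightarrow> point set set \<Rightarrow> nat set \<Rightarrow> (point \<Rightarrow> nat) set"
  where "colourings k q F = {I \<in> points k \<rightarrow>\<^sub>E F. Ker k I = q}"

text \<open>Exactly in this case the tensor power of the matrix of \<sigma> has the entry 1 at the
  indices coded by \<open>I\<close>.\<close>

definition fits :: "nat \<Rightarrow> (nat \<Rightarrow> nat) \<Rightarrow> (point \<Rightarrow> nat) \<Rightarrow> bool"
  where "fits k \<sigma> I \<longleftrightarrow> (\<forall>m\<in>{1..k}. \<sigma> (I (Inl m)) = I (Inr m))"

lemma finite_colourings: "finite F \<Longrightarrow> finite (colourings k q F)"
  unfolding colourings_def by (rule finite_subset[of _ "points k \<rightarrow>\<^sub>E F"]) (auto intro!: finite_PiE finite_points)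

lemma colouring_eq_iff:
  assumes "I \<in> colourings k q F" "a \<in> points k" "b \<in> points k"
  shows "I a = I b \<longleftrightarrow> joined q a b"
  using assms joined_Ker[of k I a b] by (auto simp: colourings_def)

lemma colouringsI:
  assumes q: "q \<in> partitions k" and I: "I \<in> points k \<rightarrow>\<^sub>E F"
    and "\<And>a b. a \<in> points k \<Longrightarrow> b \<in> points k \<Longrightarrow> I a = I b \<longleftrightarrow> joined q a b"
  shows "I \<in> colourings k q F"
proof -
  have "Ker k I = q"
    by (rule partition_eqI[OF partition_on_Ker partitionsD[OF q]])
      (use assms joined_in[OF partitionsD[OF q]] in \<open>auto simp: joined_Ker\<close>)
  then show ?thesis using I by (simp add: colourings_def)
qed

abbreviation block_of :: "'a set set \<Rightarrow> 'a \<Rightarrow> 'a set"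
  where "block_of q a \<equiv> {b. joined q a b}"

lemma block_of_eq_iff:
  assumes "partition_on A q" "a \<in> A" "b \<in> A"
  shows "block_of q a = block_of q b \<longleftrightarrow> joined q a b"
proof
  assume "block_of q a = block_of q b"
  then show "joined q a b" using joined_refl[OF assms(1,3)] by auto
next
  assume ab: "joined q a b"
  have "joined q a c \<longleftrightarrow> joined q b c" for c
    using joined_trans[OF assms(1) ab, of c] joined_trans[OF assms(1) joined_sym[OF ab], of c] by blast
  then show "block_of q a = block_of q b" by simp
qed

lemma card_injections:
  assumes "finite A" "finite F"
  shows "card {f \<in> A \<rightarrow>\<^sub>E F. inj_on f A} = (\<Prod>i<card A. card F - i)"
  using card_inj_on_subset_funcset[of A F A] assms by (simp add: atLeast0LessThan)

text \<open>A colouring is an injection of the blocks into the labels. The truncated subtraction is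
  harmless: with too few labels the factor for \<open>i = card F\<close> is 0.\<close>

lemma card_colourings:
  assumes q: "q \<in> partitions k" and F: "finite F"
  shows "card (colourings k q F) = (\<Prod>i<nc q. card F - i)"
proof -
  note Q = partitionsD[OF q]
  have "bij_betw (\<lambda>f. restrict (\<lambda>a. f (block_of q a)) (points k))
      {f \<in> q \<rightarrow>\<^sub>E F. inj_on f q} (colourings k q F)"
  proof (rule bij_betwI')
    fix f g assume f: "f \<in> {f \<in> q \<rightarrow>\<^sub>E F. inj_on f q}" and g: "g \<in> {f \<in> q \<rightarrow>\<^sub>E F. inj_on f q}"
    show "(restrict (\<lambda>a. f (block_of q a)) (points k) = restrict (\<lambda>a. g (block_of q a)) (points k)) = (f = g)"
    proof
      assume eq: "restrict (\<lambda>a. f (block_of q a)) (points k) = restrict (\<lambda>a. g (block_of q a)) (points k)"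
      have "f X = g X" if X: "X \<in> q" for X
      proof -
        obtain a where a: "a \<in> X" "a \<in> points k" by (rule obtain_element[OF Q X])
        then show ?thesis using fun_cong[OF eq, of a] block_eq_joined[OF Q X a(1)] by simp
      qed
      then show "f = g" using f g by (intro PiE_ext[of f q "\<lambda>_. F" g]) auto
    qed simp
  next
    fix f assume f: "f \<in> {f \<in> q \<rightarrow>\<^sub>E F. inj_on f q}"
    show "restrict (\<lambda>a. f (block_of q a)) (points k) \<in> colourings k q F"
    proof (rule colouringsI[OF q])
      show "restrict (\<lambda>a. f (block_of q a)) (points k) \<in> points k \<rightarrow>\<^sub>E F"
        using f joined_block_in[OF Q] by auto
      fix a b assume ab: "a \<in> points k" "b \<in> points k"
      have "f (block_of q a) = f (block_of q b) \<longleftrightarrow> block_of q a = block_of q b"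
        using f joined_block_in[OF Q] ab by (auto dest: inj_onD)
      then show "restrict (\<lambda>a. f (block_of q a)) (points k) a = restrict (\<lambda>a. f (block_of q a)) (points k) b
          \<longleftrightarrow> joined q a b"
        using ab block_of_eq_iff[OF Q ab] by simp
    qed
  next
    fix I assume I: "I \<in> colourings k q F"
    define f where "f = restrict (\<lambda>X. I (SOME a. a \<in> X)) q"
    have f: "f (block_of q a) = I a" if a: "a \<in> points k" for a
    proof -
      define b where "b = (SOME b. b \<in> block_of q a)"
      have "b \<in> block_of q a" unfolding b_def by (rule someI[of _ a]) (simp add: joined_refl[OF Q a])
      then have "I a = I b" using colouring_eq_iff[OF I a, of b] joined_in[OF Q, of a b] by simp
      then show ?thesis using joined_block_in[OF Q a] by (simp add: f_def b_def)
    qed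
    have IE: "I \<in> points k \<rightarrow>\<^sub>E F" using I by (simp add: colourings_def)
    have blk: "\<exists>a\<in>points k. X = block_of q a" if X: "X \<in> q" for X
      using obtain_element[OF Q X] block_eq_joined[OF Q X] by metis
    have "f \<in> q \<rightarrow>\<^sub>E F"
    proof (rule PiE_I)
      fix X assume "X \<in> q"
      then obtain a where "a \<in> points k" "X = block_of q a" using blk by blast
      then show "f X \<in> F" using f IE by auto
    qed (simp add: f_def)
    moreover have "inj_on f q"
    proof (rule inj_onI)
      fix X Y assume "X \<in> q" "Y \<in> q" and eq: "f X = f Y"
      then obtain a b where "a \<in> points k" "X = block_of q a" "b \<in> points k" "Y = block_of q b"
        using blk by meson
      then show "X = Y" using f eq colouring_eq_iff[OF I] block_of_eq_iff[OF Q] by simp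
    qed
    moreover have "I = restrict (\<lambda>a. f (block_of q a)) (points k)"
      using f IE by (intro extensionalityI[of I "points k"]) (auto simp: PiE_def)
    ultimately show "\<exists>f\<in>{f \<in> q \<rightarrow>\<^sub>E F. inj_on f q}. I = restrict (\<lambda>a. f (block_of q a)) (points k)"
      by blast
  qed
  then show ?thesis
    using card_injections[OF finite_partition[OF Q] F] by (simp add: bij_betw_same_card)
qed

text \<open>Turns a partial relabelling of indices, or a numbering of columns, into a permutation
  that can be used for conjugation or as a permutation of columns.\<close>

lemma permutes_extend_injection:
  assumes "finite S" "A \<subseteq> S" "inj_on f A" "f ` A \<subseteq> S"
  obtains \<tau> where "\<tau> permutes S" "\<And>x. x \<in> A \<Longrightarrow> \<tau> x = f x"
proof -
  have fA: "finite A" using assms finite_subset by blast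
  have "card (S - A) = card (S - f ` A)"
    using assms fA by (simp add: card_Diff_subset card_image)
  then obtain g where g: "bij_betw g (S - A) (S - f ` A)"
    using finite_same_card_bij[of "S - A" "S - f ` A"] assms(1) by auto
  define \<tau> where "\<tau> x = (if x \<in> A then f x else if x \<in> S then g x else x)" for x
  have "bij_betw \<tau> A (f ` A)"
    using assms(3) by (subst bij_betw_cong[of _ _ f]) (auto simp: \<tau>_def bij_betw_def)
  moreover have "bij_betw \<tau> (S - A) (S - f ` A)"
    using g by (subst bij_betw_cong[of _ _ g]) (auto simp: \<tau>_def)
  ultimately have "bij_betw \<tau> (A \<union> (S - A)) (f ` A \<union> (S - f ` A))"
    by (rule bij_betw_combine) blast
  moreover have "A \<union> (S - A) = S" "f ` A \<union> (S - f ` A) = S" using assms by auto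
  ultimately have "bij_betw \<tau> S S" by simp
  then have "\<tau> permutes S"
    by (rule bij_imp_permutes) (use assms(2) in \<open>auto simp: \<tau>_def\<close>)
  then show ?thesis using that by (simp add: \<tau>_def)
qed

section \<open>Orbits and their starting points\<close>

lemma funpow_eq_iff_mod_least_power:
  assumes "permutation \<sigma>"
  shows "(\<sigma> ^^ u) x = (\<sigma> ^^ v) x \<longleftrightarrow> u mod least_power \<sigma> x = v mod least_power \<sigma> x"
proof -
  let ?t = "least_power \<sigma> x"
  have t: "(\<sigma> ^^ ?t) x = x" "?t > 0" using least_power_of_permutation[OF assms] by auto
  have "inj_on (\<lambda>i. (\<sigma> ^^ i) x) {0..<?t}"
    using cycle_of_permutation[OF assms, of x] by (simp add: distinct_map)
  then have "(\<sigma> ^^ (u mod ?t)) x = (\<sigma> ^^ (v mod ?t)) x \<longleftrightarrow> u mod ?t = v mod ?t"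
    using t(2) by (auto dest: inj_onD)
  then show ?thesis using funpow_mod_eq[OF t(1)] by simp
qed

text \<open>The labels that position 0 of a labelled head can receive: going along the orbit, two
  labels must coincide exactly when the labelling wants the points joined, and all of them must be
  moved.\<close>

definition orbit_starts :: "nat \<Rightarrow> (nat \<Rightarrow> nat) \<Rightarrow> (nat \<Rightarrow> nat) \<Rightarrow> nat \<Rightarrow> nat set"
  where "orbit_starts N \<sigma> step s = {x \<in> {1..N}. \<sigma> x \<noteq> x \<and>
    (\<forall>u<s. \<forall>v<s. ((\<sigma> ^^ u) x = (\<sigma> ^^ v) x \<longleftrightarrow> u = v) \<and> ((\<sigma> ^^ u) x = (\<sigma> ^^ Suc v) x \<longleftrightarrow> u = step v))}"

text \<open>For \<open>v = s - 1\<close> the second condition closes the orbit after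
  \<open>s\<close> steps, and the first one excludes an earlier return. A period of at least 2 makes
  the point a moved one.\<close>

lemma orbit_starts_necklace:
  assumes "permutation \<sigma>" "s \<ge> 2"
  shows "orbit_starts N \<sigma> (\<lambda>x. Suc x mod s) s = {x \<in> {1..N}. least_power \<sigma> x = s}"
proof (intro equalityI subsetI)
  fix x assume "x \<in> orbit_starts N \<sigma> (\<lambda>x. Suc x mod s) s"
  then have x: "x \<in> {1..N}"
    and eq: "\<And>u v. u < s \<Longrightarrow> v < s \<Longrightarrow> (\<sigma> ^^ u) x = (\<sigma> ^^ v) x \<longleftrightarrow> u = v"
      "\<And>u v. u < s \<Longrightarrow> v < s \<Longrightarrow> (\<sigma> ^^ u) x = (\<sigma> ^^ Suc v) x \<longleftrightarrow> u = Suc v mod s"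
    by (auto simp: orbit_starts_def)
  have t: "(\<sigma> ^^ least_power \<sigma> x) x = x" "least_power \<sigma> x > 0"
    using least_power_of_permutation[OF assms(1)] by auto
  have "(\<sigma> ^^ 0) x = (\<sigma> ^^ Suc (s - 1)) x" using eq(2)[of 0 "s - 1"] assms(2) by simp
  then have "least_power \<sigma> x \<le> s" using assms(2) by (intro least_power_le) simp_all
  moreover have "\<not> least_power \<sigma> x < s"
    using eq(1)[of "least_power \<sigma> x" 0] t by fastforce
  ultimately show "x \<in> {x \<in> {1..N}. least_power \<sigma> x = s}" using x by simp
next
  fix x assume "x \<in> {x \<in> {1..N}. least_power \<sigma> x = s}"
  then have x: "x \<in> {1..N}" "least_power \<sigma> x = s" by auto
  note pow = funpow_eq_iff_mod_least_power[OF assms(1), of _ x, unfolded x(2)]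
  have "\<sigma> x \<noteq> x" using pow[of 1 0] assms(2) by simp
  then show "x \<in> orbit_starts N \<sigma> (\<lambda>x. Suc x mod s) s"
    using x(1) pow unfolding orbit_starts_def by (simp del: funpow.simps)
qed

text \<open>The primed points at the last position carry the iterate of order \<open>s\<close>, so a
  chain of length \<open>s\<close> occupies \<open>s + 1\<close> distinct labels. Hence the period
  must exceed \<open>s\<close>, not merely reach it.\<close>

lemma orbit_starts_chain:
  assumes "permutation \<sigma>" "s \<ge> 1"
  shows "orbit_starts N \<sigma> Suc s = {x \<in> {1..N}. least_power \<sigma> x > s}"
proof (intro equalityI subsetI)
  fix x assume "x \<in> orbit_starts N \<sigma> Suc s"
  then have x: "x \<in> {1..N}"
    and eq: "\<And>u v. u < s \<Longrightarrow> v < s \<Longrightarrow> (\<sigma> ^^ u) x = (\<sigma> ^^ Suc v) x \<longleftrightarrow> u = Suc v"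
    by (auto simp: orbit_starts_def)
  have t: "(\<sigma> ^^ least_power \<sigma> x) x = x" "least_power \<sigma> x > 0"
    using least_power_of_permutation[OF assms(1)] by auto
  have "\<not> least_power \<sigma> x \<le> s"
  proof
    assume le: "least_power \<sigma> x \<le> s"
    have "least_power \<sigma> x - 1 < s" using le t(2) by linarith
    then have "0 = Suc (least_power \<sigma> x - 1)"
      using eq[of 0 "least_power \<sigma> x - 1"] t by (simp del: funpow.simps add: funpow_0)
    then show False by simp
  qed
  then show "x \<in> {x \<in> {1..N}. least_power \<sigma> x > s}" using x by simp
next
  fix x assume "x \<in> {x \<in> {1..N}. least_power \<sigma> x > s}"
  then have x: "x \<in> {1..N}" "least_power \<sigma> x > s" by auto
  note pow = funpow_eq_iff_mod_least_power[OF assms(1), of _ x]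
  have "\<sigma> x \<noteq> x" using pow[of 1 0] x(2) assms(2) by simp
  then show "x \<in> orbit_starts N \<sigma> Suc s"
    using x pow unfolding orbit_starts_def by (simp del: funpow.simps)
qed

context
  fixes N k :: nat and \<sigma> :: "nat \<Rightarrow> nat" and q :: "point set set"
  assumes \<sigma>: "\<sigma> permutes {1..N}" and q: "q \<in> partitions k"
begin

private abbreviation (input) "B \<equiv> nonears k q"
private abbreviation (input) "Fix \<equiv> {x \<in> {1..N}. \<sigma> x = x}"
private abbreviation (input) "Moved \<equiv> {x \<in> {1..N}. \<sigma> x \<noteq> x}"

lemma sigma_inj: "\<sigma> x = \<sigma> y \<longleftrightarrow> x = y"
  using permutes_inj[OF \<sigma>] by (auto dest: injD)

text \<open>The label at \<open>i'\<close> is the image of the label at \<open>i\<close>, and the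
  two agree exactly when they share a block. Injectivity of \<sigma> carries the property of being
  fixed over to the primed point.\<close>

lemma fits_fixed_iff:
  assumes I: "I \<in> colourings k q {1..N}" and fit: "fits k \<sigma> I" and a: "a \<in> points k"
  shows "\<sigma> (I a) = I a \<longleftrightarrow> col a \<notin> nonears k q"
proof -
  have m: "col a \<in> {1..k}" using a by (simp add: in_points_iff)
  have "\<sigma> (I (Inl (col a))) = I (Inr (col a))" using fit m by (simp add: fits_def)
  moreover have "I (Inl (col a)) = I (Inr (col a)) \<longleftrightarrow> col a \<notin> nonears k q"
    using colouring_eq_iff[OF I, of "Inl (col a)" "Inr (col a)"] m by (simp add: nonears_def)
  moreover have "\<sigma> (I (Inr (col a))) = \<sigma> (I (Inl (col a))) \<longleftrightarrow> I (Inr (col a)) = I (Inl (col a))"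
    by (rule sigma_inj)
  ultimately show ?thesis by (cases a) auto
qed

text \<open>Labels are constant on blocks, and by \<open>fits_fixed_iff\<close> the label alone
  decides whether a column is an ear.\<close>

lemma fits_closed_cols:
  assumes I: "I \<in> colourings k q {1..N}" and fit: "fits k \<sigma> I"
  shows "closed_cols q (nonears k q)"
  unfolding closed_cols_def
proof (intro allI impI)
  fix a b assume ab: "joined q a b" "col a \<in> nonears k q"
  have pts: "a \<in> points k" "b \<in> points k" using joined_in[OF partitionsD[OF q] ab(1)] by auto
  have "I a = I b" using colouring_eq_iff[OF I pts] ab(1) by simp
  then show "col b \<in> nonears k q" using fits_fixed_iff[OF I fit] pts ab(2) by metis
qed

lemma card_fits_no_nonears:
  assumes B: "nonears k q = {}"
  shows "card {I \<in> colourings k q {1..N}. fits k \<sigma> I} = (\<Prod>i<nc q. card Fix - i)"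
proof -
  have "{I \<in> colourings k q {1..N}. fits k \<sigma> I} = colourings k q Fix"
  proof (intro equalityI subsetI)
    fix I assume "I \<in> {I \<in> colourings k q {1..N}. fits k \<sigma> I}"
    then have I: "I \<in> colourings k q {1..N}" "fits k \<sigma> I" by auto
    then show "I \<in> colourings k q Fix"
      using fits_fixed_iff[OF I] B by (auto simp: colourings_def PiE_iff)
  next
    fix I assume I: "I \<in> colourings k q Fix"
    then have I': "I \<in> colourings k q {1..N}" by (auto simp: colourings_def PiE_iff)
    have "\<sigma> (I (Inl m)) = I (Inr m)" if m: "m \<in> {1..k}" for m
    proof -
      have "I (Inl m) = I (Inr m)"
        using colouring_eq_iff[OF I', of "Inl m" "Inr m"] joined_ear[OF m, of q] B m by simp
      moreover have "\<sigma> (I (Inl m)) = I (Inl m)" using I m by (auto simp: colourings_def PiE_iff)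
      ultimately show ?thesis by simp
    qed
    then show "I \<in> {I \<in> colourings k q {1..N}. fits k \<sigma> I}" using I' by (simp add: fits_def)
  qed
  then show ?thesis by (simp add: card_colourings[OF q])
qed

text \<open>A compatible colouring is determined by one value on each cycle.\<close>

lemma card_fits_two_cycles:
  assumes "\<not> single_cycle q (nonears k q)"
  shows "card {I \<in> colourings k q {1..N}. fits k \<sigma> I} \<le> card Moved ^ 2 * N ^ (nc (cycles_of k q) - 2)"
    and "nc (cycles_of k q) \<ge> 2"
proof -
  let ?c = "cycles_of k q" and ?S = "{I \<in> colourings k q {1..N}. fits k \<sigma> I}"
  note Q = partitionsD[OF q] and C = partition_on_cycles_of[OF q]
  have finc: "finite ?c" by (rule finite_partition[OF C])
  obtain D i j where D: "closed_cols q D" and i: "i \<in> nonears k q" "i \<in> D" and j: "j \<in> nonears k q" "j \<notin> D"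
    using assms unfolding single_cycle_def by blast
  have ijk: "Inl i \<in> points k" "Inl j \<in> points k" using i j by (auto simp: nonears_def)
  obtain c1 where c1: "c1 \<in> ?c" "Inl i \<in> c1" by (rule obtain_block[OF C ijk(1)])
  obtain c2 where c2: "c2 \<in> ?c" "Inl j \<in> c2" by (rule obtain_block[OF C ijk(2)])
  have ne: "c1 \<noteq> c2"
  proof
    assume "c1 = c2"
    then have "joined ?c (Inl i) (Inl j)" using c1 c2 joined_in_block[OF C c1] by simp
    then show False using closed_cols_cycles_of[OF q D] i j by force
  qed
  then show two: "nc ?c \<ge> 2"
    using card_mono[OF finc, of "{c1, c2}"] c1 c2 by simp
  \<comment> \<open>In the two cycles known to meet the head the representatives are taken in
    non-ear columns, so that their values are moved points. This improves the trivial bound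
    \<open>N^c\<close> by two factors.\<close>
  define rep where "rep c = (if c = c1 then Inl i else if c = c2 then Inl j else SOME a. a \<in> c)" for c
  have rep: "rep c \<in> c" if c: "c \<in> ?c" for c
  proof -
    obtain a where "a \<in> c" by (rule obtain_element[OF C c])
    then have "(SOME a. a \<in> c) \<in> c" by (rule someI)
    then show ?thesis using c1 c2 by (simp add: rep_def)
  qed
  have rep_pt: "rep c \<in> points k" if c: "c \<in> ?c" for c
    using rep[OF c] block_subset[OF C c] by blast
  let ?T = "PiE ?c (\<lambda>c. if c \<in> {c1, c2} then Moved else {1..N})"
  define \<Psi> where "\<Psi> I = restrict (\<lambda>c. I (rep c)) ?c" for I :: "point \<Rightarrow> nat"
  have "\<Psi> ` ?S \<subseteq> ?T"
  proof
    fix g assume "g \<in> \<Psi> ` ?S"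
    then obtain I where I: "I \<in> colourings k q {1..N}" "fits k \<sigma> I" "g = \<Psi> I" by auto
    have val: "I a \<in> {1..N}" if "a \<in> points k" for a
      using I(1) that by (auto simp: colourings_def PiE_iff)
    show "g \<in> ?T"
      unfolding I(3) \<Psi>_def
    proof (rule restrict_PiE_iff[THEN iffD2], rule ballI)
      fix c assume c: "c \<in> ?c"
      have "\<sigma> (I (rep c)) \<noteq> I (rep c)" if "c \<in> {c1, c2}"
        using fits_fixed_iff[OF I(1,2) rep_pt[OF c]] that i j by (auto simp: rep_def split: if_splits)
      then show "I (rep c) \<in> (if c \<in> {c1, c2} then Moved else {1..N})"
        using val[OF rep_pt[OF c]] by simp
    qed
  qed
  moreover have "inj_on \<Psi> ?S"
  proof (rule inj_onI)
    fix I I' assume S: "I \<in> ?S" "I' \<in> ?S" and eq: "\<Psi> I = \<Psi> I'"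
    then have I: "I \<in> colourings k q {1..N}" "fits k \<sigma> I" and I': "I' \<in> colourings k q {1..N}" "fits k \<sigma> I'"
      by auto
    \<comment> \<open>The set on which two compatible colourings agree is saturated for
      \<open>q\<close> and, as \<sigma> is injective, for the identity; so it is a union of cycles
      and is decided at the representatives.\<close>
    let ?Z = "{a \<in> points k. I a = I' a}"
    have "b \<in> ?Z" if ab: "joined q a b" "a \<in> ?Z" for a b
    proof -
      have pts: "a \<in> points k" "b \<in> points k" using joined_in[OF Q ab(1)] by auto
      have "I a = I b" using colouring_eq_iff[OF I(1) pts] ab(1) by blast
      moreover have "I' a = I' b" using colouring_eq_iff[OF I'(1) pts] ab(1) by blast
      ultimately show ?thesis using ab(2) pts(2) by simp
    qed
    then have "?Z \<in> saturated (points k) q" unfolding saturated_def by simp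
    moreover have "?Z \<in> saturated (points k) (id_part k)"
    proof -
      have "I (Inl m) = I' (Inl m) \<longleftrightarrow> I (Inr m) = I' (Inr m)" if "m \<in> {1..k}" for m
        using I(2) I'(2) that sigma_inj unfolding fits_def by metis
      then have "I a = I' a \<Longrightarrow> I b = I' b" if "joined (id_part k) a b" for a b
        using that by (cases a; cases b) (auto simp: joined_id_part)
      moreover have "b \<in> points k" if "joined (id_part k) a b" for a b
        using that by (simp add: joined_id_part)
      ultimately show ?thesis unfolding saturated_def by simp
    qed
    ultimately have Z: "?Z \<in> saturated (points k) ?c" using saturated_cycles_of[OF q] by simp
    have "I a = I' a" if a: "a \<in> points k" for a
    proof -
      obtain c where c: "c \<in> ?c" "a \<in> c" by (rule obtain_block[OF C a])
      have "rep c \<in> ?Z" using fun_cong[OF eq, of c] c(1) rep_pt[OF c(1)] by (simp add: \<Psi>_def)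
      moreover have "joined ?c (rep c) a" using joined_in_block[OF C c(1) rep[OF c(1)]] c(2) by simp
      ultimately have "a \<in> ?Z" by (rule saturatedD[OF Z _, rotated])
      then show ?thesis by simp
    qed
    then show "I = I'" using I(1) I'(1) by (intro PiE_ext[of I "points k" "\<lambda>_. {1..N}" I']) (auto simp: colourings_def)
  qed
  moreover have "finite ?T" using finc by (intro finite_PiE) auto
  ultimately have "card ?S \<le> card ?T" by (intro card_inj_on_le)
  also have "card ?T = (\<Prod>c\<in>?c. if c \<in> {c1, c2} then card Moved else N)"
    using finc by (subst card_PiE) (auto intro!: prod.cong)
  also have "\<dots> = card Moved ^ 2 * N ^ (nc ?c - 2)"
  proof -
    have "(\<Prod>c\<in>?c. if c \<in> {c1, c2} then card Moved else N) =
        (\<Prod>c\<in>?c - {c1, c2}. if c \<in> {c1, c2} then card Moved else N) * (\<Prod>c\<in>{c1, c2}. if c \<in> {c1, c2} then card Moved else N)"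
      by (rule prod.subset_diff) (use finc c1 c2 in auto)
    also have "(\<Prod>c\<in>?c - {c1, c2}. if c \<in> {c1, c2} then card Moved else N) = N ^ card (?c - {c1, c2})"
      by simp
    also have "card (?c - {c1, c2}) = nc ?c - 2"
      using c1 c2 ne finc by (subst card_Diff_subset) auto
    also have "(\<Prod>c\<in>{c1, c2}. if c \<in> {c1, c2} then card Moved else N) = card Moved ^ 2"
      using ne by (simp add: power2_eq_square)
    finally show ?thesis by simp
  qed
  finally show "card ?S \<le> card Moved ^ 2 * N ^ (nc ?c - 2)" .
qed

lemma permutation_sigma: "permutation \<sigma>"
  using \<sigma> by (auto simp: permutation_permutes)

lemma funpow_in_range: "x \<in> {1..N} \<Longrightarrow> (\<sigma> ^^ n) x \<in> {1..N}"
  using permutes_in_image[OF \<sigma>] by (induction n) auto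

lemma funpow_fixed_iff: "\<sigma> ((\<sigma> ^^ n) x) = (\<sigma> ^^ n) x \<longleftrightarrow> \<sigma> x = x"
  by (induction n) (simp_all add: sigma_inj)

text \<open>As the head shares no block with an ear, a compatible colouring consists of a start
  \<open>x\<close> for the head and an injective labelling of the other blocks by fixed points. The
  two parts cannot clash since the labels on the head are moved. Necklaces and chains are treated
  together: \<open>step\<close> is the successor wherever a next position exists.\<close>

lemma card_fits_labelled:
  assumes lab: "labelling step q (nonears k q) s h" and closed: "closed_cols q (nonears k q)"
    and step: "\<And>n. Suc n < s \<Longrightarrow> step n = Suc n"
  shows "card {I \<in> colourings k q {1..N}. fits k \<sigma> I} =
    card (orbit_starts N \<sigma> step s) * (\<Prod>i<card (q - touching q B). card Fix - i)"
proof -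
  note Q = partitionsD[OF q]
  let ?q2 = "q - touching q B"
  let ?S = "{I \<in> colourings k q {1..N}. fits k \<sigma> I}" and ?V = "orbit_starts N \<sigma> step s"
  let ?G = "{g \<in> ?q2 \<rightarrow>\<^sub>E Fix. inj_on g ?q2}"
  have s: "s \<ge> 1" and hB: "h ` B = {0..<s}"
    and lab_eq: "\<And>i j. i \<in> B \<Longrightarrow> j \<in> B \<Longrightarrow> joined q (Inl i) (Inl j) \<longleftrightarrow> h i = h j"
      "\<And>i j. i \<in> B \<Longrightarrow> j \<in> B \<Longrightarrow> joined q (Inr i) (Inr j) \<longleftrightarrow> h i = h j"
      "\<And>i j. i \<in> B \<Longrightarrow> j \<in> B \<Longrightarrow> joined q (Inl i) (Inr j) \<longleftrightarrow> h i = step (h j)"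
    using lab by (auto simp: labelling_def)
  have h_less: "h i < s" if "i \<in> B" for i using hB that by auto
  have ex_h: "\<exists>i\<in>B. h i = n" if "n < s" for n using hB that by (metis atLeast0LessThan imageE lessThan_iff)
  obtain i0 where i0: "i0 \<in> B" "h i0 = 0" using ex_h[of 0] s by auto
  have Bk: "i \<in> {1..k}" if "i \<in> B" for i using that by (simp add: nonears_def)
  have q2: "X \<in> ?q2 \<longleftrightarrow> X \<in> q \<and> (\<forall>a\<in>X. col a \<notin> B)" for X by (auto simp: touching_def)
  have blk2: "block_of q a \<in> ?q2" if a: "a \<in> points k" "col a \<notin> B" for a
    using joined_block_in[OF Q a(1)] closed_colsD[OF closed joined_sym] a(2) unfolding q2 by blast
  define F where "F = (\<lambda>(x, g). restrict (\<lambda>a. if col a \<in> B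
      then (case a of Inl i \<Rightarrow> (\<sigma> ^^ h i) x | Inr i \<Rightarrow> (\<sigma> ^^ Suc (h i)) x)
      else g (block_of q a)) (points k))"
  have F_Inl: "F (x, g) (Inl i) = (\<sigma> ^^ h i) x" and F_Inr: "F (x, g) (Inr i) = (\<sigma> ^^ Suc (h i)) x"
    if "i \<in> B" for x g i
    using that Bk by (simp_all add: F_def del: funpow.simps)
  have F_ear: "F (x, g) a = g (block_of q a)" if "a \<in> points k" "col a \<notin> B" for x g a
    using that by (simp add: F_def)
  have "bij_betw F (?V \<times> ?G) ?S"
  proof (rule bij_betwI')
    fix z w assume zw: "z \<in> ?V \<times> ?G" "w \<in> ?V \<times> ?G"
    obtain x g y g' where z: "z = (x, g)" and w: "w = (y, g')" by (cases z; cases w)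
    show "F z = F w \<longleftrightarrow> z = w"
    proof
      assume eq: "F z = F w"
      have "x = y" using fun_cong[OF eq, of "Inl i0"] i0 unfolding z w by (simp add: F_Inl)
      moreover have "g X = g' X" if X: "X \<in> ?q2" for X
      proof -
        have Xq: "X \<in> q" using X by simp
        obtain a where a: "a \<in> X" "a \<in> points k" by (rule obtain_element[OF Q Xq])
        have "X = block_of q a" by (rule block_eq_joined[OF Q Xq a(1)])
        moreover have "col a \<notin> B" using X a unfolding q2 by blast
        ultimately show ?thesis using fun_cong[OF eq, of a] F_ear[OF a(2)] unfolding z w by simp
      qed
      then have "g = g'" using zw unfolding z w by (intro PiE_ext[of g ?q2 "\<lambda>_. Fix" g']) auto
      ultimately show "z = w" using z w by simp
    qed simp
  next
    fix z assume "z \<in> ?V \<times> ?G"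
    then obtain x g where z: "z = (x, g)" and x: "x \<in> ?V" and g: "g \<in> ?q2 \<rightarrow>\<^sub>E Fix" "inj_on g ?q2"
      by (cases z) auto
    have xN: "x \<in> {1..N}" and moved: "\<sigma> x \<noteq> x"
      and x_eq: "\<And>u v. u < s \<Longrightarrow> v < s \<Longrightarrow> (\<sigma> ^^ u) x = (\<sigma> ^^ v) x \<longleftrightarrow> u = v"
        "\<And>u v. u < s \<Longrightarrow> v < s \<Longrightarrow> (\<sigma> ^^ u) x = (\<sigma> ^^ Suc v) x \<longleftrightarrow> u = step v"
      using x by (auto simp: orbit_starts_def)
    let ?I = "F (x, g)"
    have I_moved: "\<sigma> (?I a) \<noteq> ?I a" "?I a \<in> {1..N}" if a: "col a \<in> B" for a
    proof -
      have "\<exists>n. ?I a = (\<sigma> ^^ n) x" using a F_Inl F_Inr by (cases a) (auto simp del: funpow.simps)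
      then obtain n where "?I a = (\<sigma> ^^ n) x" ..
      then show "\<sigma> (?I a) \<noteq> ?I a" "?I a \<in> {1..N}"
        using funpow_fixed_iff[of n x] moved funpow_in_range[OF xN, of n] by auto
    qed
    have I_fixed: "?I a \<in> Fix" if a: "a \<in> points k" "col a \<notin> B" for a
      using F_ear[OF a] PiE_mem[OF g(1) blk2[OF a]] by simp
    have I_eq: "?I a = ?I b \<longleftrightarrow> joined q a b" if ab: "a \<in> points k" "b \<in> points k" for a b
    proof (cases "col a \<in> B"; cases "col b \<in> B")
      assume a: "col a \<in> B" and b: "col b \<in> B"
      have LR: "?I (Inl i) = ?I (Inr j) \<longleftrightarrow> joined q (Inl i) (Inr j)" if "i \<in> B" "j \<in> B" for i j
        using x_eq(2)[OF h_less h_less, OF that] lab_eq(3)[OF that] that by (simp only: F_Inl F_Inr)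
      show ?thesis
      proof (cases a; cases b)
        fix i j assume "a = Inl i" "b = Inl j"
        then show ?thesis using x_eq(1)[of "h i" "h j"] h_less lab_eq(1)[of i j] a b by (simp add: F_Inl)
      next
        fix i j assume "a = Inr i" "b = Inr j"
        then show ?thesis using x_eq(1)[of "h i" "h j"] h_less lab_eq(2)[of i j] a b
          by (simp add: F_Inr sigma_inj)
      next
        fix i j assume "a = Inl i" "b = Inr j"
        then show ?thesis using LR a b by simp
      next
        fix i j assume "a = Inr i" "b = Inl j"
        then show ?thesis using LR[of j i] a b joined_commute[of q a b] by auto
      qed
    next
      assume a: "col a \<in> B" and b: "col b \<notin> B"
      then have "?I a \<noteq> ?I b" using I_moved[OF a] I_fixed[OF ab(2) b] by auto
      then show ?thesis using closed_colsD[OF closed, of a b] a b by auto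
    next
      assume a: "col a \<notin> B" and b: "col b \<in> B"
      then have "?I a \<noteq> ?I b" using I_moved[OF b] I_fixed[OF ab(1) a] by auto
      then show ?thesis using closed_colsD[OF closed joined_sym, of a b] a b by auto
    next
      assume a: "col a \<notin> B" and b: "col b \<notin> B"
      have "?I a = ?I b \<longleftrightarrow> block_of q a = block_of q b"
        unfolding F_ear[OF ab(1) a] F_ear[OF ab(2) b]
        using inj_on_eq_iff[OF g(2) blk2[OF ab(1) a] blk2[OF ab(2) b]] .
      then show ?thesis using block_of_eq_iff[OF Q ab] by simp
    qed
    have "?I \<in> points k \<rightarrow>\<^sub>E {1..N}"
    proof (rule PiE_I)
      fix a assume a: "a \<in> points k"
      show "?I a \<in> {1..N}" using I_moved(2)[of a] I_fixed[OF a] by blast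
    qed (simp add: F_def)
    then have "?I \<in> colourings k q {1..N}" by (rule colouringsI[OF q _ I_eq])
    moreover have "\<sigma> (?I (Inl m)) = ?I (Inr m)" if m: "m \<in> {1..k}" for m
    proof (cases "m \<in> B")
      case True then show ?thesis by (simp add: F_Inl F_Inr)
    next
      case False
      then have "?I (Inl m) = ?I (Inr m)" using I_eq[of "Inl m" "Inr m"] joined_ear[OF m False] m by simp
      then show ?thesis using I_fixed[of "Inl m"] m False by simp
    qed
    ultimately show "F z \<in> ?S" unfolding z fits_def by blast
  next
    fix I assume "I \<in> ?S"
    then have I: "I \<in> colourings k q {1..N}" and fit: "fits k \<sigma> I" by auto
    note I_eq = colouring_eq_iff[OF I]
    have IN: "I a \<in> {1..N}" if "a \<in> points k" for a using I that by (auto simp: colourings_def PiE_iff)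
    have fit': "I (Inr m) = \<sigma> (I (Inl m))" if "m \<in> B" for m using fit Bk[OF that] by (simp add: fits_def)
    define x where "x = I (Inl i0)"
    \<comment> \<open>The unprimed points at position \<open>n + 1\<close> share a block with the
      primed points at position \<open>n\<close>, which carry one more application of
      \<sigma>.\<close>
    have I_pow: "I (Inl i) = (\<sigma> ^^ n) x" if "i \<in> B" "h i = n" for i n
      using that
    proof (induction n arbitrary: i)
      case 0
      then show ?case using I_eq[of "Inl i" "Inl i0"] lab_eq(1)[of i i0] i0 Bk by (simp add: x_def)
    next
      case (Suc n)
      then have ns: "Suc n < s" using h_less by metis
      then obtain j where j: "j \<in> B" "h j = n" using ex_h[of n] by auto
      have "joined q (Inl i) (Inr j)" using lab_eq(3)[of i j] Suc.prems j step[OF ns] by simp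
      then have "I (Inl i) = I (Inr j)" using I_eq[of "Inl i" "Inr j"] Suc.prems j Bk by simp
      then show ?case using fit'[OF j(1)] Suc.IH[OF j] by simp
    qed
    have "x \<in> ?V"
      unfolding orbit_starts_def
    proof (intro CollectI conjI allI impI)
      show "x \<in> {1..N}" unfolding x_def by (rule IN) (use i0 Bk in simp)
      show "\<sigma> x \<noteq> x"
        unfolding x_def using fits_fixed_iff[OF I fit, of "Inl i0"] i0 Bk by simp
      fix u v assume uv: "u < s" "v < s"
      obtain i j where i: "i \<in> B" "h i = u" and j: "j \<in> B" "h j = v" using ex_h uv by meson
      show "(\<sigma> ^^ u) x = (\<sigma> ^^ v) x \<longleftrightarrow> u = v"
        using I_eq[of "Inl i" "Inl j"] I_pow[OF i] I_pow[OF j] lab_eq(1)[OF i(1) j(1)] i j Bk by simp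
      show "(\<sigma> ^^ u) x = (\<sigma> ^^ Suc v) x \<longleftrightarrow> u = step v"
        using I_eq[of "Inl i" "Inr j"] I_pow[OF i] I_pow[OF j] fit'[OF j(1)] lab_eq(3)[OF i(1) j(1)] i j Bk
        by simp
    qed
    moreover define g where "g = restrict (\<lambda>X. I (SOME a. a \<in> X)) ?q2"
    have g_blk: "g (block_of q a) = I a" if a: "a \<in> points k" "col a \<notin> B" for a
    proof -
      define b where "b = (SOME b. b \<in> block_of q a)"
      have "b \<in> block_of q a" unfolding b_def by (rule someI[of _ a]) (simp add: joined_refl[OF Q a(1)])
      then have "I a = I b" using I_eq[OF a(1), of b] joined_in[OF Q, of a b] by simp
      then show ?thesis using blk2[OF a] by (simp add: g_def b_def)
    qed
    have blk: "\<exists>a\<in>points k. col a \<notin> B \<and> X = block_of q a" if X: "X \<in> ?q2" for X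
    proof -
      have Xq: "X \<in> q" using X by simp
      obtain a where "a \<in> X" "a \<in> points k" by (rule obtain_element[OF Q Xq])
      then show ?thesis using block_eq_joined[OF Q Xq] X unfolding q2 by blast
    qed
    have "g \<in> ?q2 \<rightarrow>\<^sub>E Fix"
    proof (rule PiE_I)
      fix X assume "X \<in> ?q2"
      then obtain a where a: "a \<in> points k" "col a \<notin> B" "X = block_of q a" using blk by blast
      then show "g X \<in> Fix" using g_blk[OF a(1,2)] IN[OF a(1)] fits_fixed_iff[OF I fit a(1)] by simp
    next
      fix X assume "X \<notin> ?q2"
      then show "g X = undefined" unfolding g_def restrict_def by (rule if_not_P)
    qed
    moreover have "inj_on g ?q2"
    proof (rule inj_onI)
      fix X Y assume X: "X \<in> ?q2" and Y: "Y \<in> ?q2" and eq: "g X = g Y"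
      obtain a where a: "a \<in> points k" "col a \<notin> B" "X = block_of q a" using blk[OF X] by blast
      obtain b where b: "b \<in> points k" "col b \<notin> B" "Y = block_of q b" using blk[OF Y] by blast
      show "X = Y" using g_blk[OF a(1,2)] g_blk[OF b(1,2)] eq I_eq[OF a(1) b(1)]
          block_of_eq_iff[OF Q a(1) b(1)] a(3) b(3) by simp
    qed
    moreover have "I = F (x, g)"
    proof (rule extensionalityI[of _ "points k"])
      show "I \<in> extensional (points k)" using I by (simp add: colourings_def PiE_def)
      show "F (x, g) \<in> extensional (points k)" by (simp add: F_def)
      fix a assume a: "a \<in> points k"
      show "I a = F (x, g) a"
      proof (cases "col a \<in> B")
        case True
        then show ?thesis using I_pow fit' by (cases a) (auto simp: F_Inl F_Inr)
      next
        case False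
        then show ?thesis using g_blk[OF a] F_ear[OF a] by simp
      qed
    qed
    ultimately show "\<exists>z\<in>?V \<times> ?G. I = F z" by blast
  qed
  then have "card ?S = card (?V \<times> ?G)" by (simp add: bij_betw_same_card)
  also have "\<dots> = card ?V * (\<Prod>i<card ?q2. card Fix - i)"
    using finite_partition[OF Q] by (simp add: card_cartesian_product card_injections)
  finally show ?thesis .
qed

text \<open>The values of a compatible colouring at the columns of the non-trivial cycle form either a
  whole orbit of \<open>\<sigma>\<close> or a segment of an orbit.\<close>

lemma fits_single_cycle:
  assumes I: "I \<in> colourings k q {1..N}" and fit: "fits k \<sigma> I"
    and single: "single_cycle q (nonears k q)" and ne: "nonears k q \<noteq> {}"
  obtains s where "necklace_like q (nonears k q) s \<or> chain_like q (nonears k q) s"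
proof -
  define X where "X = (\<lambda>i. I (Inl i)) ` B"
  note closed = fits_closed_cols[OF I fit]
  note I_eq = colouring_eq_iff[OF I]
  have Bk: "i \<in> {1..k}" if "i \<in> B" for i using that by (simp add: nonears_def)
  have fit': "I (Inr m) = \<sigma> (I (Inl m))" if "m \<in> B" for m using fit Bk[OF that] by (simp add: fits_def)
  have J: "joined q (Inl i) (Inl j) \<longleftrightarrow> I (Inl i) = I (Inl j)"
    "joined q (Inr i) (Inr j) \<longleftrightarrow> I (Inl i) = I (Inl j)"
    "joined q (Inl i) (Inr j) \<longleftrightarrow> I (Inl i) = \<sigma> (I (Inl j))" if "i \<in> B" "j \<in> B" for i j
    using I_eq[of "Inl i" "Inl j"] I_eq[of "Inr i" "Inr j"] I_eq[of "Inl i" "Inr j"] that Bk fit'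
      sigma_inj by auto
  \<comment> \<open>Connectedness of the head in terms of labels: a set \<open>Z\<close> that meets
    \<open>X\<close>, and that \<sigma> neither enters nor leaves within \<open>X\<close>, contains
    \<open>X\<close>.\<close>
  have all: "X \<subseteq> Z" if Z: "x0 \<in> X \<inter> Z" "\<And>x. x \<in> X \<Longrightarrow> \<sigma> x \<in> X \<Longrightarrow> x \<in> Z \<longleftrightarrow> \<sigma> x \<in> Z" for Z x0
  proof -
    define D where "D = {i \<in> B. I (Inl i) \<in> Z}"
    have "col b \<in> D" if ab: "joined q a b" "col a \<in> D" for a b
    proof -
      have aB: "col a \<in> B" "I (Inl (col a)) \<in> Z" using ab by (auto simp: D_def)
      have bB: "col b \<in> B" using closed_colsD[OF closed ab(1) aB(1)] .
      have X: "I (Inl (col a)) \<in> X" "I (Inl (col b)) \<in> X" using aB bB by (auto simp: X_def)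
      have "I (Inl (col b)) \<in> Z"
      proof (cases a; cases b)
        fix i j assume "a = Inl i" "b = Inl j"
        then show ?thesis using J(1)[of i j] ab(1) aB bB by simp
      next
        fix i j assume "a = Inr i" "b = Inr j"
        then show ?thesis using J(2)[of i j] ab(1) aB bB by simp
      next
        fix i j assume "a = Inl i" "b = Inr j"
        then show ?thesis using J(3)[of i j] ab(1) aB bB X Z(2)[of "I (Inl j)"] by simp
      next
        fix i j assume "a = Inr i" "b = Inl j"
        then show ?thesis using J(3)[of j i] joined_sym[OF ab(1)] aB bB X Z(2)[of "I (Inl i)"] by simp
      qed
      then show ?thesis using bB by (simp add: D_def)
    qed
    then have "closed_cols q D" unfolding closed_cols_def by blast
    moreover have "B \<inter> D \<noteq> {}" using Z(1) by (auto simp: X_def D_def)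
    ultimately have "B \<subseteq> D" using single unfolding single_cycle_def by blast
    then show ?thesis by (auto simp: X_def D_def)
  qed
  have finX: "finite X" using finite_nonears by (simp add: X_def)
  have neX: "X \<noteq> {}" using ne by (simp add: X_def)
  note pow = funpow_eq_iff_mod_least_power[OF permutation_sigma]
  have label: "labelling step q B s h"
    if s: "s \<ge> 1" "X = (\<lambda>n. (\<sigma> ^^ n) x0) ` {0..<s}"
      and eq: "\<And>u v. u < s \<Longrightarrow> v < s \<Longrightarrow> (\<sigma> ^^ u) x0 = (\<sigma> ^^ v) x0 \<longleftrightarrow> u = v"
        "\<And>u v. u < s \<Longrightarrow> v < s \<Longrightarrow> (\<sigma> ^^ u) x0 = (\<sigma> ^^ Suc v) x0 \<longleftrightarrow> u = step v"
      and h: "h = (\<lambda>i. SOME n. n < s \<and> (\<sigma> ^^ n) x0 = I (Inl i))" for step s x0 h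
  proof -
    have hi: "h i < s \<and> (\<sigma> ^^ h i) x0 = I (Inl i)" if "i \<in> B" for i
    proof -
      have "I (Inl i) \<in> X" using that by (simp add: X_def)
      then have "\<exists>n. n < s \<and> (\<sigma> ^^ n) x0 = I (Inl i)" unfolding s(2) by auto
      then show ?thesis unfolding h by (rule someI_ex)
    qed
    have "h ` B = {0..<s}"
    proof (intro equalityI subsetI)
      fix n assume n: "n \<in> {0..<s}"
      then have "(\<sigma> ^^ n) x0 \<in> X" unfolding s(2) by blast
      then obtain i where i: "i \<in> B" "I (Inl i) = (\<sigma> ^^ n) x0" by (auto simp: X_def)
      then have "h i = n" using hi[OF i(1)] eq(1)[of "h i" n] n by simp
      then show "n \<in> h ` B" using i by blast
    qed (use hi in auto)
    moreover have "(h i = h j) = (I (Inl i) = I (Inl j))" "(h i = step (h j)) = (I (Inl i) = \<sigma> (I (Inl j)))"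
      if "i \<in> B" "j \<in> B" for i j
      using hi[OF that(1)] hi[OF that(2)] eq(1)[of "h i" "h j"] eq(2)[of "h i" "h j"] by auto
    ultimately show ?thesis using s(1) J unfolding labelling_def by simp
  qed
  show ?thesis
  proof (cases "\<sigma> ` X = X")
    case True
    obtain x0 where x0: "x0 \<in> X" using neX by blast
    define t where "t = least_power \<sigma> x0"
    have t: "(\<sigma> ^^ t) x0 = x0" "t > 0"
      using least_power_of_permutation[OF permutation_sigma] by (auto simp: t_def)
    let ?Z = "range (\<lambda>n. (\<sigma> ^^ n) x0)"
    have "X \<subseteq> ?Z"
    proof (rule all[of x0])
      show "x0 \<in> X \<inter> ?Z" using x0 by (auto intro: range_eqI[of _ _ 0])
      fix x
      show "x \<in> ?Z \<longleftrightarrow> \<sigma> x \<in> ?Z"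
      proof
        assume "x \<in> ?Z"
        then obtain n where "x = (\<sigma> ^^ n) x0" by blast
        then show "\<sigma> x \<in> ?Z" by (intro range_eqI[of _ _ "Suc n"]) simp
      next
        assume "\<sigma> x \<in> ?Z"
        then obtain n where n: "\<sigma> x = (\<sigma> ^^ n) x0" by blast
        \<comment> \<open>The preimage is reached by \<open>t - 1\<close> further steps, one full
          turn minus one; going back from \<open>n\<close> directly would fail for
          \<open>n = 0\<close>.\<close>
        have "\<sigma> x = (\<sigma> ^^ Suc (n + (t - 1))) x0"
        proof -
          have "(\<sigma> ^^ Suc (n + (t - 1))) x0 = (\<sigma> ^^ (n + t)) x0" using t(2) by (simp del: funpow.simps)
          then show ?thesis using n t(1) by (simp add: funpow_add)
        qed
        then have "x = (\<sigma> ^^ (n + (t - 1))) x0" by (simp add: sigma_inj)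
        then show "x \<in> ?Z" by blast
      qed
    qed
    moreover have "(\<sigma> ^^ n) x0 \<in> X" for n using x0 True by (induction n) auto
    ultimately have "X = ?Z" by blast
    also have "?Z = (\<lambda>n. (\<sigma> ^^ n) x0) ` {0..<t}"
    proof (intro equalityI subsetI)
      fix y assume "y \<in> ?Z"
      then obtain n where "y = (\<sigma> ^^ n) x0" by blast
      then have "y = (\<sigma> ^^ (n mod t)) x0" using funpow_mod_eq[OF t(1)] by simp
      then show "y \<in> (\<lambda>n. (\<sigma> ^^ n) x0) ` {0..<t}" using t(2) by auto
    qed auto
    finally have "X = (\<lambda>n. (\<sigma> ^^ n) x0) ` {0..<t}" .
    then have "labelling (\<lambda>x. Suc x mod t) q B t (\<lambda>i. SOME n. n < t \<and> (\<sigma> ^^ n) x0 = I (Inl i))"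
      by (intro label[of t x0]) (use t(2) pow[of _ x0] in \<open>simp_all add: t_def del: funpow.simps\<close>)
    then show ?thesis using that unfolding necklace_like_def by blast
  next
    case False
    \<comment> \<open>By finiteness a set that is not stable contains a point without preimage in
      the set. This point is the start of the segment.\<close>
    have "\<not> X \<subseteq> \<sigma> ` X"
      using False finX card_seteq[of "\<sigma> ` X" X] card_image_le[OF finX, of \<sigma>] by auto
    then obtain x0 where x0: "x0 \<in> X" "x0 \<notin> \<sigma> ` X" by blast
    define t where "t = least_power \<sigma> x0"
    have t: "(\<sigma> ^^ t) x0 = x0" "t > 0"
      using least_power_of_permutation[OF permutation_sigma] by (auto simp: t_def)
    define s where "s = (LEAST n. (\<sigma> ^^ n) x0 \<notin> X)"
    \<comment> \<open>The predecessor of \<open>x0\<close> on its orbit. As it is outside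
      \<open>X\<close>, the first exit from \<open>X\<close> comes before the orbit closes, which
      gives \<open>s < t\<close>.\<close>
    have tX: "(\<sigma> ^^ (t - 1)) x0 \<notin> X"
    proof
      assume "(\<sigma> ^^ (t - 1)) x0 \<in> X"
      moreover have "\<sigma> ((\<sigma> ^^ (t - 1)) x0) = x0" using t by (cases t) auto
      ultimately show False using x0 by force
    qed
    have sX: "(\<sigma> ^^ s) x0 \<notin> X" unfolding s_def by (rule LeastI[of _ "t - 1"]) (rule tX)
    have "s \<le> t - 1" unfolding s_def by (rule Least_le) (rule tX)
    then have st: "s < t" using t(2) by simp
    have less: "(\<sigma> ^^ n) x0 \<in> X" if "n < s" for n using not_less_Least[of n "\<lambda>n. (\<sigma> ^^ n) x0 \<notin> X"] that
      unfolding s_def by blast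
    have s1: "s \<ge> 1" using sX x0(1) by (cases s) auto
    let ?Z = "(\<lambda>n. (\<sigma> ^^ n) x0) ` {0..<s}"
    have "X \<subseteq> ?Z"
    proof (rule all[of x0])
      show "x0 \<in> X \<inter> ?Z" using x0(1) s1 by (auto intro!: image_eqI[of _ _ 0])
      fix x assume x: "x \<in> X" "\<sigma> x \<in> X"
      show "x \<in> ?Z \<longleftrightarrow> \<sigma> x \<in> ?Z"
      proof
        assume "x \<in> ?Z"
        then obtain n where n: "x = (\<sigma> ^^ n) x0" "n < s" by auto
        then have "(\<sigma> ^^ Suc n) x0 \<in> X" using x(2) by simp
        then have "Suc n \<noteq> s" using sX by metis
        then show "\<sigma> x \<in> ?Z" using n by (intro image_eqI[of _ _ "Suc n"]) auto
      next
        assume "\<sigma> x \<in> ?Z"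
        then obtain n where n: "\<sigma> x = (\<sigma> ^^ n) x0" "n < s" by auto
        then obtain m where "n = Suc m" using x x0(2) by (cases n) auto
        then show "x \<in> ?Z" using n by (intro image_eqI[of _ _ m]) (auto simp: sigma_inj)
      qed
    qed
    then have "X = ?Z" using less by auto
    then have "labelling Suc q B s (\<lambda>i. SOME n. n < s \<and> (\<sigma> ^^ n) x0 = I (Inl i))"
      by (intro label[of s x0]) (use s1 st pow[of _ x0] in \<open>simp_all add: t_def del: funpow.simps\<close>)
    then show ?thesis using that unfolding chain_like_def by blast
  qed
qed

end

section \<open>Asymptotics of the normalized counts\<close>

lemma tendsto_truncated_diff:
  fixes a :: "nat \<Rightarrow> nat"
  assumes "(\<lambda>N. real (a N) / real N) \<longlonglongrightarrow> 1"
  shows "(\<lambda>N. real (a N - i) / real N) \<longlonglongrightarrow> 1"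
proof (rule tendsto_sandwich)
  show "\<forall>\<^sub>F N in sequentially. real (a N) / real N - real i / real N \<le> real (a N - i) / real N"
    by (intro always_eventually allI) (simp add: divide_right_mono flip: diff_divide_distrib)
  show "\<forall>\<^sub>F N in sequentially. real (a N - i) / real N \<le> real (a N) / real N"
    by (intro always_eventually allI) (simp add: divide_right_mono)
  have "(\<lambda>N. real (a N) / real N - real i / real N) \<longlonglongrightarrow> 1 - 0"
    by (intro tendsto_diff assms lim_const_over_n)
  then show "(\<lambda>N. real (a N) / real N - real i / real N) \<longlonglongrightarrow> 1" by simp
qed (rule assms)

lemma tendsto_falling_product:
  fixes a :: "nat \<Rightarrow> nat"
  assumes "(\<lambda>N. real (a N) / real N) \<longlonglongrightarrow> 1"
  shows "(\<lambda>N. real (\<Prod>i<v. a N - i) / real N ^ v) \<longlonglongrightarrow> 1"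
proof -
  have "(\<lambda>N. \<Prod>i<v. real (a N - i) / real N) \<longlonglongrightarrow> (\<Prod>i<v. 1)"
    by (intro tendsto_prod tendsto_truncated_diff assms)
  then show ?thesis by (simp add: prod_dividef)
qed

lemma tendsto_self_over_n: "(\<lambda>N. real N / real N) \<longlonglongrightarrow> 1"
proof -
  have "\<forall>\<^sub>F N in sequentially. real N / real N = 1"
    using eventually_gt_at_top[of 0] by eventually_elim simp
  then show ?thesis by (rule tendsto_eventually)
qed

lemma tendsto_power_over_falling_product:
  "(\<lambda>N. real N ^ v / real (\<Prod>i<v. N - i)) \<longlonglongrightarrow> 1"
proof -
  have "(\<lambda>N. inverse (real (\<Prod>i<v. N - i) / real N ^ v)) \<longlonglongrightarrow> inverse 1"
    by (intro tendsto_inverse tendsto_falling_product tendsto_self_over_n) simp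
  then show ?thesis by simp
qed

text \<open>To first order each of the \<open>v\<close> factors loses a proportion
  \<open>n N / N\<close>. In the induction the new quotient is \<open>1 - n N / (N - v)\<close>: the
  scaled defect is multiplied by it, which tends to 1, and \<open>N / (N - v)\<close>, which also
  tends to 1, is subtracted.\<close>

lemma falling_product_defect:
  fixes n :: "nat \<Rightarrow> nat"
  assumes n: "\<forall>\<^sub>F N in sequentially. 0 < n N \<and> n N \<le> N" and small: "(\<lambda>N. real (n N) / real N) \<longlonglongrightarrow> 0"
  shows "(\<lambda>N. real N / real (n N) * (real (\<Prod>i<v. (N - n N) - i) / real (\<Prod>i<v. N - i) - 1)) \<longlonglongrightarrow> - real v"
proof (induction v)
  case 0
  then show ?case by simp
next
  case (Suc v)
  let ?a = "\<lambda>N. N - n N"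
  let ?R = "\<lambda>v N. real (\<Prod>i<v. ?a N - i) / real (\<Prod>i<v. N - i)"
  have a: "(\<lambda>N. real (?a N) / real N) \<longlonglongrightarrow> 1"
  proof (rule Lim_transform_eventually)
    show "(\<lambda>N. 1 - real (n N) / real N) \<longlonglongrightarrow> 1" using tendsto_diff[OF tendsto_const small, of 1] by simp
    show "\<forall>\<^sub>F N in sequentially. 1 - real (n N) / real N = real (?a N) / real N"
      using n eventually_gt_at_top[of 0] by eventually_elim (simp add: of_nat_diff field_simps)
  qed
  have q: "(\<lambda>N. (real (?a N - v) / real N) / (real (N - v) / real N)) \<longlonglongrightarrow> 1 / 1"
    by (intro tendsto_divide tendsto_truncated_diff a tendsto_self_over_n) simp
  have r: "(\<lambda>N. 1 / (real (N - v) / real N)) \<longlonglongrightarrow> 1 / 1"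
    by (intro tendsto_divide tendsto_truncated_diff tendsto_self_over_n tendsto_const) simp
  have lim: "(\<lambda>N. real N / real (n N) * (?R v N - 1) * ((real (?a N - v) / real N) / (real (N - v) / real N))
      - 1 / (real (N - v) / real N)) \<longlonglongrightarrow> - real v * (1 / 1) - 1 / 1"
    by (intro tendsto_diff tendsto_mult q r Suc.IH)
  have "\<forall>\<^sub>F N in sequentially. real (?a N) / real N > 1 / 2"
    using a by (rule order_tendstoD) simp
  moreover have "\<forall>\<^sub>F N in sequentially. N > 2 * v" by (rule eventually_gt_at_top)
  ultimately have "\<forall>\<^sub>F N in sequentially.
      real N / real (n N) * (?R v N - 1) * ((real (?a N - v) / real N) / (real (N - v) / real N))
        - 1 / (real (N - v) / real N) = real N / real (n N) * (?R (Suc v) N - 1)"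
    using n
  proof eventually_elim
    case (elim N)
    have N: "real N > 0" "v < N" using elim by auto
    then have "real (?a N) > real v" using elim by (simp add: field_simps)
    \<comment> \<open>From \<open>N - n N > N / 2\<close> and \<open>N > 2 * v\<close>; from here on
      the truncated differences are genuine ones.\<close>
    then have av: "v < ?a N" by linarith
    have R: "?R (Suc v) N = ?R v N * (real (?a N - v) / real (N - v))" by simp
    have "real (?a N - v) = real N - real (n N) - real v" "real (N - v) = real N - real v"
      using av elim N by (simp_all add: of_nat_diff)
    then have d: "real (?a N - v) / real (N - v) = 1 - real (n N) / (real N - real v)"
      using N by (simp add: field_simps)
    have "real N / real (n N) * (?R (Suc v) N - 1) =
        real N / real (n N) * (?R v N - 1) * (real (?a N - v) / real (N - v))
        + real N / real (n N) * (real (?a N - v) / real (N - v) - 1)"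
      unfolding R by (simp add: algebra_simps)
    also have "real N / real (n N) * (real (?a N - v) / real (N - v) - 1) = - (1 / (real (N - v) / real N))"
      unfolding d using elim N by (simp add: of_nat_diff)
    finally show ?case using N by simp
  qed
  with lim have "(\<lambda>N. real N / real (n N) * (?R (Suc v) N - 1)) \<longlonglongrightarrow> - real v * (1 / 1) - 1 / 1"
    by (rule Lim_transform_eventually)
  moreover have "- real v * (1 / 1) - 1 / 1 = - real (Suc v)" by simp
  ultimately show ?case by (simp only:)
qed

section \<open>Periods and support of a conjugacy class\<close>

lemma least_power_eq_1_iff: "permutation \<sigma> \<Longrightarrow> least_power \<sigma> x = 1 \<longleftrightarrow> \<sigma> x = x"
  using least_power_of_permutation(1)[of \<sigma> x] least_power_gt_one[of \<sigma> x]
    least_power_le[of 1 \<sigma> x] least_power_of_permutation(2)[of \<sigma> x] by fastforce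

text \<open>The same choice as in \<open>class_count\<close>, so that period counts and colourings
  refer to the same permutation.\<close>

definition representative :: "(nat \<Rightarrow> nat) set \<Rightarrow> nat \<Rightarrow> nat"
  where "representative C = (SOME \<sigma>. \<sigma> \<in> C)"

text \<open>The derivative of the expected entry at an index pair with kernel \<open>q\<close>,
  written with one permutation and all colourings in place of one colouring and the whole class. The
  subtracted term is the entry of the identity.\<close>

definition scaled_count :: "nat \<Rightarrow> (nat \<Rightarrow> nat) set \<Rightarrow> nat \<Rightarrow> point set set \<Rightarrow> real"
  where "scaled_count N C k q = real N / real (class_support N C) *
    (real (card {I \<in> colourings k q {1..N}. fits k (representative C) I}) / real (\<Prod>i<nc q. N - i)
      - (if nonears k q = {} then 1 else 0))"

lemma conjugacy_class_nonempty: "conjugacy_class N C \<Longrightarrow> C \<noteq> {}"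
  unfolding conjugacy_class_def Sym_def using permutes_id by blast

lemma conjugacy_class_subset: "conjugacy_class N C \<Longrightarrow> C \<subseteq> Sym N"
  unfolding conjugacy_class_def Sym_def
  by (auto intro!: permutes_compose permutes_inv)

lemma representative_in: "conjugacy_class N C \<Longrightarrow> representative C \<in> C"
  using conjugacy_class_nonempty unfolding representative_def by (metis ex_in_conv someI)

lemma representative_permutes: "conjugacy_class N C \<Longrightarrow> representative C permutes {1..N}"
  using representative_in conjugacy_class_subset unfolding Sym_def by blast

lemma class_count_le: "class_count N C i \<le> N"
proof -
  have "class_count N C i \<le> card {1..N}" unfolding class_count_def by (rule card_mono) auto
  then show ?thesis by simp
qed

lemma
  assumes C: "conjugacy_class N C"
  shows card_fixed: "card {x \<in> {1..N}. representative C x = x} = N - class_support N C"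
    and card_moved: "card {x \<in> {1..N}. representative C x \<noteq> x} = class_support N C"
proof -
  let ?\<sigma> = "representative C"
  have "permutation ?\<sigma>" using representative_permutes[OF C] by (auto simp: permutation_permutes)
  then have c1: "class_count N C 1 = card {x \<in> {1..N}. ?\<sigma> x = x}"
    unfolding class_count_def representative_def[symmetric] by (simp only: least_power_eq_1_iff)
  then show "card {x \<in> {1..N}. ?\<sigma> x = x} = N - class_support N C"
    using class_count_le[of N C 1] by (simp add: class_support_def)
  have "{x \<in> {1..N}. ?\<sigma> x \<noteq> x} = {1..N} - {x \<in> {1..N}. ?\<sigma> x = x}" by blast
  then have "card {x \<in> {1..N}. ?\<sigma> x \<noteq> x} = card ({1..N} - {x \<in> {1..N}. ?\<sigma> x = x})" by (rule arg_cong)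
  also have "\<dots> = card {1..N} - card {x \<in> {1..N}. ?\<sigma> x = x}"
    by (rule card_Diff_subset) auto
  finally show "card {x \<in> {1..N}. ?\<sigma> x \<noteq> x} = class_support N C"
    unfolding class_support_def c1 by simp
qed

text \<open>If nothing were moved, the class would contain the identity, whose conjugates are all
  equal to it.\<close>

lemma class_support_pos:
  assumes "nontrivial_class N C"
  shows "class_support N C > 0"
proof (rule ccontr)
  assume zero: "\<not> class_support N C > 0"
  have C: "conjugacy_class N C" "C \<noteq> {id}" using assms by (auto simp: nontrivial_class_def)
  let ?\<sigma> = "representative C"
  have "{x \<in> {1..N}. ?\<sigma> x \<noteq> x} = {}" using card_moved[OF C(1)] zero by simp
  then have "?\<sigma> x = x" for x
    using permutes_not_in[OF representative_permutes[OF C(1)], of x] by blast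
  then have "?\<sigma> = id" by (simp add: fun_eq_iff)
  then have id: "id \<in> C" using representative_in[OF C(1)] by simp
  obtain \<rho> where \<rho>: "\<rho> \<in> Sym N" "C = (\<lambda>\<tau>. \<tau> \<circ> \<rho> \<circ> inv \<tau>) ` Sym N"
    using C(1) by (auto simp: conjugacy_class_def)
  then obtain \<tau> where \<tau>: "\<tau> permutes {1..N}" "id = \<tau> \<circ> \<rho> \<circ> inv \<tau>" using id by (auto simp: Sym_def)
  have "\<rho> = inv \<tau> \<circ> (\<tau> \<circ> \<rho> \<circ> inv \<tau>) \<circ> \<tau>"
    using permutes_inverses[OF \<tau>(1)] by (simp add: fun_eq_iff)
  then have "\<rho> = id" using \<tau> permutes_inverses[OF \<tau>(1)] by (simp add: fun_eq_iff)
  then have "C = (\<lambda>\<tau>. id) ` Sym N"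
    unfolding \<rho>(2) using permutes_inverses by (intro image_cong) (auto simp: Sym_def fun_eq_iff)
  then show False using C(2) id by auto
qed

lemma class_support_le: "class_support N C \<le> N"
  by (simp add: class_support_def)

lemma card_long_orbits:
  assumes C: "conjugacy_class N C" and s: "s \<ge> 1"
  shows "real (card {x \<in> {1..N}. least_power (representative C) x > s}) =
    real (class_support N C) - (\<Sum>i=2..s. real (class_count N C i))"
  using s
proof (induction s rule: dec_induct)
  case base
  let ?\<sigma> = "representative C"
  have p: "permutation ?\<sigma>" using representative_permutes[OF C] by (auto simp: permutation_permutes)
  have "least_power ?\<sigma> x > 1 \<longleftrightarrow> ?\<sigma> x \<noteq> x" for x
    using least_power_eq_1_iff[OF p, of x] least_power_of_permutation(2)[OF p, of x] by linarith
  then show ?case using card_moved[OF C] by simp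
next
  case (step s)
  let ?\<sigma> = "representative C"
  have "{x \<in> {1..N}. least_power ?\<sigma> x > s} =
      {x \<in> {1..N}. least_power ?\<sigma> x > Suc s} \<union> {x \<in> {1..N}. least_power ?\<sigma> x = Suc s}" by auto
  then have "card {x \<in> {1..N}. least_power ?\<sigma> x > s} =
      card {x \<in> {1..N}. least_power ?\<sigma> x > Suc s} + card {x \<in> {1..N}. least_power ?\<sigma> x = Suc s}"
    by (simp only:) (rule card_Un_disjoint, auto)
  moreover have "card {x \<in> {1..N}. least_power ?\<sigma> x = Suc s} = class_count N C (Suc s)"
    by (simp add: class_count_def representative_def)
  moreover have "{2..Suc s} = insert (Suc s) {2..s}" using step by auto
  ultimately show ?case using step.IH by simp
qed

text \<open>A necklace with one bead joins \<open>i\<close> with \<open>i'\<close>, which would make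
  the column an ear.\<close>

lemma necklace_like_ge_2:
  assumes "necklace_like q (nonears k q) s"
  shows "s \<ge> 2"
proof (rule ccontr)
  assume "\<not> s \<ge> 2"
  obtain h where h: "labelling (\<lambda>x. Suc x mod s) q (nonears k q) s h"
    using assms by (auto simp: necklace_like_def)
  then have "s = 1" using \<open>\<not> s \<ge> 2\<close> by (simp add: labelling_def)
  have "0 \<in> h ` nonears k q" using h by (auto simp: labelling_def)
  then obtain i where i: "i \<in> nonears k q" "h i = 0" by auto
  then have "joined q (Inl i) (Inr i)" using h \<open>s = 1\<close> by (simp add: labelling_def)
  then show False using i by (simp add: nonears_def)
qed

context
  fixes C :: "nat \<Rightarrow> (nat \<Rightarrow> nat) set" and lam :: "nat \<Rightarrow> real"
  assumes nontriv: "\<And>N. N \<ge> 2 \<Longrightarrow> nontrivial_class N (C N)"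
    and conv: "classes_converge C lam 0"
begin

private abbreviation (input) "n \<equiv> \<lambda>N. class_support N (C N)"

lemma class_conj: "N \<ge> 2 \<Longrightarrow> conjugacy_class N (C N)"
  using nontriv by (simp add: nontrivial_class_def)

lemma eventually_support: "\<forall>\<^sub>F N in sequentially. 0 < class_support N (C N) \<and> class_support N (C N) \<le> N"
  using eventually_ge_at_top[of 2] by eventually_elim (use nontriv class_support_pos class_support_le in auto)

lemma support_over_n: "(\<lambda>N. real (class_support N (C N)) / real N) \<longlonglongrightarrow> 0"
proof (rule Lim_transform_eventually)
  show "(\<lambda>N. 1 - real (class_count N (C N) 1) / real N) \<longlonglongrightarrow> 0"
    using tendsto_diff[OF tendsto_const, of _ _ sequentially 1] conv by (fastforce simp: classes_converge_def)
  show "\<forall>\<^sub>F N in sequentially. 1 - real (class_count N (C N) 1) / real N = real (class_support N (C N)) / real N"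
    using eventually_gt_at_top[of 0]
    by eventually_elim (simp add: class_support_def of_nat_diff class_count_le field_simps)
qed

lemma fixed_over_n: "(\<lambda>N. real (N - class_support N (C N)) / real N) \<longlonglongrightarrow> 1"
proof (rule Lim_transform_eventually)
  show "(\<lambda>N. 1 - real (n N) / real N) \<longlonglongrightarrow> 1"
    using tendsto_diff[OF tendsto_const support_over_n, of 1] by simp
  show "\<forall>\<^sub>F N in sequentially. 1 - real (n N) / real N = real (N - n N) / real N"
    using eventually_support eventually_gt_at_top[of 0]
    by eventually_elim (simp add: of_nat_diff field_simps)
qed

lemma class_count_over_support:
  "i \<ge> 2 \<Longrightarrow> (\<lambda>N. real (class_count N (C N) i) / real (class_support N (C N))) \<longlonglongrightarrow> lam i"
  using conv by (simp add: classes_converge_def)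

lemma card_necklace_starts:
  assumes "s \<ge> 2"
  shows "(\<lambda>N. real (card (orbit_starts N (representative (C N)) (\<lambda>x. Suc x mod s) s)) / real (n N)) \<longlonglongrightarrow> lam s"
proof (rule Lim_transform_eventually[OF class_count_over_support[OF assms]])
  show "\<forall>\<^sub>F N in sequentially. real (class_count N (C N) s) / real (n N) =
      real (card (orbit_starts N (representative (C N)) (\<lambda>x. Suc x mod s) s)) / real (n N)"
    using eventually_ge_at_top[of 2]
  proof eventually_elim
    case (elim N)
    have "permutation (representative (C N))"
      using representative_permutes[OF class_conj[OF elim]] by (auto simp: permutation_permutes)
    then show ?case
      using orbit_starts_necklace[OF _ assms] by (simp add: class_count_def representative_def)
  qed
qed

lemma card_chain_starts:
  assumes "s \<ge> 1"
  shows "(\<lambda>N. real (card (orbit_starts N (representative (C N)) Suc s)) / real (n N))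
    \<longlonglongrightarrow> 1 - (\<Sum>i=2..s. lam i)"
proof (rule Lim_transform_eventually)
  show "(\<lambda>N. 1 - (\<Sum>i=2..s. real (class_count N (C N) i) / real (n N))) \<longlonglongrightarrow> 1 - (\<Sum>i=2..s. lam i)"
    by (intro tendsto_diff tendsto_const tendsto_sum class_count_over_support) auto
  show "\<forall>\<^sub>F N in sequentially. 1 - (\<Sum>i=2..s. real (class_count N (C N) i) / real (n N)) =
      real (card (orbit_starts N (representative (C N)) Suc s)) / real (n N)"
    using eventually_ge_at_top[of 2] eventually_support
  proof eventually_elim
    case (elim N)
    have "permutation (representative (C N))"
      using representative_permutes[OF class_conj[OF elim(1)]] by (auto simp: permutation_permutes)
    then show ?case
      using orbit_starts_chain[OF _ assms] card_long_orbits[OF class_conj[OF elim(1)] assms] elim(2)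
      by (simp add: diff_divide_distrib sum_divide_distrib)
  qed
qed

text \<open>For a non-empty head the power of \<open>N\<close> and the falling product leave, up to
  a factor tending to 1, the number of compatible colourings times \<open>N / n\<close> and divided
  by \<open>N^c\<close>, with \<open>c\<close> the number of cycles. The counts vanish when an ear
  is attached to a one-cycle head or when such a head is neither a necklace nor a chain. For several
  cycles in the head \<open>card_fits_two_cycles\<close> gives a limit 0, and otherwise the count is
  a product by \<open>card_fits_labelled\<close>.\<close>

lemma scaled_count_limit:
  assumes q: "q \<in> partitions k"
  shows "(\<lambda>N. real N powi part_rank k q * scaled_count N (C N) k q) \<longlonglongrightarrow> moment_limit lam k q"
proof (cases "nonears k q = {}")
  case True
  show ?thesis
  proof (rule Lim_transform_eventually)
    show "(\<lambda>N. real N / real (n N) * (real (\<Prod>i<nc q. (N - n N) - i) / real (\<Prod>i<nc q. N - i) - 1))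
        \<longlonglongrightarrow> moment_limit lam k q"
      using falling_product_defect[OF eventually_support support_over_n, of "nc q"] True
      by (simp add: moment_limit_def)
    show "\<forall>\<^sub>F N in sequentially. real N / real (n N) * (real (\<Prod>i<nc q. (N - n N) - i) / real (\<Prod>i<nc q. N - i) - 1)
        = real N powi part_rank k q * scaled_count N (C N) k q"
      using eventually_ge_at_top[of 2]
    proof eventually_elim
      case (elim N)
      note c = class_conj[OF elim]
      show ?case
        using card_fits_no_nonears[OF representative_permutes[OF c] q True] card_fixed[OF c]
          rank_no_nonears[OF q True] True by (simp add: scaled_count_def)
    qed
  qed
next
  case ne: False
  let ?cnt = "\<lambda>N. card {I \<in> colourings k q {1..N}. fits k (representative (C N)) I}"
  let ?v = "nc q" and ?c = "nc (cycles_of k q)"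
  have scaled: "\<forall>\<^sub>F N in sequentially. real N powi part_rank k q * scaled_count N (C N) k q =
      (real N ^ ?v / real (\<Prod>i<?v. N - i)) * (real N / real (n N) * (real (?cnt N) / real N ^ ?c))"
    using eventually_gt_at_top[of 0]
    by eventually_elim (use ne in \<open>simp add: scaled_count_def part_rank_def power_int_diff\<close>)
  have reduce: "(\<lambda>N. real N powi part_rank k q * scaled_count N (C N) k q) \<longlonglongrightarrow> x"
    if "(\<lambda>N. real N / real (n N) * (real (?cnt N) / real N ^ ?c)) \<longlonglongrightarrow> x" for x
    using tendsto_mult[OF tendsto_power_over_falling_product[of ?v] that] scaled
    by (simp add: filterlim_cong)
  have zero: "(\<lambda>N. real N powi part_rank k q * scaled_count N (C N) k q) \<longlonglongrightarrow> 0"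
    if z: "\<And>N. N \<ge> 2 \<Longrightarrow> ?cnt N = 0"
  proof (rule reduce, rule tendsto_eventually)
    show "\<forall>\<^sub>F N in sequentially. real N / real (n N) * (real (?cnt N) / real N ^ ?c) = 0"
      using eventually_ge_at_top[of 2] by eventually_elim (use z in simp)
  qed
  have fits_single: "closed_cols q (nonears k q) \<and> (single_cycle q (nonears k q) \<longrightarrow>
      (\<exists>s. necklace_like q (nonears k q) s \<or> chain_like q (nonears k q) s))"
    if N: "N \<ge> 2" and cnt: "?cnt N \<noteq> 0" for N
  proof -
    note perm = representative_permutes[OF class_conj[OF N]]
    obtain I where I: "I \<in> colourings k q {1..N}" "fits k (representative (C N)) I"
      using cnt by (metis (mono_tags, lifting) Collect_empty_eq card.empty)
    show ?thesis using fits_closed_cols[OF perm q I] fits_single_cycle[OF perm q I _ ne] by blast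
  qed
  consider (many) "\<not> single_cycle q (nonears k q)"
    | (touch) "single_cycle q (nonears k q)" "\<not> closed_cols q (nonears k q)"
    | (other) "single_cycle q (nonears k q)" "closed_cols q (nonears k q)"
        "\<nexists>s. necklace_like q (nonears k q) s \<or> chain_like q (nonears k q) s"
    | (lab) s where "single_cycle q (nonears k q)" "closed_cols q (nonears k q)"
        "necklace_like q (nonears k q) s \<or> chain_like q (nonears k q) s"
    by blast
  then show ?thesis
  proof cases
    case many
    have "(\<lambda>N. real N / real (n N) * (real (?cnt N) / real N ^ ?c)) \<longlonglongrightarrow> 0"
    proof (rule tendsto_sandwich[OF _ _ tendsto_const support_over_n])
      show "\<forall>\<^sub>F N in sequentially. 0 \<le> real N / real (n N) * (real (?cnt N) / real N ^ ?c)"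
        by (intro always_eventually allI) simp
      show "\<forall>\<^sub>F N in sequentially. real N / real (n N) * (real (?cnt N) / real N ^ ?c) \<le> real (n N) / real N"
        using eventually_ge_at_top[of 2] eventually_support
      proof eventually_elim
        case (elim N)
        note c = class_conj[OF elim(1)]
        note bnd = card_fits_two_cycles[OF representative_permutes[OF c] q many]
        obtain d where d: "?c = d + 2" using bnd(2) by (metis add.commute le_Suc_ex)
        have "real (?cnt N) \<le> real (n N ^ 2 * N ^ d)"
          using bnd(1) card_moved[OF c] unfolding d by (simp del: of_nat_mult of_nat_power)
        then have "real N / real (n N) * (real (?cnt N) / real N ^ ?c)
            \<le> real N / real (n N) * (real (n N ^ 2 * N ^ d) / real N ^ ?c)"
          by (intro mult_left_mono divide_right_mono) auto
        also have "\<dots> = real (n N) / real N"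
          using elim unfolding d by (simp add: field_simps power2_eq_square)
        finally show ?case .
      qed
    qed
    then show ?thesis using reduce many ne by (simp add: moment_limit_def)
  next
    case touch
    then have "?cnt N = 0" if "N \<ge> 2" for N using fits_single[OF that] by blast
    then show ?thesis using zero touch ne by (simp add: moment_limit_def)
  next
    case other
    then have "weight lam q (nonears k q) = 0" using ne by (auto simp: weight_def)
    moreover have "?cnt N = 0" if "N \<ge> 2" for N using fits_single[OF that] other by blast
    ultimately show ?thesis using zero other ne by (simp add: moment_limit_def)
  next
    case lab
    let ?q2 = "q - touching q (nonears k q)"
    obtain step h where h: "labelling step q (nonears k q) s h" and step: "\<And>m. Suc m < s \<Longrightarrow> step m = Suc m"
      and starts: "(\<lambda>N. real (card (orbit_starts N (representative (C N)) step s)) / real (n N))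
        \<longlonglongrightarrow> weight lam q (nonears k q)"
    proof -
      consider "necklace_like q (nonears k q) s" | "chain_like q (nonears k q) s" using lab(3) by blast
      then show ?thesis
      proof cases
        case 1
        then obtain h where "labelling (\<lambda>x. Suc x mod s) q (nonears k q) s h" by (auto simp: necklace_like_def)
        then show ?thesis
          using that[of "\<lambda>x. Suc x mod s" h] card_necklace_starts[OF necklace_like_ge_2[OF 1]] weight_necklace[OF 1]
          by simp
      next
        case 2
        then obtain h where h: "labelling Suc q (nonears k q) s h" by (auto simp: chain_like_def)
        then have "s \<ge> 1" by (simp add: labelling_def)
        then show ?thesis using that[of Suc h] h card_chain_starts weight_chain[OF 2] by simp
      qed
    qed
    have finq: "finite q" by (rule finite_partition[OF partitionsD[OF q]])
    \<comment> \<open>One cycle for the head; every block outside is a cycle on its own. So the free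
      blocks use up all but one factor of \<open>N^c\<close>, and the last one cancels against
      \<open>N / n\<close>.\<close>
    have c: "?c = Suc (card ?q2)"
      unfolding cycles_of_single(1)[OF q ne nonears_subset lab(1) subset_refl]
      using cycles_of_single(2)[OF q ne nonears_subset lab(1) subset_refl] finq by simp
    have "(\<lambda>N. real (card (orbit_starts N (representative (C N)) step s)) / real (n N) *
        (real (\<Prod>i<card ?q2. (N - n N) - i) / real N ^ card ?q2)) \<longlonglongrightarrow> weight lam q (nonears k q) * 1"
      by (intro tendsto_mult starts tendsto_falling_product fixed_over_n)
    then have "(\<lambda>N. real N / real (n N) * (real (?cnt N) / real N ^ ?c)) \<longlonglongrightarrow> weight lam q (nonears k q) * 1"
    proof (rule Lim_transform_eventually)
      show "\<forall>\<^sub>F N in sequentially. real (card (orbit_starts N (representative (C N)) step s)) / real (n N) *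
        (real (\<Prod>i<card ?q2. (N - n N) - i) / real N ^ card ?q2) = real N / real (n N) * (real (?cnt N) / real N ^ ?c)"
        using eventually_ge_at_top[of 2]
      proof eventually_elim
        case (elim N)
        note cl = class_conj[OF elim]
        have cnt: "?cnt N = card (orbit_starts N (representative (C N)) step s) *
            (\<Prod>i<card ?q2. (N - n N) - i)"
          unfolding card_fixed[OF cl, symmetric]
          by (rule card_fits_labelled[OF representative_permutes[OF cl] q h lab(2) step])
        show ?case unfolding cnt c using elim by simp
      qed
    qed
    then show ?thesis using reduce lab ne by (simp add: moment_limit_def)
  qed
qed

end

section \<open>The derivative of the expected tensor power\<close>

lemma finite_Sym: "finite (Sym N)"
  unfolding Sym_def by (rule finite_permutations) simp

lemma finite_conjugacy_class: "conjugacy_class N C \<Longrightarrow> finite C"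
  using conjugacy_class_subset finite_Sym finite_subset by blast

section \<open>Conjugation invariance of the counts\<close>

lemma conjugacy_class_conj_closed:
  assumes C: "conjugacy_class N C" and \<sigma>: "\<sigma> \<in> C" and \<tau>: "\<tau> permutes {1..N}"
  shows "\<tau> \<circ> \<sigma> \<circ> inv \<tau> \<in> C"
proof -
  obtain \<rho> where \<rho>: "\<rho> \<in> Sym N" "C = (\<lambda>\<tau>. \<tau> \<circ> \<rho> \<circ> inv \<tau>) ` Sym N"
    using C by (auto simp: conjugacy_class_def)
  then obtain \<theta> where \<theta>: "\<theta> permutes {1..N}" "\<sigma> = \<theta> \<circ> \<rho> \<circ> inv \<theta>" using \<sigma> by (auto simp: Sym_def)
  have "\<tau> \<circ> \<sigma> \<circ> inv \<tau> = (\<tau> \<circ> \<theta>) \<circ> \<rho> \<circ> inv (\<tau> \<circ> \<theta>)"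
    unfolding \<theta>(2) using permutes_bij[OF \<tau>] permutes_bij[OF \<theta>(1)] by (simp add: o_inv_distrib o_assoc)
  moreover have "\<tau> \<circ> \<theta> \<in> Sym N" using permutes_compose[OF \<theta>(1) \<tau>] by (simp add: Sym_def)
  ultimately show ?thesis unfolding \<rho>(2) by blast
qed

lemma conjugacy_class_conjugate:
  assumes C: "conjugacy_class N C" and \<sigma>: "\<sigma> \<in> C" and \<sigma>': "\<sigma>' \<in> C"
  obtains \<tau> where "\<tau> permutes {1..N}" "\<sigma>' = \<tau> \<circ> \<sigma> \<circ> inv \<tau>"
proof -
  obtain \<rho> where \<rho>: "\<rho> \<in> Sym N" "C = (\<lambda>\<tau>. \<tau> \<circ> \<rho> \<circ> inv \<tau>) ` Sym N"
    using C by (auto simp: conjugacy_class_def)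
  then obtain \<theta> \<theta>' where \<theta>: "\<theta> permutes {1..N}" "\<sigma> = \<theta> \<circ> \<rho> \<circ> inv \<theta>"
    and \<theta>': "\<theta>' permutes {1..N}" "\<sigma>' = \<theta>' \<circ> \<rho> \<circ> inv \<theta>'" using \<sigma> \<sigma>' by (auto simp: Sym_def)
  let ?\<tau> = "\<theta>' \<circ> inv \<theta>"
  have \<tau>: "?\<tau> permutes {1..N}" by (rule permutes_compose[OF permutes_inv[OF \<theta>(1)] \<theta>'(1)])
  have "inv ?\<tau> = \<theta> \<circ> inv \<theta>'"
    using permutes_bij[OF \<theta>(1)] permutes_bij[OF \<theta>'(1)]
    by (simp add: o_inv_distrib bij_imp_bij_inv inv_inv_eq)
  then have "\<sigma>' = ?\<tau> \<circ> \<sigma> \<circ> inv ?\<tau>"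
    unfolding \<theta>(2) \<theta>'(2) using permutes_inverses[OF \<theta>(1)] by (simp add: fun_eq_iff)
  then show ?thesis using that \<tau> by blast
qed

text \<open>Relabelling a colouring by \<tau> keeps its kernel and turns compatibility with \<sigma>
  into compatibility with the conjugate.\<close>

lemma card_fits_le_conjugate:
  assumes \<tau>: "\<tau> permutes {1..N}" and q: "q \<in> partitions k"
  shows "card {I \<in> colourings k q {1..N}. fits k \<sigma> I}
    \<le> card {I \<in> colourings k q {1..N}. fits k (\<tau> \<circ> \<sigma> \<circ> inv \<tau>) I}"
proof (rule card_inj_on_le)
  let ?f = "\<lambda>I. restrict (\<tau> \<circ> I) (points k)"
  have inj: "\<tau> x = \<tau> y \<longleftrightarrow> x = y" for x y using permutes_inj[OF \<tau>] by (auto dest: injD)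
  show "inj_on ?f {I \<in> colourings k q {1..N}. fits k \<sigma> I}"
  proof (rule inj_onI)
    fix I I' assume I: "I \<in> {I \<in> colourings k q {1..N}. fits k \<sigma> I}" "I' \<in> {I \<in> colourings k q {1..N}. fits k \<sigma> I}"
      and eq: "?f I = ?f I'"
    have "I a = I' a" if "a \<in> points k" for a using fun_cong[OF eq, of a] that inj by simp
    then show "I = I'" using I by (intro PiE_ext[of I "points k" "\<lambda>_. {1..N}" I']) (auto simp: colourings_def)
  qed
  show "finite {I \<in> colourings k q {1..N}. fits k (\<tau> \<circ> \<sigma> \<circ> inv \<tau>) I}"
    using finite_colourings by simp
  show "?f ` {I \<in> colourings k q {1..N}. fits k \<sigma> I} \<subseteq> {I \<in> colourings k q {1..N}. fits k (\<tau> \<circ> \<sigma> \<circ> inv \<tau>) I}"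
  proof
    fix I' assume "I' \<in> ?f ` {I \<in> colourings k q {1..N}. fits k \<sigma> I}"
    then obtain I where I: "I \<in> colourings k q {1..N}" "fits k \<sigma> I" "I' = ?f I" by blast
    have "\<tau> (I a) \<in> {1..N}" if "a \<in> points k" for a
      using permutes_in_image[OF \<tau>, of "I a"] I(1) that by (auto simp: colourings_def PiE_iff)
    then have "I' \<in> points k \<rightarrow>\<^sub>E {1..N}" unfolding I(3) by auto
    then have "I' \<in> colourings k q {1..N}"
      by (rule colouringsI[OF q]) (use inj colouring_eq_iff[OF I(1)] in \<open>auto simp: I(3)\<close>)
    moreover have "fits k (\<tau> \<circ> \<sigma> \<circ> inv \<tau>) I'"
      using I(2) permutes_inverses(2)[OF \<tau>] by (auto simp: fits_def I(3))
    ultimately show "I' \<in> {I \<in> colourings k q {1..N}. fits k (\<tau> \<circ> \<sigma> \<circ> inv \<tau>) I}" by blast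
  qed
qed

lemma card_fits_class:
  assumes "conjugacy_class N C" "\<sigma> \<in> C" "\<sigma>' \<in> C" and q: "q \<in> partitions k"
  shows "card {I \<in> colourings k q {1..N}. fits k \<sigma> I} = card {I \<in> colourings k q {1..N}. fits k \<sigma>' I}"
proof (rule antisym)
  obtain \<tau> where \<tau>: "\<tau> permutes {1..N}" "\<sigma>' = \<tau> \<circ> \<sigma> \<circ> inv \<tau>"
    by (rule conjugacy_class_conjugate[OF assms(1-3)])
  show "card {I \<in> colourings k q {1..N}. fits k \<sigma> I} \<le> card {I \<in> colourings k q {1..N}. fits k \<sigma>' I}"
    unfolding \<tau>(2) by (rule card_fits_le_conjugate[OF \<tau>(1) q])
  obtain \<tau>' where \<tau>': "\<tau>' permutes {1..N}" "\<sigma> = \<tau>' \<circ> \<sigma>' \<circ> inv \<tau>'"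
    by (rule conjugacy_class_conjugate[OF assms(1,3,2)])
  show "card {I \<in> colourings k q {1..N}. fits k \<sigma>' I} \<le> card {I \<in> colourings k q {1..N}. fits k \<sigma> I}"
    unfolding \<tau>'(2) by (rule card_fits_le_conjugate[OF \<tau>'(1) q])
qed

text \<open>Two colourings with the same kernel differ by an injective relabelling. Extended to a
  permutation, it conjugates the members of the class compatible with \<open>I\<close> into members
  compatible with \<open>I'\<close>.\<close>

lemma card_class_fits_le:
  assumes C: "conjugacy_class N C" and I: "I \<in> colourings k q {1..N}" and I': "I' \<in> colourings k q {1..N}"
  shows "card {\<sigma> \<in> C. fits k \<sigma> I} \<le> card {\<sigma> \<in> C. fits k \<sigma> I'}"
proof -
  define f where "f x = I' (SOME a. a \<in> points k \<and> I a = x)" for x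
  have f: "f (I a) = I' a" if a: "a \<in> points k" for a
  proof -
    define b where "b = (SOME b. b \<in> points k \<and> I b = I a)"
    have "b \<in> points k \<and> I b = I a" unfolding b_def by (rule someI[of _ a]) (simp add: a)
    then show ?thesis
      using colouring_eq_iff[OF I, of b a] colouring_eq_iff[OF I', of b a] a by (simp add: f_def b_def)
  qed
  have "inj_on f (I ` points k)"
    by (rule inj_onI) (use f colouring_eq_iff[OF I] colouring_eq_iff[OF I'] in auto)
  moreover have "I ` points k \<subseteq> {1..N}" "f ` I ` points k \<subseteq> {1..N}"
    using I I' f by (auto simp: colourings_def PiE_iff)
  ultimately obtain \<tau> where \<tau>: "\<tau> permutes {1..N}" "\<And>x. x \<in> I ` points k \<Longrightarrow> \<tau> x = f x"
    using permutes_extend_injection[of "{1..N}" "I ` points k" f] by (metis finite_atLeastAtMost)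
  have \<tau>I: "\<tau> (I a) = I' a" if "a \<in> points k" for a using \<tau>(2)[of "I a"] f that by simp
  show ?thesis
  proof (rule card_inj_on_le)
    let ?g = "\<lambda>\<sigma>. \<tau> \<circ> \<sigma> \<circ> inv \<tau>"
    show "inj_on ?g {\<sigma> \<in> C. fits k \<sigma> I}"
    proof (rule inj_onI)
      fix \<sigma> \<sigma>' assume "?g \<sigma> = ?g \<sigma>'"
      then have "\<tau> (\<sigma> (inv \<tau> (\<tau> x))) = \<tau> (\<sigma>' (inv \<tau> (\<tau> x)))" for x by (metis comp_apply)
      then have "\<sigma> x = \<sigma>' x" for x
        using permutes_inj[OF \<tau>(1)] permutes_inverses(2)[OF \<tau>(1)] by (auto dest: injD)
      then show "\<sigma> = \<sigma>'" by (simp add: fun_eq_iff)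
    qed
    show "finite {\<sigma> \<in> C. fits k \<sigma> I'}" using finite_conjugacy_class[OF C] by simp
    show "?g ` {\<sigma> \<in> C. fits k \<sigma> I} \<subseteq> {\<sigma> \<in> C. fits k \<sigma> I'}"
    proof
      fix \<rho> assume "\<rho> \<in> ?g ` {\<sigma> \<in> C. fits k \<sigma> I}"
      then obtain \<sigma> where \<sigma>: "\<sigma> \<in> C" "fits k \<sigma> I" "\<rho> = ?g \<sigma>" by blast
      have "\<rho> (I' (Inl m)) = I' (Inr m)" if "m \<in> {1..k}" for m
      proof -
        have "\<rho> (I' (Inl m)) = \<tau> (\<sigma> (inv \<tau> (\<tau> (I (Inl m)))))"
          using \<tau>I[of "Inl m"] that by (simp add: \<sigma>(3))
        also have "\<dots> = \<tau> (I (Inr m))"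
          using permutes_inverses(2)[OF \<tau>(1)] \<sigma>(2) that by (simp add: fits_def)
        finally show ?thesis using \<tau>I[of "Inr m"] that by simp
      qed
      then show "\<rho> \<in> {\<sigma> \<in> C. fits k \<sigma> I'}"
        using conjugacy_class_conj_closed[OF C \<sigma>(1) \<tau>(1)] \<sigma>(3) by (simp add: fits_def)
    qed
  qed
qed

text \<open>Double counting of the compatible pairs of a permutation and a colouring: by conjugation
  invariance the count is the same for all permutations of the class, and the same for all
  colourings.\<close>

lemma class_average:
  assumes C: "conjugacy_class N C" and q: "q \<in> partitions k" and I: "I \<in> colourings k q {1..N}"
  shows "real (card {\<sigma> \<in> C. fits k \<sigma> I}) / real (card C) =
    real (card {I \<in> colourings k q {1..N}. fits k (representative C) I}) / real (\<Prod>i<nc q. N - i)"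
proof -
  let ?K = "colourings k q {1..N}"
  have fin: "finite C" "finite ?K" using finite_conjugacy_class[OF C] finite_colourings by auto
  have "(\<Sum>\<sigma>\<in>C. card {I \<in> ?K. fits k \<sigma> I}) = (\<Sum>I\<in>?K. card {\<sigma> \<in> C. fits k \<sigma> I})"
    unfolding card_eq_sum by (rule sum.swap_restrict[OF fin])
  moreover have "(\<Sum>\<sigma>\<in>C. card {I \<in> ?K. fits k \<sigma> I}) = card C * card {I \<in> ?K. fits k (representative C) I}"
    using card_fits_class[OF C _ representative_in[OF C] q] by (simp add: sum_constant)
  moreover have "(\<Sum>I'\<in>?K. card {\<sigma> \<in> C. fits k \<sigma> I'}) = card ?K * card {\<sigma> \<in> C. fits k \<sigma> I}"
  proof -
    have "card {\<sigma> \<in> C. fits k \<sigma> I'} = card {\<sigma> \<in> C. fits k \<sigma> I}" if "I' \<in> ?K" for I'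
      by (rule antisym[OF card_class_fits_le[OF C that I] card_class_fits_le[OF C I that]])
    then have "(\<Sum>I'\<in>?K. card {\<sigma> \<in> C. fits k \<sigma> I'}) = (\<Sum>I'\<in>?K. card {\<sigma> \<in> C. fits k \<sigma> I})"
      by (rule sum.cong[OF refl])
    then show ?thesis by simp
  qed
  ultimately have "card C * card {I \<in> ?K. fits k (representative C) I} = card ?K * card {\<sigma> \<in> C. fits k \<sigma> I}"
    by simp
  then have "real (card {\<sigma> \<in> C. fits k \<sigma> I}) * real (card ?K) =
      real (card {I \<in> ?K. fits k (representative C) I}) * real (card C)"
    by (simp only: mult.commute flip: of_nat_mult)
  moreover have "real (card C) \<noteq> 0" using fin conjugacy_class_nonempty[OF C] by simp
  moreover have "real (card ?K) \<noteq> 0" using fin I by auto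
  ultimately have "real (card {\<sigma> \<in> C. fits k \<sigma> I}) / real (card C) =
      real (card {I \<in> ?K. fits k (representative C) I}) / real (card ?K)"
    by (simp add: frac_eq_eq)
  then show ?thesis using card_colourings[OF q, of "{1..N}"] by simp
qed

text \<open>Real-valued, because \<open>generator\<close> and \<open>has_generator\<close> act on
  real functions.\<close>

definition matrix_entry :: "nat \<Rightarrow> (nat \<Rightarrow> nat) \<Rightarrow> (nat \<Rightarrow> nat) \<Rightarrow> (nat \<Rightarrow> nat) \<Rightarrow> real"
  where "matrix_entry k J K \<sigma> = (if \<forall>m\<in>{1..k}. J m = \<sigma> (K m) then 1 else 0)"

lemma tensor_product_perm_matrix:
  "tensor_product k (\<lambda>_. perm_matrix \<sigma>) J K = of_real (matrix_entry k J K \<sigma>)"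
proof (cases "\<forall>m\<in>{1..k}. J m = \<sigma> (K m)")
  case True
  then show ?thesis unfolding tensor_product_def perm_matrix_def matrix_entry_def by (simp add: prod.neutral)
next
  case False
  then have "tensor_product k (\<lambda>_. perm_matrix \<sigma>) J K = 0"
    unfolding tensor_product_def by (intro prod_zero) (auto simp: perm_matrix_def)
  then show ?thesis using False by (simp only: matrix_entry_def if_False of_real_0)
qed

lemma generator_matrix_entry:
  assumes C: "conjugacy_class N C" and J: "J \<in> tensor_indices N k" and K: "K \<in> tensor_indices N k"
  shows "generator N C (matrix_entry k J K) id = scaled_count N C k (Ker k (pair_index J K))"
proof -
  let ?q = "Ker k (pair_index J K)"
  define I where "I = restrict (pair_index J K) (points k)"
  have q: "?q \<in> partitions k" by (rule Ker_in_partitions)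
  have "pair_index J K a \<in> {1..N}" if "a \<in> points k" for a
    using that J K by (cases a) (auto simp: pair_index_def tensor_indices_def PiE_iff)
  then have I: "I \<in> colourings k ?q {1..N}"
    unfolding I_def by (intro colouringsI[OF q]) (auto simp: joined_Ker)
  have entry: "matrix_entry k J K \<sigma> = (if fits k \<sigma> I then 1 else 0)" for \<sigma>
    by (auto simp: matrix_entry_def fits_def I_def pair_index_def)
  have id: "fits k id I \<longleftrightarrow> nonears k ?q = {}"
    by (auto simp: fits_def I_def nonears_def joined_Ker)
  have fin: "finite C" by (rule finite_conjugacy_class[OF C])
  have c: "card C > 0" using fin conjugacy_class_nonempty[OF C] by (simp add: card_gt_0_iff)
  have 1: "(\<Sum>\<sigma>\<in>C. matrix_entry k J K (\<sigma> \<circ> id) - matrix_entry k J K id) =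
      (\<Sum>\<sigma>\<in>C. matrix_entry k J K \<sigma>) - real (card C) * matrix_entry k J K id"
    by (simp add: sum_subtractf)
  have 2: "(\<Sum>\<sigma>\<in>C. matrix_entry k J K \<sigma>) = real (card {\<sigma> \<in> C. fits k \<sigma> I})"
    unfolding entry using fin by (simp flip: sum.inter_filter)
  have 3: "matrix_entry k J K id = (if nonears k ?q = {} then 1 else 0)"
    unfolding entry id ..
  have "1 / real (card C) * (\<Sum>\<sigma>\<in>C. matrix_entry k J K (\<sigma> \<circ> id) - matrix_entry k J K id) =
      real (card {\<sigma> \<in> C. fits k \<sigma> I}) / real (card C) - (if nonears k ?q = {} then 1 else 0)"
    unfolding 1 unfolding 2 3 using c by (simp only: right_diff_distrib) simp
  then show ?thesis
    unfolding generator_def scaled_count_def class_average[OF C q I, symmetric]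
    by (simp only: mult.assoc)
qed

text \<open>The Markov property is used for the two times 0 and \<open>t\<close>: the event at time
  0 has probability 1, so the joint probability is the marginal one at time
  \<open>t\<close>.\<close>

lemma markov_process_marginal:
  assumes mp: "markov_process M S X P" and start: "AE \<omega> in M. S 0 \<omega> = e" and e: "e \<in> X"
    and t: "t \<ge> 0" and y: "y \<in> X"
  shows "measure M {\<omega> \<in> space M. S t \<omega> = y} = P t e y"
proof -
  interpret prob_space M using mp by (simp add: markov_process_def)
  have meas: "S t \<in> measurable M (count_space X)" if "t \<ge> 0" for t
    using mp that by (simp add: markov_process_def)
  have ev: "{\<omega> \<in> space M. S t \<omega> = z} \<in> events" if "t \<ge> 0" "z \<in> X" for t z
  proof -
    have "S t -` {z} \<inter> space M \<in> events"
      by (rule measurable_sets[OF meas[OF that(1)]]) (use that in simp)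
    moreover have "S t -` {z} \<inter> space M = {\<omega> \<in> space M. S t \<omega> = z}" by auto
    ultimately show ?thesis by simp
  qed
  have step: "\<And>n (t :: nat \<Rightarrow> real) x. 0 \<le> t 0 \<Longrightarrow> (\<forall>i\<le>n. t i \<le> t (Suc i)) \<Longrightarrow> (\<forall>i\<le>Suc n. x i \<in> X) \<Longrightarrow>
       measure M {\<omega> \<in> space M. \<forall>i\<le>Suc n. S (t i) \<omega> = x i} =
       measure M {\<omega> \<in> space M. \<forall>i\<le>n. S (t i) \<omega> = x i} * P (t (Suc n) - t n) (x n) (x (Suc n))"
    using mp unfolding markov_process_def by blast
  have "measure M {\<omega> \<in> space M. \<forall>i\<le>Suc 0. S (if i = 0 then 0 else t) \<omega> = (if i = 0 then e else y)} =
      measure M {\<omega> \<in> space M. \<forall>i\<le>0::nat. S (if i = 0 then 0 else t) \<omega> = (if i = 0 then e else y)} *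
      P ((if Suc 0 = 0 then 0 else t) - (if (0::nat) = 0 then 0 else t)) (if (0::nat) = 0 then e else y) (if Suc 0 = 0 then e else y)"
    by (rule step[of "\<lambda>i. if i = 0 then 0 else t" 0 "\<lambda>i. if i = 0 then e else y"]) (use t e y in auto)
  moreover have "(\<forall>i\<le>Suc 0. S (if i = 0 then 0 else t) \<omega> = (if i = 0 then e else y)) \<longleftrightarrow> S 0 \<omega> = e \<and> S t \<omega> = y" for \<omega>
    by (auto simp: le_Suc_eq)
  moreover have "(\<forall>i\<le>0::nat. S (if i = 0 then 0 else t) \<omega> = (if i = 0 then e else y)) \<longleftrightarrow> S 0 \<omega> = e" for \<omega>
    by auto
  ultimately have "prob {\<omega> \<in> space M. S 0 \<omega> = e \<and> S t \<omega> = y} = prob {\<omega> \<in> space M. S 0 \<omega> = e} * P t e y"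
    by simp
  moreover have "prob {\<omega> \<in> space M. S 0 \<omega> = e} = 1"
    using prob_Collect_eq_1[OF ev[OF order_refl e]] start by simp
  moreover have "prob {\<omega> \<in> space M. S 0 \<omega> = e \<and> S t \<omega> = y} = prob {\<omega> \<in> space M. S t \<omega> = y}"
  proof (rule prob_eq_AE)
    show "AE \<omega> in M. (S 0 \<omega> = e \<and> S t \<omega> = y) = (S t \<omega> = y)" using start by eventually_elim simp
    have "{\<omega> \<in> space M. S 0 \<omega> = e \<and> S t \<omega> = y} = {\<omega> \<in> space M. S 0 \<omega> = e} \<inter> {\<omega> \<in> space M. S t \<omega> = y}" by auto
    then show "{\<omega> \<in> space M. S 0 \<omega> = e \<and> S t \<omega> = y} \<in> events" using ev[OF order_refl e] ev[OF t y] by auto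
  qed (rule ev[OF t y])
  ultimately show ?thesis by simp
qed

lemma markov_process_expectation:
  fixes f :: "'s \<Rightarrow> real"
  assumes mp: "markov_process M S X P" and start: "AE \<omega> in M. S 0 \<omega> = e" and e: "e \<in> X"
    and t: "t \<ge> 0" and fin: "finite X"
  shows "(\<integral>\<omega>. complex_of_real (f (S t \<omega>)) \<partial>M) = of_real (\<Sum>y\<in>X. P t e y * f y)"
proof -
  interpret prob_space M using mp by (simp add: markov_process_def)
  have meas: "S t \<in> measurable M (count_space X)" using mp t by (simp add: markov_process_def)
  have ev: "{\<omega> \<in> space M. S t \<omega> = z} \<in> events" if "z \<in> X" for z
  proof -
    have "S t -` {z} \<inter> space M \<in> events" by (rule measurable_sets[OF meas]) (use that in simp)
    moreover have "S t -` {z} \<inter> space M = {\<omega> \<in> space M. S t \<omega> = z}" by auto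
    ultimately show ?thesis by simp
  qed
  have "(\<integral>\<omega>. f (S t \<omega>) \<partial>M) = (\<integral>\<omega>. (\<Sum>y\<in>X. indicator {\<omega> \<in> space M. S t \<omega> = y} \<omega> * f y) \<partial>M)"
  proof (rule Bochner_Integration.integral_cong)
    fix \<omega> assume \<omega>: "\<omega> \<in> space M"
    have "S t \<omega> \<in> X" using measurable_space[OF meas \<omega>] by simp
    have "(\<Sum>y\<in>X. indicator {\<omega> \<in> space M. S t \<omega> = y} \<omega> * f y) = (\<Sum>y\<in>X. if S t \<omega> = y then f y else 0)"
      by (rule sum.cong) (use \<omega> in auto)
    then show "f (S t \<omega>) = (\<Sum>y\<in>X. indicator {\<omega> \<in> space M. S t \<omega> = y} \<omega> * f y)"
      using \<open>S t \<omega> \<in> X\<close> fin by simp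
  qed simp
  also have "\<dots> = (\<Sum>y\<in>X. (\<integral>\<omega>. indicator {\<omega> \<in> space M. S t \<omega> = y} \<omega> * f y \<partial>M))"
    by (rule Bochner_Integration.integral_sum)
      (use ev in \<open>auto intro!: integrable_mult_left integrable_real_indicator simp: emeasure_eq_measure\<close>)
  also have "\<dots> = (\<Sum>y\<in>X. P t e y * f y)"
  proof (rule sum.cong)
    fix y assume y: "y \<in> X"
    show "(\<integral>\<omega>. indicator {\<omega> \<in> space M. S t \<omega> = y} \<omega> * f y \<partial>M) = P t e y * f y"
      using ev[OF y] markov_process_marginal[OF mp start e t y] sets.sets_into_space[OF ev[OF y]]
      by (simp add: Int_absorb2)
  qed simp
  finally show ?thesis by (simp only: integral_complex_of_real)
qed

text \<open>The expected entry at time \<open>t\<close> is the transition semigroup applied to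
  \<open>matrix_entry\<close> and evaluated at \<open>id\<close>, so its right derivative at 0 is
  the generator.\<close>

lemma mean_derivative_eq:
  assumes C: "conjugacy_class N C" and walk: "class_random_walk N C M S"
    and J: "J \<in> tensor_indices N k" and K: "K \<in> tensor_indices N k"
  shows "mean_derivative M S k J K = of_real (scaled_count N C k (Ker k (pair_index J K)))"
proof -
  let ?f = "matrix_entry k J K" and ?D = "scaled_count N C k (Ker k (pair_index J K))"
  obtain P where mp: "markov_process M S (Sym N) P" and gen: "has_generator (Sym N) P (generator N C)"
    and start: "AE \<omega> in M. S 0 \<omega> = id"
    using walk by (auto simp: class_random_walk_def)
  have id: "id \<in> Sym N" by (simp add: Sym_def permutes_id)
  define u where "u t = (\<Sum>y\<in>Sym N. P t id y * ?f y)" for t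
  have u0: "u 0 = ?f id"
  proof -
    have "P 0 id y = (if id = y then 1 else 0)" if "y \<in> Sym N" for y
      using mp id that by (simp add: markov_process_def transition_semigroup_def)
    then have "u 0 = (\<Sum>y\<in>Sym N. if id = y then ?f y else 0)" unfolding u_def by (intro sum.cong) auto
    then show ?thesis using id finite_Sym by simp
  qed
  have "((\<lambda>t. (u t - u 0) / (t - 0)) \<longlongrightarrow> generator N C ?f id) (at_right 0)"
    using gen id unfolding has_generator_def u0 by (simp add: u_def)
  then have "((\<lambda>t. (u t - u 0) / (t - 0)) \<longlongrightarrow> ?D) (at 0 within {0..})"
    by (simp only: generator_matrix_entry[OF C J K] at_within_Ici_at_right)
  then have "(u has_field_derivative ?D) (at 0 within {0..})"
    unfolding has_field_derivative_iff .
  then have deriv: "((\<lambda>t. complex_of_real (u t)) has_vector_derivative of_real ?D) (at 0 within {0..})"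
    by (rule has_vector_derivative_of_real)
  have "(\<integral>\<omega>. tensor_product k (\<lambda>_. perm_matrix (S t \<omega>)) J K \<partial>M) = complex_of_real (u t)"
    if "t \<in> {0..}" for t
    unfolding tensor_product_perm_matrix u_def
    by (rule markov_process_expectation[OF mp start id _ finite_Sym]) (use that in simp)
  then have "((\<lambda>t. \<integral>\<omega>. tensor_product k (\<lambda>_. perm_matrix (S t \<omega>)) J K \<partial>M)
      has_vector_derivative of_real ?D) (at 0 within {0..})"
    by (rule has_vector_derivative_transform[OF _ _ deriv, rotated]) simp_all
  moreover have "at (0::real) within {0..} \<noteq> bot"
    by (simp add: at_within_Ici_at_right trivial_limit_at_right_real)
  ultimately show ?thesis
    unfolding mean_derivative_def by (intro vector_derivative_within)
qed

theorem log_kappa_limit: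
  assumes nontriv: "\<And>N. N \<ge> 2 \<Longrightarrow> nontrivial_class N (C N)"
    and conv: "classes_converge C lam 0"
    and walk: "\<And>N. N \<ge> 2 \<Longrightarrow> class_random_walk N (C N) (M N) (S N)"
    and p: "p \<in> partitions k"
  shows "(\<lambda>N. log_kappa M S N k p) \<longlonglongrightarrow> of_real (log_cumulant_value lam k p)"
proof (rule lower_sum_limit[where g = "\<lambda>N q. of_real (scaled_count N (C N) k q)"
      and m = "\<lambda>q. of_real (moment_limit lam k q)"])
  fix q assume q: "q \<in> partitions k"
  show "\<forall>\<^sub>F N in sequentially. (\<Sum>p\<in>{p \<in> partitions k. refines (points k) p q}.
      of_nat N powi (- part_rank k p) * log_kappa M S N k p) = of_real (scaled_count N (C N) k q)"
    \<comment> \<open>The part \<open>2 * k\<close> makes the coefficients unique; the bound 2 is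
      where the assumptions on the classes and the walks start.\<close>
    using eventually_ge_at_top[of "2 * k + 2"]
  proof eventually_elim
    case (elim N)
    then have N: "2 * k \<le> N" "1 \<le> N" "2 \<le> N" by auto
    have c: "conjugacy_class N (C N)" using nontriv[OF N(3)] by (simp add: nontrivial_class_def)
    show ?case unfolding log_kappa_def
      by (rule kappa_lower_sum[OF N(1,2) _ q]) (rule mean_derivative_eq[OF c walk[OF N(3)]])
  qed
  have "(\<lambda>N. complex_of_real (real N powi part_rank k q * scaled_count N (C N) k q)) \<longlonglongrightarrow> of_real (moment_limit lam k q)"
    by (rule tendsto_of_real[OF scaled_count_limit[OF nontriv conv q]])
  then show "(\<lambda>N. of_nat N powi part_rank k q * complex_of_real (scaled_count N (C N) k q)) \<longlonglongrightarrow> of_real (moment_limit lam k q)"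
    by simp
  show "(\<Sum>p\<in>geodesic_below k q. complex_of_real (log_cumulant_value lam k p)) = of_real (moment_limit lam k q)"
    using sum_log_cumulant_value[OF q, of lam] by (simp flip: of_real_sum)
qed (rule p)

section \<open>Embeddings of columns\<close>

lemma active_iff:
  assumes p: "p \<in> partitions k" and i: "i \<in> {1..k}"
  shows "i \<in> active k p \<longleftrightarrow> \<not> joined p (Inl i) (Inr i) \<or> (\<exists>b. joined p (Inl i) b \<and> col b \<noteq> i)"
proof
  assume act: "i \<in> active k p"
  show "\<not> joined p (Inl i) (Inr i) \<or> (\<exists>b. joined p (Inl i) b \<and> col b \<noteq> i)"
  proof (rule ccontr)
    assume "\<not> ?thesis"
    then have "joined p (Inl i) (Inr i)" and c: "\<And>b. joined p (Inl i) b \<Longrightarrow> col b = i" by auto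
    moreover have "b = Inl i \<or> b = Inr i" if "joined p (Inl i) b" for b using c[OF that] by (cases b) auto
    moreover have "joined p (Inl i) (Inl i)" using joined_refl[OF partitionsD[OF p]] i by simp
    ultimately have "{b. joined p (Inl i) b} = {Inl i, Inr i}" by blast
    then show False using joined_block_in[OF partitionsD[OF p], of "Inl i"] act i by (simp add: active_def)
  qed
next
  assume *: "\<not> joined p (Inl i) (Inr i) \<or> (\<exists>b. joined p (Inl i) b \<and> col b \<noteq> i)"
  show "i \<in> active k p"
  proof (rule ccontr)
    assume "i \<notin> active k p"
    then have "joined p (Inl i) b \<longleftrightarrow> b \<in> points k \<and> col b = i" for b
      using joined_inactive[OF p, of "Inl i" b] i by simp
    then show False using * i by simp
  qed
qed

lemma col_map_sum: "col (map_sum f f a) = f (col a)"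
  by (cases a) auto

text \<open>One relation that covers juxtaposition with identities, permutation of columns and the
  comparison of a partition with its head. The columns of \<open>p\<close> outside the image are
  inactive, so \<open>p'\<close> carries all of the structure.\<close>

definition embeds :: "(nat \<Rightarrow> nat) \<Rightarrow> nat \<Rightarrow> point set set \<Rightarrow> nat \<Rightarrow> point set set \<Rightarrow> bool"
  where "embeds \<pi> k' p' k p \<longleftrightarrow> p' \<in> partitions k' \<and> p \<in> partitions k \<and>
    inj_on \<pi> {1..k'} \<and> \<pi> ` {1..k'} \<subseteq> {1..k} \<and> active k p \<subseteq> \<pi> ` {1..k'} \<and>
    (\<forall>a\<in>points k'. \<forall>b\<in>points k'. joined p (map_sum \<pi> \<pi> a) (map_sum \<pi> \<pi> b) \<longleftrightarrow> joined p' a b)"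

context
  fixes \<pi> k' p' k p
  assumes emb: "embeds \<pi> k' p' k p"
begin

private abbreviation (input) "m \<equiv> map_sum \<pi> \<pi>"

private lemma props: "p' \<in> partitions k'" "p \<in> partitions k" "inj_on \<pi> {1..k'}" "\<pi> ` {1..k'} \<subseteq> {1..k}"
  "active k p \<subseteq> \<pi> ` {1..k'}"
  "\<And>a b. a \<in> points k' \<Longrightarrow> b \<in> points k' \<Longrightarrow> joined p (m a) (m b) \<longleftrightarrow> joined p' a b"
  using emb by (auto simp: embeds_def)

text \<open>A block that meets the image of the embedding stays over it, since the columns outside
  are blocks on their own.\<close>

lemma embeds_preimage:
  assumes "joined p (map_sum \<pi> \<pi> a) b" "a \<in> points k'"
  obtains b' where "b' \<in> points k'" "b = map_sum \<pi> \<pi> b'"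
proof -
  have b: "b \<in> points k" using joined_in[OF partitionsD[OF props(2)] assms(1)] by simp
  have "col b \<in> \<pi> ` {1..k'}"
  proof (cases "col b \<in> active k p")
    case False
    then have "col b = col (m a)"
      using joined_inactive[OF props(2) b False] joined_sym[OF assms(1)] by simp
    then show ?thesis using assms(2) by (simp add: col_map_sum in_points_iff)
  qed (use props(5) in blast)
  then obtain i where i: "i \<in> {1..k'}" "col b = \<pi> i" by blast
  show ?thesis
  proof (cases b)
    case (Inl x) then show ?thesis using that[of "Inl i"] i by simp
  next
    case (Inr x) then show ?thesis using that[of "Inr i"] i by simp
  qed
qed

lemma embeds_nonears: "nonears k p = \<pi> ` nonears k' p'"
proof -
  have iff: "\<pi> i \<in> nonears k p \<longleftrightarrow> i \<in> nonears k' p'" if "i \<in> {1..k'}" for i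
  proof -
    have "\<pi> i \<in> {1..k}" using props(4) that by blast
    then show ?thesis using props(6)[of "Inl i" "Inr i"] that by (simp add: nonears_def)
  qed
  show ?thesis
  proof (intro equalityI subsetI)
    fix x assume x: "x \<in> nonears k p"
    then obtain i where "i \<in> {1..k'}" "x = \<pi> i" using nonears_subset_active props(5) by blast
    then show "x \<in> \<pi> ` nonears k' p'" using iff x by blast
  next
    fix x assume "x \<in> \<pi> ` nonears k' p'"
    then show "x \<in> nonears k p" using iff nonears_subset[of k' p'] by blast
  qed
qed

lemma embeds_active: "active k p = \<pi> ` active k' p'"
proof -
  have iff: "\<pi> i \<in> active k p \<longleftrightarrow> i \<in> active k' p'" if i: "i \<in> {1..k'}" for i
  proof -
    have \<pi>i: "\<pi> i \<in> {1..k}" using props(4) i by blast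
    have 1: "joined p (Inl (\<pi> i)) (Inr (\<pi> i)) \<longleftrightarrow> joined p' (Inl i) (Inr i)"
      using props(6)[of "Inl i" "Inr i"] i by simp
    have 2: "(\<exists>b. joined p (Inl (\<pi> i)) b \<and> col b \<noteq> \<pi> i) \<longleftrightarrow> (\<exists>b. joined p' (Inl i) b \<and> col b \<noteq> i)"
    proof
      assume "\<exists>b. joined p (Inl (\<pi> i)) b \<and> col b \<noteq> \<pi> i"
      then obtain b where b: "joined p (m (Inl i)) b" "col b \<noteq> \<pi> i" by auto
      obtain b' where b': "b' \<in> points k'" "b = m b'" by (rule embeds_preimage[OF b(1)]) (use i in simp)
      then have "joined p' (Inl i) b'" using b(1) props(6)[of "Inl i" b'] i by simp
      moreover have "col b' \<noteq> i" using b(2) b'(2) by (auto simp: col_map_sum)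
      ultimately show "\<exists>b. joined p' (Inl i) b \<and> col b \<noteq> i" by blast
    next
      assume "\<exists>b. joined p' (Inl i) b \<and> col b \<noteq> i"
      then obtain b where b: "joined p' (Inl i) b" "col b \<noteq> i" by blast
      have bp: "b \<in> points k'" using joined_in[OF partitionsD[OF props(1)] b(1)] by simp
      then have "joined p (Inl (\<pi> i)) (m b)" using b(1) props(6)[of "Inl i" b] i by simp
      moreover have "col (m b) \<noteq> \<pi> i"
        using b(2) bp i inj_onD[OF props(3), of "col b" i] by (auto simp: col_map_sum in_points_iff)
      ultimately show "\<exists>b. joined p (Inl (\<pi> i)) b \<and> col b \<noteq> \<pi> i" by blast
    qed
    show ?thesis unfolding active_iff[OF props(2) \<pi>i] active_iff[OF props(1) i] 1 2 ..
  qed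
  show ?thesis
  proof (intro equalityI subsetI)
    fix x assume x: "x \<in> active k p"
    then obtain i where "i \<in> {1..k'}" "x = \<pi> i" using props(5) by blast
    then show "x \<in> \<pi> ` active k' p'" using iff x by blast
  next
    fix x assume "x \<in> \<pi> ` active k' p'"
    then obtain i where "i \<in> active k' p'" "x = \<pi> i" by blast
    then show "x \<in> active k p" using iff[of i] by (simp add: active_def)
  qed
qed

lemma embeds_single_cycle:
  assumes A: "A \<subseteq> {1..k'}"
  shows "single_cycle p (\<pi> ` A) \<longleftrightarrow> single_cycle p' A"
proof
  assume s: "single_cycle p (\<pi> ` A)"
  show "single_cycle p' A"
    unfolding single_cycle_def
  proof (intro allI impI)
    fix D' assume D': "closed_cols p' D'"
    define D where "D = \<pi> ` (D' \<inter> {1..k'})"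
    have "closed_cols p D"
      unfolding closed_cols_def
    proof (intro allI impI)
      fix a b assume ab: "joined p a b" "col a \<in> D"
      then obtain i where i: "i \<in> D'" "i \<in> {1..k'}" "col a = \<pi> i" by (auto simp: D_def)
      obtain a' where a': "a' \<in> points k'" "a = m a'" "col a' = i"
        using that[of "Inl i"] that[of "Inr i"] i by (cases a) auto
      obtain b' where b': "b' \<in> points k'" "b = m b'"
        by (rule embeds_preimage[OF _ a'(1)]) (use ab a' in auto)
      have "joined p' a' b'" using ab(1) props(6)[OF a'(1) b'(1)] a' b' by simp
      then have "col b' \<in> D'" using closed_colsD[OF D'] a'(3) i(1) by simp
      then show "col b \<in> D" using b' by (auto simp: D_def col_map_sum in_points_iff)
    qed
    then have "\<pi> ` A \<subseteq> D \<or> \<pi> ` A \<inter> D = {}" using s by (simp add: single_cycle_def)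
    moreover have "\<pi> i \<in> D \<longleftrightarrow> i \<in> D'" if "i \<in> A" for i
    proof -
      have "i \<in> {1..k'}" using that A by blast
      then show ?thesis unfolding D_def by (subst inj_on_image_mem_iff[OF props(3)]) auto
    qed
    ultimately show "A \<subseteq> D' \<or> A \<inter> D' = {}" by blast
  qed
next
  assume s: "single_cycle p' A"
  show "single_cycle p (\<pi> ` A)"
    unfolding single_cycle_def
  proof (intro allI impI)
    fix D assume D: "closed_cols p D"
    have "closed_cols p' {i. \<pi> i \<in> D}"
      unfolding closed_cols_def
    proof (intro allI impI)
      fix a b assume ab: "joined p' a b" "col a \<in> {i. \<pi> i \<in> D}"
      have "joined p (m a) (m b)"
        using ab(1) props(6) joined_in[OF partitionsD[OF props(1)] ab(1)] by simp
      then show "col b \<in> {i. \<pi> i \<in> D}"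
        using closed_colsD[OF D, of "m a" "m b"] ab(2) by (simp add: col_map_sum)
    qed
    then have "A \<subseteq> {i. \<pi> i \<in> D} \<or> A \<inter> {i. \<pi> i \<in> D} = {}" using s by (simp add: single_cycle_def)
    then show "\<pi> ` A \<subseteq> D \<or> \<pi> ` A \<inter> D = {}" by blast
  qed
qed

lemma embeds_id_part_iff: "p = id_part k \<longleftrightarrow> p' = id_part k'"
  using active_empty_iff[OF props(1)] active_empty_iff[OF props(2)] embeds_active by simp

text \<open>All ingredients of the value are transported by the embedding. The identity is excluded
  because its value counts the columns.\<close>

lemma embeds_log_cumulant_value:
  assumes "p \<noteq> id_part k"
  shows "log_cumulant_value lam k p = log_cumulant_value lam k' p'"
proof -
  have sub: "active k' p' \<subseteq> {1..k'}" "nonears k' p' \<subseteq> {1..k'}"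
    by (auto simp: active_def nonears_def)
  have inj: "inj_on \<pi> (nonears k' p')" using props(3) sub(2) by (rule inj_on_subset)
  have "active k p - nonears k p = \<pi> ` (active k' p' - nonears k' p')"
    unfolding embeds_active embeds_nonears
    by (rule inj_on_image_set_diff[OF props(3), symmetric]) (use sub in auto)
  then have "card (active k p - nonears k p) = card (active k' p' - nonears k' p')"
    using sub inj_on_subset[OF props(3)] by (simp add: card_image subset_iff)
  moreover have "weight lam p (nonears k p) = weight lam p' (nonears k' p')"
  proof (rule weight_transfer[of \<pi>])
    show "bij_betw \<pi> (nonears k' p') (nonears k p)"
      using inj embeds_nonears by (simp add: bij_betw_def)
    fix a b assume "col a \<in> nonears k' p'" "col b \<in> nonears k' p'"
    then show "joined p (m a) (m b) \<longleftrightarrow> joined p' a b"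
      using props(6) sub by (auto simp: in_points_iff subset_iff)
  qed
  ultimately show ?thesis
    using assms embeds_id_part_iff embeds_single_cycle[OF sub(1)]
    by (simp add: log_cumulant_value_def embeds_active[symmetric])
qed

end

section \<open>Juxtaposition and permutation of columns\<close>

lemma partition_on_image_blocks:
  assumes "partition_on A p" "inj_on f A"
  shows "partition_on (f ` A) ((`) f ` p)"
proof -
  have "partition_on (f ` A) ((`) f ` p - {{}})"
    using assms by (rule partition_on_inj_image)
  moreover have "{} \<notin> (`) f ` p" using partition_onD3[OF assms(1)] by auto
  ultimately show ?thesis by simp
qed

lemma joined_image_blocks:
  "joined ((`) f ` p) x y \<longleftrightarrow> (\<exists>a b. x = f a \<and> y = f b \<and> joined p a b)"
  unfolding joined_def by blast

lemma partition_on_disjoint_union: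
  assumes "partition_on A p" "partition_on B q" "A \<inter> B = {}"
  shows "partition_on (A \<union> B) (p \<union> q)"
proof (rule partition_onI)
  show "\<Union>(p \<union> q) = A \<union> B" using assms by (auto simp: partition_on_def)
  show "{} \<notin> p \<union> q" using assms by (auto simp: partition_on_def)
  fix X Y assume XY: "X \<in> p \<union> q" "Y \<in> p \<union> q" "X \<noteq> Y"
  have cross: "disjnt X Y" if "X \<in> p" "Y \<in> q" for X Y
    using block_subset[OF assms(1) that(1)] block_subset[OF assms(2) that(2)] assms(3)
    unfolding disjnt_def by blast
  consider "X \<in> p" "Y \<in> p" | "X \<in> q" "Y \<in> q" | "X \<in> p" "Y \<in> q" | "X \<in> q" "Y \<in> p" using XY by blast
  then show "disjnt X Y"
  proof cases
    case 1
    then show ?thesis using block_eqI[OF assms(1)] XY(3) unfolding disjnt_def by blast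
  next
    case 2
    then show ?thesis using block_eqI[OF assms(2)] XY(3) unfolding disjnt_def by blast
  next
    case 3 then show ?thesis by (rule cross)
  next
    case 4 then show ?thesis using cross disjnt_sym by blast
  qed
qed

abbreviation shift_cols :: "nat \<Rightarrow> point \<Rightarrow> point"
  where "shift_cols k \<equiv> map_sum (\<lambda>i. k + i) (\<lambda>i. k + i)"

lemma tensor_part_in_partitions:
  assumes "p \<in> partitions k" "q \<in> partitions l"
  shows "tensor_part k p q \<in> partitions (k + l)"
proof -
  have inj: "inj_on (shift_cols k) (points l)" by (auto simp: inj_on_def points_def)
  have "partition_on (points k \<union> shift_cols k ` points l) (tensor_part k p q)"
    unfolding tensor_part_def
    by (intro partition_on_disjoint_union partition_on_image_blocks partitionsD assms inj)
      (auto simp: in_points_iff col_map_sum)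
  moreover have "points k \<union> shift_cols k ` points l = points (k + l)"
  proof (intro equalityI subsetI)
    fix a assume a: "a \<in> points (k + l)"
    show "a \<in> points k \<union> shift_cols k ` points l"
    proof (cases "col a \<le> k")
      case True then show ?thesis using a by (simp add: in_points_iff)
    next
      case False
      have "a \<in> shift_cols k ` points l"
      proof (cases a)
        case (Inl i) then show ?thesis using False a by (intro image_eqI[of _ _ "Inl (i - k)"]) auto
      next
        case (Inr i) then show ?thesis using False a by (intro image_eqI[of _ _ "Inr (i - k)"]) auto
      qed
      then show ?thesis by blast
    qed
  qed (auto simp: in_points_iff col_map_sum)
  ultimately show ?thesis by (simp add: partitions_def)
qed

lemma joined_tensor_part:
  "joined (tensor_part k p q) x y \<longleftrightarrow>
    joined p x y \<or> (\<exists>a b. x = shift_cols k a \<and> y = shift_cols k b \<and> joined q a b)"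
proof -
  have "joined (tensor_part k p q) x y \<longleftrightarrow> joined p x y \<or> joined ((`) (shift_cols k) ` q) x y"
    unfolding tensor_part_def joined_def by (rule bex_Un)
  then show ?thesis by (simp add: joined_image_blocks)
qed

lemma joined_tensor_part_left:
  assumes q: "q \<in> partitions l" and a: "a \<in> points k"
  shows "joined (tensor_part k p q) a b \<longleftrightarrow> joined p a b"
proof -
  have "\<not> (a = shift_cols k c \<and> joined q c d)" for c d
    using joined_in[OF partitionsD[OF q], of c d] a by (auto simp: in_points_iff col_map_sum)
  then show ?thesis unfolding joined_tensor_part by blast
qed

lemma inj_shift_cols: "inj (shift_cols k)"
  by (rule sum.inj_map) (auto simp: inj_on_def)

lemma joined_tensor_part_right:
  assumes p: "p \<in> partitions k" and a: "a \<in> points l"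
  shows "joined (tensor_part k p q) (shift_cols k a) (shift_cols k b) \<longleftrightarrow> joined q a b"
proof -
  have "\<not> joined p (shift_cols k a) c" for c
    using joined_in[OF partitionsD[OF p], of "shift_cols k a" c] a by (auto simp: in_points_iff col_map_sum)
  then show ?thesis unfolding joined_tensor_part using injD[OF inj_shift_cols] by blast
qed

lemma inactive_tensor_right:
  assumes "{Inl i, Inr i} \<in> q"
  shows "{Inl (k + i), Inr (k + i)} \<in> tensor_part k p q"
  unfolding tensor_part_def using assms by (intro UnI2 image_eqI[of _ _ "{Inl i, Inr i}"]) auto

lemma embeds_tensor_left:
  assumes p: "p \<in> partitions k"
  shows "embeds id k p (k + l) (tensor_part k p (id_part l))"
  unfolding embeds_def
proof (intro conjI ballI)
  note t = tensor_part_in_partitions[OF p id_part_in_partitions]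
  show "tensor_part k p (id_part l) \<in> partitions (k + l)" by (rule t)
  show "active (k + l) (tensor_part k p (id_part l)) \<subseteq> id ` {1..k}"
  proof
    fix i assume i: "i \<in> active (k + l) (tensor_part k p (id_part l))"
    show "i \<in> id ` {1..k}"
    proof (rule ccontr)
      assume "i \<notin> id ` {1..k}"
      then have "i - k \<in> {1..l}" "k + (i - k) = i" using i by (auto simp: active_def)
      then have "{Inl i, Inr i} \<in> tensor_part k p (id_part l)"
        using inactive_tensor_right[of "i - k" "id_part l" k p] by (simp add: id_part_def)
      then show False using i by (simp add: active_def)
    qed
  qed
  fix a b assume "a \<in> points k" "b \<in> points k"
  then show "joined (tensor_part k p (id_part l)) (map_sum id id a) (map_sum id id b) = joined p a b"
    using joined_tensor_part_left[OF id_part_in_partitions] by (simp add: map_sum.id)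
qed (use p in auto)

lemma embeds_tensor_right:
  assumes q: "q \<in> partitions l"
  shows "embeds (\<lambda>i. k + i) l q (k + l) (tensor_part k (id_part k) q)"
  unfolding embeds_def
proof (intro conjI ballI)
  show "tensor_part k (id_part k) q \<in> partitions (k + l)"
    by (rule tensor_part_in_partitions[OF id_part_in_partitions q])
  show "active (k + l) (tensor_part k (id_part k) q) \<subseteq> (\<lambda>i. k + i) ` {1..l}"
  proof
    fix i assume i: "i \<in> active (k + l) (tensor_part k (id_part k) q)"
    have "\<not> i \<le> k"
    proof
      assume "i \<le> k"
      then have "{Inl i, Inr i} \<in> tensor_part k (id_part k) q"
        using i by (auto simp: active_def tensor_part_def id_part_def)
      then show False using i by (simp add: active_def)
    qed
    then show "i \<in> (\<lambda>i. k + i) ` {1..l}"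
      using i by (intro image_eqI[of _ _ "i - k"]) (auto simp: active_def)
  qed
  fix a b assume "a \<in> points l" "b \<in> points l"
  then show "joined (tensor_part k (id_part k) q) (shift_cols k a) (shift_cols k b) = joined q a b"
    by (intro joined_tensor_part_right[OF id_part_in_partitions])
qed (use q in \<open>auto simp: inj_on_def\<close>)

text \<open>Two identities add up their numbers of columns, and one identity factor is an embedding.
  If neither factor is an identity, both sides of the closed set \<open>{1..k}\<close> contain
  active columns, so they are not in one cycle and the value is 0.\<close>

lemma log_cumulant_value_tensor:
  assumes p: "p \<in> partitions k" and q: "q \<in> partitions l"
  shows "log_cumulant_value lam (k + l) (tensor_part k p q) =
    log_cumulant_value lam k p * (if q = id_part l then 1 else 0)
    + (if p = id_part k then 1 else 0) * log_cumulant_value lam l q"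
proof -
  let ?t = "tensor_part k p q"
  have t: "?t \<in> partitions (k + l)" by (rule tensor_part_in_partitions[OF p q])
  consider (ii) "p = id_part k" "q = id_part l" | (pi) "p \<noteq> id_part k" "q = id_part l"
    | (iq) "p = id_part k" "q \<noteq> id_part l" | (pq) "p \<noteq> id_part k" "q \<noteq> id_part l" by blast
  then show ?thesis
  proof cases
    case ii
    have "?t = id_part (k + l)"
      using embeds_id_part_iff[OF embeds_tensor_left[OF p, of l]] ii by simp
    then show ?thesis using ii by (simp add: log_cumulant_value_def)
  next
    case pi
    have "?t \<noteq> id_part (k + l)"
      using embeds_id_part_iff[OF embeds_tensor_left[OF p, of l]] pi by simp
    then show ?thesis using embeds_log_cumulant_value[OF embeds_tensor_left[OF p, of l]] pi by simp
  next
    case iq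
    have "?t \<noteq> id_part (k + l)"
      using embeds_id_part_iff[OF embeds_tensor_right[OF q, of k]] iq by simp
    then show ?thesis using embeds_log_cumulant_value[OF embeds_tensor_right[OF q, of k]] iq by simp
  next
    case pq
    obtain i where i: "i \<in> active k p" using active_empty_iff[OF p] pq by blast
    obtain j where j: "j \<in> active l q" using active_empty_iff[OF q] pq by blast
    have ik: "i \<in> {1..k}" and jl: "j \<in> {1..l}" using i j by (auto simp: active_def)
    have it: "i \<in> active (k + l) ?t"
    proof -
      have "joined ?t (Inl i) b \<longleftrightarrow> joined p (Inl i) b" for b
        by (rule joined_tensor_part_left[OF q]) (use ik in simp)
      then show ?thesis
        using active_iff[OF t, of i] active_iff[OF p ik] i ik by simp
    qed
    have jt: "k + j \<in> active (k + l) ?t"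
    proof -
      have J: "joined ?t (Inl (k + j)) (shift_cols k b) \<longleftrightarrow> joined q (Inl j) b" for b
        using joined_tensor_part_right[OF p, of "Inl j" l q b] jl by simp
      have "\<not> joined q (Inl j) (Inr j) \<or> (\<exists>b. joined q (Inl j) b \<and> col b \<noteq> j)"
        using active_iff[OF q jl] j by simp
      then have "\<not> joined ?t (Inl (k + j)) (Inr (k + j)) \<or> (\<exists>b. joined ?t (Inl (k + j)) b \<and> col b \<noteq> k + j)"
      proof
        assume "\<not> joined q (Inl j) (Inr j)"
        then show ?thesis using J[of "Inr j"] by simp
      next
        assume "\<exists>b. joined q (Inl j) b \<and> col b \<noteq> j"
        then obtain b where "joined q (Inl j) b" "col b \<noteq> j" by blast
        then have "joined ?t (Inl (k + j)) (shift_cols k b)" "col (shift_cols k b) \<noteq> k + j"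
          using J by (auto simp: col_map_sum)
        then show ?thesis by blast
      qed
      then show ?thesis using active_iff[OF t, of "k + j"] jl by simp
    qed
    have "closed_cols ?t {1..k}"
      unfolding closed_cols_def
    proof (intro allI impI)
      fix a b assume ab: "joined ?t a b" "col a \<in> {1..k}"
      then have "joined p a b" using joined_tensor_part_left[OF q, of a k p b] by (simp add: in_points_iff)
      then show "col b \<in> {1..k}" using joined_in[OF partitionsD[OF p]] by (auto simp: in_points_iff)
    qed
    then have "\<not> single_cycle ?t (active (k + l) ?t)"
      using it jt ik jl unfolding single_cycle_def by fastforce
    moreover have "?t \<noteq> id_part (k + l)" using active_empty_iff[OF t] it by blast
    ultimately show ?thesis using pq by (simp add: log_cumulant_value_def)
  qed
qed

section \<open>Permutations of columns and stabilisation\<close>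

lemma
  assumes p: "p \<in> partitions k" and \<pi>: "\<pi> permutes {1..k}"
  shows permute_columns_in_partitions: "permute_columns \<pi> p \<in> partitions k"
    and joined_permute_columns: "joined (permute_columns \<pi> p) (map_sum \<pi> \<pi> a) (map_sum \<pi> \<pi> b) \<longleftrightarrow> joined p a b"
proof -
  have inj: "inj (map_sum \<pi> \<pi>)" by (rule sum.inj_map) (use permutes_inj[OF \<pi>] in auto)
  have "partition_on (map_sum \<pi> \<pi> ` points k) (permute_columns \<pi> p)"
    unfolding permute_columns_def
    by (intro partition_on_image_blocks partitionsD p inj_on_subset[OF inj]) auto
  moreover have "map_sum \<pi> \<pi> ` points k = points k"
  proof (intro equalityI subsetI)
    fix a assume "a \<in> points k"
    then have a: "col a \<in> \<pi> ` {1..k}" using permutes_image[OF \<pi>] by (simp add: in_points_iff)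
    then obtain i where "i \<in> {1..k}" "col a = \<pi> i" by blast
    then show "a \<in> map_sum \<pi> \<pi> ` points k"
      by (cases a) (auto intro: image_eqI[of _ _ "Inl i"] image_eqI[of _ _ "Inr i"])
  next
    fix x assume "x \<in> map_sum \<pi> \<pi> ` points k"
    then obtain a where "a \<in> points k" "x = map_sum \<pi> \<pi> a" by blast
    then show "x \<in> points k"
      using permutes_in_image[OF \<pi>, of "col a"] by (simp add: in_points_iff col_map_sum)
  qed
  ultimately show "permute_columns \<pi> p \<in> partitions k" by (simp add: partitions_def)
  show "joined (permute_columns \<pi> p) (map_sum \<pi> \<pi> a) (map_sum \<pi> \<pi> b) \<longleftrightarrow> joined p a b"
    unfolding permute_columns_def joined_image_blocks using injD[OF inj] by blast
qed

lemma stabilizes_embeds: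
  assumes p': "p' \<in> partitions k'" and "stabilizes k p k' p'"
  obtains \<pi> where "embeds \<pi> k' p' k p"
proof -
  obtain l \<pi> where k: "k = k' + l" and \<pi>: "\<pi> permutes {1..k}"
    and p: "p = permute_columns \<pi> (tensor_part k' p' (id_part l))"
    using assms by (auto simp: stabilizes_def)
  let ?t = "tensor_part k' p' (id_part l)"
  have t: "?t \<in> partitions k" unfolding k by (rule tensor_part_in_partitions[OF p' id_part_in_partitions])
  have "embeds \<pi> k' p' k p"
    unfolding embeds_def
  proof (intro conjI ballI)
    show "inj_on \<pi> {1..k'}" using permutes_inj[OF \<pi>] by (rule inj_on_subset) simp
    have "\<pi> ` {1..k'} \<subseteq> \<pi> ` {1..k}" by (rule image_mono) (simp add: k)
    then show "\<pi> ` {1..k'} \<subseteq> {1..k}" by (simp only: permutes_image[OF \<pi>])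
    show "p \<in> partitions k" unfolding p by (rule permute_columns_in_partitions[OF t \<pi>])
    show "active k p \<subseteq> \<pi> ` {1..k'}"
    proof
      fix i assume i: "i \<in> active k p"
      then have "i \<in> \<pi> ` {1..k}" using permutes_image[OF \<pi>] by (simp add: active_def)
      then obtain j where j: "j \<in> {1..k}" "i = \<pi> j" by blast
      have "j \<in> {1..k'}"
      proof (rule ccontr)
        assume "j \<notin> {1..k'}"
        then have "j - k' \<in> {1..l}" "k' + (j - k') = j" using j(1) by (auto simp: k)
        then have "{Inl j, Inr j} \<in> ?t"
          using inactive_tensor_right[of "j - k'" "id_part l" k' p'] by (simp add: id_part_def)
        then have "{Inl i, Inr i} \<in> p"
          unfolding p permute_columns_def j(2) by (intro image_eqI[of _ _ "{Inl j, Inr j}"]) auto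
        then show False using i by (simp add: active_def)
      qed
      then show "i \<in> \<pi> ` {1..k'}" using j(2) by blast
    qed
    fix a b assume "a \<in> points k'" "b \<in> points k'"
    then show "joined p (map_sum \<pi> \<pi> a) (map_sum \<pi> \<pi> b) = joined p' a b"
      unfolding p joined_permute_columns[OF t \<pi>] by (intro joined_tensor_part_left[OF id_part_in_partitions])
  qed (rule p')
  then show ?thesis by (rule that)
qed

text \<open>Numbering the active columns from 1 and extending this to a permutation moves them to
  the front. What \<open>p\<close> does there is irreducible because the active columns are in one
  cycle, and the inactive rest is an identity.\<close>

lemma single_cycle_stabilizes:
  assumes p: "p \<in> partitions k" and ne: "p \<noteq> id_part k" and single: "single_cycle p (active k p)"
  obtains k' p' where "irreducible_part k' p'" "stabilizes k p k' p'"
proof -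
  note P = partitionsD[OF p]
  let ?A = "active k p"
  define k' where "k' = card ?A"
  have A: "?A \<subseteq> {1..k}" "?A \<noteq> {}" using active_empty_iff[OF p] ne by (auto simp: active_def)
  have k': "k' \<le> k" "k' \<ge> 1"
    using card_mono[OF _ A(1)] A(2) finite_active by (auto simp: k'_def Suc_le_eq card_gt_0_iff)
  obtain f where f: "bij_betw f {1..k'} ?A"
    using ex_bij_betw_nat_finite_1[OF finite_active] unfolding k'_def by blast
  obtain \<pi> where \<pi>: "\<pi> permutes {1..k}" and \<pi>f: "\<And>x. x \<in> {1..k'} \<Longrightarrow> \<pi> x = f x"
    by (rule permutes_extend_injection[of "{1..k}" "{1..k'}" f])
      (use f A k' in \<open>auto simp: bij_betw_def\<close>)
  have \<pi>A: "\<pi> ` {1..k'} = ?A" using f \<pi>f by (simp add: bij_betw_def)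
  let ?m = "map_sum \<pi> \<pi>"
  define p' where "p' = classes (points k') (\<lambda>a b. joined p (?m a) (?m b))"
  have m_pt: "?m a \<in> points k \<longleftrightarrow> a \<in> points k" for a
    using permutes_in_image[OF \<pi>] by (simp add: in_points_iff col_map_sum)
  have sub: "a \<in> points k" if "a \<in> points k'" for a using that k' by (simp add: in_points_iff)
  have R: "joined p (?m a) (?m a)" if "a \<in> points k'" for a
    using joined_refl[OF P] m_pt sub[OF that] by blast
  have p'_part: "partition_on (points k') p'"
    unfolding p'_def by (rule partition_on_classes(1), erule R, erule joined_sym, erule (1) joined_trans[OF P])
  have jp': "joined p' a b \<longleftrightarrow> a \<in> points k' \<and> b \<in> points k' \<and> joined p (?m a) (?m b)" for a b
    unfolding p'_def by (rule partition_on_classes(2), erule R, erule joined_sym, erule (1) joined_trans[OF P])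
  have p': "p' \<in> partitions k'" using p'_part by (simp add: partitions_def)
  have emb: "embeds \<pi> k' p' k p"
    unfolding embeds_def
    using p p' \<pi>A A jp' permutes_inj_on[OF \<pi>] by auto
  have irr: "irreducible_part k' p'"
    unfolding irreducible_iff using p' k' embeds_single_cycle[OF emb, of "{1..k'}"] single \<pi>A by simp
  let ?l = "k - k'"
  let ?t = "tensor_part k' p' (id_part ?l)"
  have t: "?t \<in> partitions k" using tensor_part_in_partitions[OF p' id_part_in_partitions, of ?l] k' by simp
  have col_A: "col (?m a) \<in> ?A \<longleftrightarrow> a \<in> points k'" if "a \<in> points k" for a
    using \<pi>A permutes_inj[OF \<pi>] unfolding \<pi>A[symmetric] in_points_iff col_map_sum
    by (simp only: inj_image_mem_iff)
  have "p = permute_columns \<pi> ?t"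
  proof (rule partition_eqI[OF P partitionsD[OF permute_columns_in_partitions[OF t \<pi>]]])
    fix x y
    have inv: "?m (map_sum (inv \<pi>) (inv \<pi>) z) = z" for z
      using permutes_inverses(1)[OF \<pi>] by (cases z) auto
    define a b where "a = map_sum (inv \<pi>) (inv \<pi>) x" and "b = map_sum (inv \<pi>) (inv \<pi>) y"
    have xy: "x = ?m a" "y = ?m b" using inv by (simp_all add: a_def b_def)
    have key: "joined p (?m a) (?m b) \<longleftrightarrow> joined ?t a b" if ab: "a \<in> points k" "b \<in> points k"
    proof (cases "a \<in> points k'")
      case True
      have "joined p (?m a) (?m b) \<Longrightarrow> b \<in> points k'"
      proof (rule ccontr)
        assume j: "joined p (?m a) (?m b)" and b: "b \<notin> points k'"
        then have "col (?m b) \<notin> ?A" using col_A ab by simp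
        then have "col (?m a) = col (?m b)"
          using joined_inactive[OF p, of "?m b" "?m a"] joined_sym[OF j] m_pt ab by simp
        then show False using col_A[OF ab(1)] True \<open>col (?m b) \<notin> ?A\<close> by simp
      qed
      then show ?thesis
        unfolding joined_tensor_part_left[OF id_part_in_partitions True] jp' using True by blast
    next
      case False
      then have "col (?m a) \<notin> ?A" using col_A ab by simp
      then have "joined p (?m a) (?m b) \<longleftrightarrow> col (?m b) = col (?m a)"
        using joined_inactive[OF p, of "?m a" "?m b"] m_pt ab by simp
      also have "\<dots> \<longleftrightarrow> col b = col a"
        unfolding col_map_sum using inj_eq[OF permutes_inj[OF \<pi>]] .
      also have "\<dots> \<longleftrightarrow> joined ?t a b"
      proof
        have "{Inl (col a), Inr (col a)} \<in> ?t"
        proof -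
          have "col a - k' \<in> {1..?l}" "k' + (col a - k') = col a"
            using False ab(1) by (auto simp: in_points_iff)
          then show ?thesis
            using inactive_tensor_right[of "col a - k'" "id_part ?l" k' p'] by (simp add: id_part_def)
        qed
        then have ia: "col a \<notin> active k ?t" by (simp add: active_def)
        show "joined ?t a b" if "col b = col a" using joined_inactive[OF t ab(1) ia] that ab by simp
        show "col b = col a" if "joined ?t a b" using joined_inactive[OF t ab(1) ia] that by simp
      qed
      finally show ?thesis .
    qed
    show "joined p x y = joined (permute_columns \<pi> ?t) x y"
      unfolding xy joined_permute_columns[OF t \<pi>]
      using key joined_in[OF P, of "?m a" "?m b"] joined_in[OF partitionsD[OF t], of a b]
        m_pt[of a] m_pt[of b] by blast
  qed
  moreover have "k = k' + ?l" using k' by simp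
  ultimately have "stabilizes k p k' p'" unfolding stabilizes_def using \<pi> by blast
  then show ?thesis using that irr by blast
qed

lemma Union_partition: "p \<in> partitions k \<Longrightarrow> \<Union>p = points k"
  by (simp add: partitions_def partition_on_def)

lemma columns_points: "columns (points k) = {1..k}"
  by (auto simp: columns_def)

text \<open>The definition ranges over identities of all sizes; a partition determines its number of
  columns, so only one size can match.\<close>

lemma eps_box_eq:
  assumes p: "p \<in> partitions k"
  shows "eps_box p = (if p = id_part k then 1 else 0)"
proof -
  have "j = k" if "p = id_part j" for j
  proof -
    have "points j = points k" using Union_partition[OF p] Union_partition[OF id_part_in_partitions] that by metis
    then have "{1..j} = {1..k}" by (metis columns_points)
    then show ?thesis by (metis card_atLeastAtMost diff_Suc_1)
  qed
  then show ?thesis unfolding eps_box_def by metis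
qed

theorem log_cumulant_value_infinitesimal_character:
  assumes E: "\<And>k p. p \<in> partitions k \<Longrightarrow> E p = of_real (log_cumulant_value lam k p)"
  shows "infinitesimal_character E"
  unfolding infinitesimal_character_def
proof (intro conjI allI ballI impI)
  fix k l p q assume p: "p \<in> partitions k" and q: "q \<in> partitions l"
  show "E (tensor_part k p q) = E p * eps_box q + eps_box p * E q"
    using log_cumulant_value_tensor[OF p q, of lam]
    by (simp add: E[OF tensor_part_in_partitions[OF p q]] E[OF p] E[OF q] eps_box_eq[OF p] eps_box_eq[OF q])
next
  fix k :: nat
  show "E (id_part k) = of_nat k * E (id_part 1)"
    by (simp add: E[OF id_part_in_partitions] log_cumulant_value_def)
next
  fix k k' p p'
  assume *: "p \<in> partitions k \<and> p \<noteq> id_part k \<and> irreducible_part k' p' \<and> stabilizes k p k' p'"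
  then have p': "p' \<in> partitions k'" by (simp add: irreducible_part_def)
  obtain \<pi> where emb: "embeds \<pi> k' p' k p" by (rule stabilizes_embeds[OF p']) (use * in blast)
  show "E p = E p'"
    using embeds_log_cumulant_value[OF emb] E[OF p'] E[of p k] * by simp
next
  fix k p
  assume *: "p \<in> partitions k \<and> p \<noteq> id_part k \<and> \<not> (\<exists>k' p'. irreducible_part k' p' \<and> stabilizes k p k' p')"
  then have "\<not> single_cycle p (active k p)" using single_cycle_stabilizes by metis
  then show "E p = 0" using * E[of p k] by (simp add: log_cumulant_value_def)
qed

section \<open>Necklaces and chains as labelled partitions\<close>

text \<open>The step count decreases along \<open>\<sigma>\<close> because in a necklace the points of \<open>b l\<close> are joined with
  the primed points of \<open>b (\<sigma> l)\<close>, so that \<open>\<sigma>\<close> runs against the positions of a labelling.\<close>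

definition steps_to :: "(nat \<Rightarrow> nat) \<Rightarrow> nat \<Rightarrow> nat \<Rightarrow> nat"
  where "steps_to \<sigma> i0 l = (LEAST n. (\<sigma> ^^ n) l = i0)"

context
  fixes \<sigma> :: "nat \<Rightarrow> nat" and s i0 :: nat
  assumes perm: "\<sigma> permutes {1..s}" and cyc: "cyclic_on \<sigma> {1..s}" and i0: "i0 \<in> {1..s}"
begin

private abbreviation (input) "pos \<equiv> steps_to \<sigma> i0"

lemma funpow_steps_to:
  assumes "l \<in> {1..s}"
  shows "(\<sigma> ^^ steps_to \<sigma> i0 l) l = i0"
proof -
  have "i0 \<in> orbit \<sigma> l" using cyc i0 assms by (simp add: cyclic_on_alldef)
  then obtain n where "(\<sigma> ^^ n) l = i0" unfolding orbit_altdef by auto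
  then show ?thesis unfolding steps_to_def by (rule LeastI)
qed

lemma steps_to_self: "steps_to \<sigma> i0 i0 = 0"
  unfolding steps_to_def by (rule Least_eq_0) simp

lemma steps_to_Suc:
  assumes "l \<in> {1..s}" "l \<noteq> i0"
  shows "steps_to \<sigma> i0 l = Suc (steps_to \<sigma> i0 (\<sigma> l))"
proof -
  have "(LEAST n. (\<sigma> ^^ n) l = i0) = Suc (LEAST m. (\<sigma> ^^ Suc m) l = i0)"
    by (rule Least_Suc[of _ "steps_to \<sigma> i0 l"]) (use funpow_steps_to[OF assms(1)] assms(2) in auto)
  then show ?thesis unfolding steps_to_def by (simp add: funpow_swap1)
qed

lemma steps_to_inj: "inj_on (steps_to \<sigma> i0) {1..s}"
proof (rule inj_onI)
  fix l l' assume "l \<in> {1..s}" "l' \<in> {1..s}" "steps_to \<sigma> i0 l = steps_to \<sigma> i0 l'"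
  then have "(\<sigma> ^^ steps_to \<sigma> i0 l) l = (\<sigma> ^^ steps_to \<sigma> i0 l) l'"
    using funpow_steps_to by metis
  then show "l = l'" using inj_fn[OF permutes_inj[OF perm]] by (auto dest: injD)
qed

text \<open>The step counts are distinct. Since \<sigma> lowers a positive count by one, they are
  also closed downwards, so they fill an initial segment with \<open>s\<close> elements.\<close>

lemma steps_to_image: "steps_to \<sigma> i0 ` {1..s} = {0..<s}"
proof (rule card_subset_eq)
  have down: "m \<in> pos ` {1..s}" if "n \<in> pos ` {1..s}" "m \<le> n" for m n
    using that(2,1)
  proof (induction rule: inc_induct)
    case (step m)
    then obtain l where l: "l \<in> {1..s}" "Suc m = pos l" by auto
    then have "l \<noteq> i0" using steps_to_self by auto
    then have "m = pos (\<sigma> l)" using steps_to_Suc l by simp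
    then show ?case using l(1) permutes_in_image[OF perm] by blast
  qed
  show "pos ` {1..s} \<subseteq> {0..<s}"
  proof
    fix n assume n: "n \<in> pos ` {1..s}"
    have "{0..n} \<subseteq> pos ` {1..s}"
    proof
      fix m assume "m \<in> {0..n}"
      then show "m \<in> pos ` {1..s}" by (intro down[OF n]) simp
    qed
    then have "card {0..n} \<le> card (pos ` {1..s})" by (intro card_mono) auto
    then show "n \<in> {0..<s}" using card_image[OF steps_to_inj] by simp
  qed
  show "card (pos ` {1..s}) = card {0..<s}" using card_image[OF steps_to_inj] by simp
qed simp

text \<open>The largest count \<open>s - 1\<close> is attained at some point. A preimage of it other
  than \<open>i0\<close> would have the count \<open>s\<close>.\<close>

lemma steps_to_image_i0: "steps_to \<sigma> i0 (\<sigma> i0) = s - 1"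
proof -
  have "s - 1 \<in> pos ` {1..s}" unfolding steps_to_image using i0 by auto
  then obtain l where l: "l \<in> {1..s}" "pos l = s - 1" by auto
  obtain l' where l': "l' \<in> {1..s}" "l = \<sigma> l'" using permutes_image[OF perm] l(1) by blast
  have "l' = i0"
  proof (rule ccontr)
    assume "l' \<noteq> i0"
    then have "pos l' = s" using steps_to_Suc[OF l'(1)] l l' i0 by simp
    moreover have "pos l' \<in> {0..<s}" using steps_to_image l'(1) by blast
    ultimately show False by simp
  qed
  then show ?thesis using l l' by simp
qed

lemma steps_to_chain:
  assumes "l \<in> {1..s}" "l' \<in> {1..s}"
  shows "steps_to \<sigma> i0 l = Suc (steps_to \<sigma> i0 l') \<longleftrightarrow> l \<noteq> i0 \<and> l' = \<sigma> l"
proof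
  assume eq: "pos l = Suc (pos l')"
  then have ne: "l \<noteq> i0" using steps_to_self by auto
  then have "pos l' = pos (\<sigma> l)" using eq steps_to_Suc[OF assms(1)] by simp
  moreover have "\<sigma> l \<in> {1..s}" using permutes_in_image[OF perm] assms(1) by blast
  ultimately show "l \<noteq> i0 \<and> l' = \<sigma> l" using ne inj_onD[OF steps_to_inj] assms(2) by blast
qed (use steps_to_Suc assms in auto)

lemma steps_to_necklace:
  assumes "l \<in> {1..s}" "l' \<in> {1..s}"
  shows "steps_to \<sigma> i0 l = Suc (steps_to \<sigma> i0 l') mod s \<longleftrightarrow> l' = \<sigma> l"
proof -
  have less: "pos x < s" if "x \<in> {1..s}" for x using steps_to_image that by fastforce
  have \<sigma>l: "\<sigma> l \<in> {1..s}" using permutes_in_image[OF perm] assms(1) by blast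
  have eq: "pos l = Suc (pos (\<sigma> l)) mod s"
  proof (cases "l = i0")
    case True
    then show ?thesis using steps_to_self steps_to_image_i0 i0 by simp
  next
    case False
    then show ?thesis using steps_to_Suc[OF assms(1)] less[OF assms(1)] by simp
  qed
  have "pos l' = pos (\<sigma> l)" if "Suc (pos (\<sigma> l)) mod s = Suc (pos l') mod s"
    using that less[OF assms(2)] less[OF \<sigma>l] by (auto simp: mod_Suc split: if_splits)
  then have "l' = \<sigma> l" if "pos l = Suc (pos l') mod s"
    using that eq inj_onD[OF steps_to_inj _ assms(2) \<sigma>l] by simp
  then show ?thesis using eq by blast
qed

end

text \<open>The standard cycle run backwards. If \<open>b l\<close> holds the columns at position
  \<open>l - 1\<close>, then its block must contain the primed columns one position earlier, that
  is, those of \<open>b (l - 1)\<close>.\<close>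

definition pred_cycle :: "nat \<Rightarrow> nat \<Rightarrow> nat"
  where "pred_cycle s l = (if l \<in> {1..s} then if l = 1 then s else l - 1 else l)"

lemma pred_cycle_permutes:
  shows "pred_cycle s permutes {1..s}"
proof (rule bij_imp_permutes)
  have inj: "inj_on (pred_cycle s) {1..s}" by (auto simp: inj_on_def pred_cycle_def split: if_splits)
  moreover have "pred_cycle s ` {1..s} \<subseteq> {1..s}" by (auto simp: pred_cycle_def)
  ultimately show "bij_betw (pred_cycle s) {1..s} {1..s}"
    by (simp add: bij_betw_def endo_inj_surj)
next
  fix l assume "l \<notin> {1..s}"
  then show "pred_cycle s l = l" unfolding pred_cycle_def by (rule if_not_P)
qed

lemma pred_cycle_cyclic:
  assumes "s \<ge> 1"
  shows "cyclic_on (pred_cycle s) {1..s}"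
proof -
  have pow: "(pred_cycle s ^^ n) s = s - n" if "n < s" for n
    using that by (induction n) (auto simp: pred_cycle_def)
  have "{1..s} = orbit (pred_cycle s) s"
  proof (intro equalityI subsetI)
    fix l assume l: "l \<in> {1..s}"
    show "l \<in> orbit (pred_cycle s) s"
    proof (cases "l = s")
      case False
      then have "l = (pred_cycle s ^^ (s - l)) s" "0 < s - l" using pow[of "s - l"] l by auto
      then show ?thesis unfolding orbit_altdef by blast
    next
      case True
      \<comment> \<open>Membership in an orbit asks for a positive number of steps, so
        \<open>s\<close> itself is reached by a full turn.\<close>
      have "(pred_cycle s ^^ Suc (s - 1)) s = pred_cycle s ((pred_cycle s ^^ (s - 1)) s)"
        by (simp only: funpow.simps comp_apply)
      then have "(pred_cycle s ^^ Suc (s - 1)) s = s" using pow[of "s - 1"] assms by (simp add: pred_cycle_def)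
      then show ?thesis unfolding orbit_altdef True by (metis (mono_tags, lifting) mem_Collect_eq zero_less_Suc)
    qed
  next
    fix l assume "l \<in> orbit (pred_cycle s) s"
    then show "l \<in> {1..s}"
      using permutes_orbit_subset[OF pred_cycle_permutes, of s s] assms by auto
  qed
  moreover have "s \<in> {1..s}" using assms by simp
  ultimately show ?thesis unfolding cyclic_on_def by (rule bexI)
qed

context
  fixes k s :: nat and b :: "nat \<Rightarrow> nat set" and \<sigma> :: "nat \<Rightarrow> nat"
  assumes data: "necklace_data k s b \<sigma>"
begin

definition bead :: "nat \<Rightarrow> nat"
  where "bead i = (SOME l. l \<in> {1..s} \<and> i \<in> b l)"

private lemma data_props: "inj_on b {1..s}" "partition_on {1..k} (b ` {1..s})" "\<sigma> permutes {1..s}" "cyclic_on \<sigma> {1..s}"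
  using data by (auto simp: necklace_data_def)

lemma bead_in: "i \<in> {1..k} \<Longrightarrow> bead i \<in> {1..s} \<and> i \<in> b (bead i)"
proof -
  assume "i \<in> {1..k}"
  then have "i \<in> \<Union>(b ` {1..s})" using data_props(2) by (simp add: partition_on_def)
  then have "\<exists>l. l \<in> {1..s} \<and> i \<in> b l" by blast
  then show ?thesis unfolding bead_def by (rule someI_ex)
qed

lemma in_bead_iff:
  assumes "i \<in> {1..k}" "l \<in> {1..s}"
  shows "i \<in> b l \<longleftrightarrow> bead i = l"
proof
  assume "i \<in> b l"
  then have "b (bead i) = b l"
    using block_eqI[OF data_props(2), of "b (bead i)" "b l" i] bead_in[OF assms(1)] assms(2) by blast
  then show "bead i = l" using inj_onD[OF data_props(1)] bead_in[OF assms(1)] assms(2) by blast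
qed (use bead_in[OF assms(1)] in blast)

lemma bead_image: "bead ` {1..k} = {1..s}"
proof (intro equalityI subsetI)
  fix l assume l: "l \<in> {1..s}"
  then have "b l \<noteq> {}" "b l \<subseteq> {1..k}" using data_props(2) by (auto simp: partition_on_def)
  then obtain i where i: "i \<in> {1..k}" "i \<in> b l" by blast
  then have "bead i = l" using in_bead_iff[OF i(1) l] by simp
  then show "l \<in> bead ` {1..k}" using i(1) by blast
qed (use bead_in in auto)

lemma sigma_in: "l \<in> {1..s} \<Longrightarrow> \<sigma> l \<in> {1..s}"
  using permutes_in_image[OF data_props(3)] by blast

lemma bead_sigma: "j \<in> {1..k} \<Longrightarrow> l \<in> {1..s} \<Longrightarrow> j \<in> b (\<sigma> l) \<longleftrightarrow> bead j = \<sigma> l"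
  using in_bead_iff sigma_in by blast

lemma bead_preimage: "j \<in> {1..k} \<Longrightarrow> \<exists>l\<in>{1..s}. bead j = \<sigma> l"
  using bead_in permutes_image[OF data_props(3)] by blast

lemma joined_necklace:
  assumes ij: "i \<in> {1..k}" "j \<in> {1..k}"
  defines "p \<equiv> necklace_block b \<sigma> ` {1..s}"
  shows "joined p (Inl i) (Inl j) \<longleftrightarrow> bead i = bead j"
    and "joined p (Inr i) (Inr j) \<longleftrightarrow> bead i = bead j"
    and "joined p (Inl i) (Inr j) \<longleftrightarrow> bead j = \<sigma> (bead i)"
proof -
  have "joined p (Inl i) (Inl j) \<longleftrightarrow> (\<exists>l\<in>{1..s}. i \<in> b l \<and> j \<in> b l)"
    by (auto simp: joined_def p_def necklace_block_def)
  also have "\<dots> \<longleftrightarrow> bead i = bead j" using in_bead_iff ij bead_in[OF ij(1)] by metis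
  finally show "joined p (Inl i) (Inl j) \<longleftrightarrow> bead i = bead j" .
  have "joined p (Inr i) (Inr j) \<longleftrightarrow> (\<exists>l\<in>{1..s}. i \<in> b (\<sigma> l) \<and> j \<in> b (\<sigma> l))"
    by (auto simp: joined_def p_def necklace_block_def)
  also have "\<dots> \<longleftrightarrow> bead i = bead j" using bead_sigma ij bead_preimage[OF ij(1)] by metis
  finally show "joined p (Inr i) (Inr j) \<longleftrightarrow> bead i = bead j" .
  have "joined p (Inl i) (Inr j) \<longleftrightarrow> (\<exists>l\<in>{1..s}. i \<in> b l \<and> j \<in> b (\<sigma> l))"
    by (auto simp: joined_def p_def necklace_block_def)
  also have "\<dots> \<longleftrightarrow> bead j = \<sigma> (bead i)" using bead_sigma in_bead_iff ij bead_in[OF ij(1)] by metis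
  finally show "joined p (Inl i) (Inr j) \<longleftrightarrow> bead j = \<sigma> (bead i)" .
qed

lemma joined_chain:
  assumes ij: "i \<in> {1..k}" "j \<in> {1..k}" and i0: "i0 \<in> {1..s}"
  defines "p \<equiv> necklace_block b \<sigma> ` ({1..s} - {i0}) \<union> {Inl ` b i0, Inr ` b (\<sigma> i0)}"
  shows "joined p (Inl i) (Inl j) \<longleftrightarrow> bead i = bead j"
    and "joined p (Inr i) (Inr j) \<longleftrightarrow> bead i = bead j"
    and "joined p (Inl i) (Inr j) \<longleftrightarrow> bead i \<noteq> i0 \<and> bead j = \<sigma> (bead i)"
proof -
  have "joined p (Inl i) (Inl j) \<longleftrightarrow> (\<exists>l\<in>{1..s}. i \<in> b l \<and> j \<in> b l)"
    using i0 by (auto simp: joined_def p_def necklace_block_def)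
  also have "\<dots> \<longleftrightarrow> bead i = bead j" using in_bead_iff ij bead_in[OF ij(1)] by metis
  finally show "joined p (Inl i) (Inl j) \<longleftrightarrow> bead i = bead j" .
  have "joined p (Inr i) (Inr j) \<longleftrightarrow> (\<exists>l\<in>{1..s}. i \<in> b (\<sigma> l) \<and> j \<in> b (\<sigma> l))"
    using i0 by (auto simp: joined_def p_def necklace_block_def)
  also have "\<dots> \<longleftrightarrow> bead i = bead j" using bead_sigma ij bead_preimage[OF ij(1)] by metis
  finally show "joined p (Inr i) (Inr j) \<longleftrightarrow> bead i = bead j" .
  have "joined p (Inl i) (Inr j) \<longleftrightarrow> (\<exists>l\<in>{1..s}. l \<noteq> i0 \<and> i \<in> b l \<and> j \<in> b (\<sigma> l))"
    by (auto simp: joined_def p_def necklace_block_def)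
  also have "\<dots> \<longleftrightarrow> bead i \<noteq> i0 \<and> bead j = \<sigma> (bead i)" using bead_sigma in_bead_iff ij bead_in[OF ij(1)] by metis
  finally show "joined p (Inl i) (Inr j) \<longleftrightarrow> bead i \<noteq> i0 \<and> bead j = \<sigma> (bead i)" .
qed

lemma data_nonempty: "s \<ge> 1"
  using data_props(4) by (auto simp: cyclic_on_def)

lemma steps_bead_eq:
  assumes "i \<in> {1..k}" "j \<in> {1..k}" "i0 \<in> {1..s}"
  shows "steps_to \<sigma> i0 (bead i) = steps_to \<sigma> i0 (bead j) \<longleftrightarrow> bead i = bead j"
  using inj_on_eq_iff[OF steps_to_inj[OF data_props(3,4) assms(3)]] bead_in assms by blast

lemma steps_bead_image: "i0 \<in> {1..s} \<Longrightarrow> (\<lambda>i. steps_to \<sigma> i0 (bead i)) ` {1..k} = {0..<s}"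
  using steps_to_image[OF data_props(3,4)] bead_image by (metis image_image)

lemma necklace_data_like:
  "necklace_like (necklace_block b \<sigma> ` {1..s}) {1..k} s"
proof -
  have i0: "1 \<in> {1..s}" using data_nonempty by simp
  have "labelling (\<lambda>x. Suc x mod s) (necklace_block b \<sigma> ` {1..s}) {1..k} s (\<lambda>i. steps_to \<sigma> 1 (bead i))"
    unfolding labelling_def
    using data_nonempty steps_bead_image[OF i0] steps_bead_eq[OF _ _ i0] joined_necklace bead_in
      steps_to_necklace[OF data_props(3,4) i0] by simp
  then show ?thesis by (auto simp: necklace_like_def)
qed

text \<open>The positions are counted from the cut bead: its unprimed points lose their primed
  partners, just as position 0 of a labelling has no predecessor. For a necklace any bead can serve
  as origin.\<close>

lemma chain_data_like:
  assumes i0: "i0 \<in> {1..s}"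
  shows "chain_like (necklace_block b \<sigma> ` ({1..s} - {i0}) \<union> {Inl ` b i0, Inr ` b (\<sigma> i0)}) {1..k} s"
proof -
  have "labelling Suc (necklace_block b \<sigma> ` ({1..s} - {i0}) \<union> {Inl ` b i0, Inr ` b (\<sigma> i0)}) {1..k} s
      (\<lambda>i. steps_to \<sigma> i0 (bead i))"
    unfolding labelling_def
    using data_nonempty steps_bead_image[OF i0] steps_bead_eq[OF _ _ i0] joined_chain[OF _ _ i0] bead_in
      steps_to_chain[OF data_props(3,4) i0] by simp
  then show ?thesis by (auto simp: chain_like_def)
qed

end

text \<open>The fibres of a labelling, with positions starting at 0 and classes at 1; hence the
  shift \<open>l - 1\<close>.\<close>

lemma labelled_blocks:
  fixes h :: "nat \<Rightarrow> nat"
  assumes hk: "h ` {1..k} = {0..<s}" and s: "s \<ge> 1"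
  defines "b \<equiv> \<lambda>l. {i \<in> {1..k}. h i = l - 1}"
  shows "necklace_data k s b (pred_cycle s)"
proof -
  have ne: "b l \<noteq> {}" if "l \<in> {1..s}" for l
  proof -
    have "l - 1 \<in> h ` {1..k}" unfolding hk using that by auto
    then show ?thesis by (auto simp: b_def)
  qed
  have inj: "inj_on b {1..s}"
  proof (rule inj_onI)
    fix l l' assume l: "l \<in> {1..s}" "l' \<in> {1..s}" "b l = b l'"
    then obtain i where "i \<in> b l" "i \<in> b l'" using ne by blast
    then show "l = l'" using l by (auto simp: b_def)
  qed
  have "partition_on {1..k} (b ` {1..s})"
  proof (rule partition_onI)
    show "\<Union>(b ` {1..s}) = {1..k}"
    proof (intro equalityI subsetI)
      fix i assume i: "i \<in> {1..k}"
      then have "h i < s" using hk by fastforce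
      then have "i \<in> b (Suc (h i))" "Suc (h i) \<in> {1..s}" using i by (auto simp: b_def)
      then show "i \<in> \<Union>(b ` {1..s})" by blast
    qed (auto simp: b_def)
    show "{} \<notin> b ` {1..s}" using ne by blast
    fix X Y assume "X \<in> b ` {1..s}" "Y \<in> b ` {1..s}" "X \<noteq> Y"
    then obtain l l' where "X = b l" "Y = b l'" "l \<in> {1..s}" "l' \<in> {1..s}" "l \<noteq> l'" by blast
    then show "disjnt X Y" by (auto simp: disjnt_def b_def)
  qed
  then show ?thesis
    unfolding necklace_data_def using inj pred_cycle_permutes pred_cycle_cyclic[OF s] by blast
qed

lemma partition_on_necklace:
  assumes data: "necklace_data k s b \<sigma>"
  shows "partition_on (points k) (necklace_block b \<sigma> ` {1..s})"
    and "i0 \<in> {1..s} \<Longrightarrow> partition_on (points k)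
      (necklace_block b \<sigma> ` ({1..s} - {i0}) \<union> {Inl ` b i0, Inr ` b (\<sigma> i0)})"
proof -
  have inj: "inj_on b {1..s}" and part: "partition_on {1..k} (b ` {1..s})" and perm: "\<sigma> permutes {1..s}"
    using data by (auto simp: necklace_data_def)
  have \<sigma>_in: "\<sigma> l \<in> {1..s}" if "l \<in> {1..s}" for l using permutes_in_image[OF perm] that by blast
  have disj: "b l \<inter> b l' = {}" if "l \<in> {1..s}" "l' \<in> {1..s}" "l \<noteq> l'" for l l'
    using block_eqI[OF part, of "b l" "b l'"] inj_onD[OF inj] that by blast
  have \<sigma>_ne: "\<sigma> l \<noteq> \<sigma> l'" if "l \<noteq> l'" for l l' using permutes_inj[OF perm] that by (auto dest: injD)
  have ne: "b l \<noteq> {}" if "l \<in> {1..s}" for l using partition_onD3[OF part] that by force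
  have U1: "(\<Union>l\<in>{1..s}. b l) = {1..k}" using part by (simp add: partition_on_def)
  have U2: "(\<Union>l\<in>{1..s}. b (\<sigma> l)) = {1..k}"
  proof -
    have "(\<Union>l\<in>{1..s}. b (\<sigma> l)) = (\<Union>l\<in>\<sigma> ` {1..s}. b l)" by blast
    then show ?thesis by (simp only: U1 permutes_image[OF perm])
  qed
  have d: "disjnt (necklace_block b \<sigma> l) (necklace_block b \<sigma> l')"
    if "l \<in> {1..s}" "l' \<in> {1..s}" "l \<noteq> l'" for l l'
    using disj[OF that] disj[OF \<sigma>_in[OF that(1)] \<sigma>_in[OF that(2)] \<sigma>_ne[OF that(3)]]
    by (auto simp: disjnt_def necklace_block_def)
  have UN: "\<Union>(necklace_block b \<sigma> ` {1..s}) = points k"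
  proof -
    have "\<Union>(necklace_block b \<sigma> ` {1..s}) = Inl ` (\<Union>l\<in>{1..s}. b l) \<union> Inr ` (\<Union>l\<in>{1..s}. b (\<sigma> l))"
      unfolding necklace_block_def by blast
    then show ?thesis unfolding U1 U2 by (simp add: points_def Plus_def)
  qed
  show "partition_on (points k) (necklace_block b \<sigma> ` {1..s})"
  proof (rule partition_onI[OF UN])
    show "{} \<notin> necklace_block b \<sigma> ` {1..s}" using ne by (auto simp: necklace_block_def)
  qed (use d in blast)
  assume i0: "i0 \<in> {1..s}"
  show "partition_on (points k) (necklace_block b \<sigma> ` ({1..s} - {i0}) \<union> {Inl ` b i0, Inr ` b (\<sigma> i0)})"
  proof (rule partition_onI)
    have "\<Union>(necklace_block b \<sigma> ` ({1..s} - {i0}) \<union> {Inl ` b i0, Inr ` b (\<sigma> i0)})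
        = \<Union>(necklace_block b \<sigma> ` ({1..s} - {i0})) \<union> necklace_block b \<sigma> i0"
      by (auto simp: necklace_block_def)
    also have "\<dots> = \<Union>(necklace_block b \<sigma> ` {1..s})" using i0 by blast
    finally show "\<Union>(necklace_block b \<sigma> ` ({1..s} - {i0}) \<union> {Inl ` b i0, Inr ` b (\<sigma> i0)}) = points k"
      using UN by simp
    show "{} \<notin> necklace_block b \<sigma> ` ({1..s} - {i0}) \<union> {Inl ` b i0, Inr ` b (\<sigma> i0)}"
      using ne i0 \<sigma>_in by (auto simp: necklace_block_def)
    have d0: "disjnt (necklace_block b \<sigma> l) (Inl ` b i0)" "disjnt (necklace_block b \<sigma> l) (Inr ` b (\<sigma> i0))"
      if "l \<in> {1..s} - {i0}" for l
      using d[of l i0] that i0 by (auto simp: disjnt_def necklace_block_def)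
    have d1: "disjnt (Inl ` b i0 :: point set) (Inr ` b (\<sigma> i0))" by (auto simp: disjnt_def)
    define Z where "Z = necklace_block b \<sigma> ` ({1..s} - {i0})"
    fix X Y assume XY: "X \<in> necklace_block b \<sigma> ` ({1..s} - {i0}) \<union> {Inl ` b i0, Inr ` b (\<sigma> i0)}"
      "Y \<in> necklace_block b \<sigma> ` ({1..s} - {i0}) \<union> {Inl ` b i0, Inr ` b (\<sigma> i0)}" "X \<noteq> Y"
    have "X \<in> Z \<or> X = Inl ` b i0 \<or> X = Inr ` b (\<sigma> i0)" "Y \<in> Z \<or> Y = Inl ` b i0 \<or> Y = Inr ` b (\<sigma> i0)"
      using XY(1,2) unfolding Z_def[symmetric] by blast+
    then consider "X \<in> Z" "Y \<in> Z" | "X \<in> Z" "Y = Inl ` b i0 \<or> Y = Inr ` b (\<sigma> i0)"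
      | "X = Inl ` b i0 \<or> X = Inr ` b (\<sigma> i0)" "Y \<in> Z"
      | "X = Inl ` b i0" "Y = Inr ` b (\<sigma> i0)" | "X = Inr ` b (\<sigma> i0)" "Y = Inl ` b i0"
      using XY(3) by metis
    then show "disjnt X Y"
    proof cases
      case 1
      then obtain l l' where "X = necklace_block b \<sigma> l" "Y = necklace_block b \<sigma> l'" "l \<in> {1..s}" "l' \<in> {1..s}"
        unfolding Z_def by blast
      then show ?thesis using d[of l l'] XY(3) by blast
    next
      case 2
      then obtain l where "X = necklace_block b \<sigma> l" "l \<in> {1..s} - {i0}" unfolding Z_def by blast
      then show ?thesis using d0[of l] 2(2) by blast
    next
      case 3
      then obtain l where "Y = necklace_block b \<sigma> l" "l \<in> {1..s} - {i0}" unfolding Z_def by blast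
      then have "disjnt Y X" using d0[of l] 3(1) by blast
      then show ?thesis by (rule disjnt_sym)
    next
      case 4 then show ?thesis using d1 by simp
    next
      case 5 then show ?thesis using disjnt_sym[OF d1] by simp
    qed
  qed
qed

text \<open>A labelling of all columns prescribes \<open>joined\<close> for every pair of points,
  the pairs of a primed and an unprimed point being covered by symmetry.\<close>

lemma labelling_partition_eqI:
  assumes p: "p \<in> partitions k" and q: "partition_on (points k) q"
    and p_lab: "labelling step p {1..k} s h" and q_lab: "labelling step q {1..k} s h"
  shows "p = q"
proof (rule partition_eqI[OF partitionsD[OF p] q])
  fix a b
  have same: "joined p a b = joined q a b" if ab: "a \<in> points k" "b \<in> points k"
  proof (cases a; cases b)
    fix i j assume "a = Inr i" "b = Inl j"
    then show ?thesis
      using p_lab q_lab ab joined_commute[of p a b] joined_commute[of q a b] by (simp add: labelling_def)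
  qed (use p_lab q_lab ab in \<open>simp_all add: labelling_def\<close>)
  then show "joined p a b = joined q a b"
    using joined_in[OF partitionsD[OF p], of a b] joined_in[OF q, of a b] by blast
qed

lemma labelled_bead:
  assumes hk: "h ` {1..k} = {0..<s}" and s: "s \<ge> 1" and i: "i \<in> {1..k}"
  shows "bead s (\<lambda>l. {i \<in> {1..k}. h i = l - 1}) i = Suc (h i)"
proof -
  note data = labelled_blocks[OF hk s]
  have "h i < s" using hk i by fastforce
  then have "Suc (h i) \<in> {1..s}" by simp
  then show ?thesis using in_bead_iff[OF data i, of "Suc (h i)"] i by simp
qed

text \<open>The empty necklace has length 0 and no labelling, so \<open>k \<ge> 1\<close> is
  required.\<close>

lemma necklace_iff:
  assumes p: "p \<in> partitions k" and k: "k \<ge> 1"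
  shows "necklace k p s \<longleftrightarrow> necklace_like p {1..k} s"
proof
  assume "necklace k p s"
  then obtain b \<sigma> where "necklace_data k s b \<sigma>" "p = necklace_block b \<sigma> ` {1..s}"
    using k by (auto simp: necklace_def)
  then show "necklace_like p {1..k} s" using necklace_data_like by simp
next
  assume "necklace_like p {1..k} s"
  then obtain h where h: "labelling (\<lambda>x. Suc x mod s) p {1..k} s h" by (auto simp: necklace_like_def)
  then have hk: "h ` {1..k} = {0..<s}" and s: "s \<ge> 1" by (auto simp: labelling_def)
  define b where "b = (\<lambda>l. {i \<in> {1..k}. h i = l - 1})"
  note data = labelled_blocks[OF hk s, folded b_def]
  note bead = labelled_bead[OF hk s, folded b_def]
  have less: "h i < s" if "i \<in> {1..k}" for i using hk that by fastforce
  have "h i = Suc (h j) mod s \<longleftrightarrow> Suc (h j) = pred_cycle s (Suc (h i))" if "i \<in> {1..k}" "j \<in> {1..k}" for i j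
    using less[OF that(1)] less[OF that(2)] by (cases "Suc (h j) = s") (auto simp: pred_cycle_def)
  then have "labelling (\<lambda>x. Suc x mod s) (necklace_block b (pred_cycle s) ` {1..s}) {1..k} s h"
    unfolding labelling_def using s hk joined_necklace[OF data] bead by simp
  then have "p = necklace_block b (pred_cycle s) ` {1..s}"
    by (rule labelling_partition_eqI[OF p partition_on_necklace(1)[OF data] h])
  then show "necklace k p s" unfolding necklace_def using data by blast
qed

lemma chain_iff:
  assumes p: "p \<in> partitions k"
  shows "chain k p s \<longleftrightarrow> chain_like p {1..k} s"
proof
  assume "chain k p s"
  then obtain b \<sigma> i0 where "necklace_data k s b \<sigma>" "i0 \<in> {1..s}"
    "p = necklace_block b \<sigma> ` ({1..s} - {i0}) \<union> {Inl ` b i0, Inr ` b (\<sigma> i0)}"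
    unfolding chain_def by blast
  then show "chain_like p {1..k} s" using chain_data_like by simp
next
  assume "chain_like p {1..k} s"
  then obtain h where h: "labelling Suc p {1..k} s h" by (auto simp: chain_like_def)
  then have hk: "h ` {1..k} = {0..<s}" and s: "s \<ge> 1" by (auto simp: labelling_def)
  define b where "b = (\<lambda>l. {i \<in> {1..k}. h i = l - 1})"
  note data = labelled_blocks[OF hk s, folded b_def]
  note bead = labelled_bead[OF hk s, folded b_def]
  have less: "h i < s" if "i \<in> {1..k}" for i using hk that by fastforce
  \<comment> \<open>Bead 1 holds position 0, so this is where the chain is cut.\<close>
  have i0: "1 \<in> {1..s}" using s by simp
  have "h i = Suc (h j) \<longleftrightarrow> Suc (h i) \<noteq> 1 \<and> Suc (h j) = pred_cycle s (Suc (h i))"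
    if "i \<in> {1..k}" "j \<in> {1..k}" for i j
    using less[OF that(1)] less[OF that(2)] by (auto simp: pred_cycle_def)
  then have "labelling Suc (necklace_block b (pred_cycle s) ` ({1..s} - {1}) \<union> {Inl ` b 1, Inr ` b (pred_cycle s 1)}) {1..k} s h"
    unfolding labelling_def using s hk joined_chain[OF data _ _ i0] bead by simp
  then have "p = necklace_block b (pred_cycle s) ` ({1..s} - {1}) \<union> {Inl ` b 1, Inr ` b (pred_cycle s 1)}"
    by (rule labelling_partition_eqI[OF p partition_on_necklace(2)[OF data i0] h])
  then show "chain k p s" unfolding chain_def using data i0 by blast
qed

section \<open>Heads\<close>

lemma columns_head:
  assumes "p \<in> partitions k"
  shows "columns (points k - \<Union>(ears p)) = nonears k p"
  by (auto simp: columns_def ears_def nonears_def joined_def)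

lemma head_points:
  assumes "p \<in> partitions k"
  shows "a \<in> points k - \<Union>(ears p) \<longleftrightarrow> col a \<in> nonears k p"
  by (cases a) (auto simp: ears_def nonears_def joined_def)

lemma rank_in_bij:
  assumes fin: "finite (columns C)"
  shows "bij_betw (rank_in C) (columns C) {1..card (columns C)}"
proof -
  have mono: "rank_in C i < rank_in C j" if "i \<in> columns C" "j \<in> columns C" "i < j" for i j
    unfolding rank_in_def
  proof (rule psubset_card_mono)
    show "finite {x \<in> columns C. x \<le> j}" using fin by simp
    have "j \<in> {x \<in> columns C. x \<le> j}" "j \<notin> {x \<in> columns C. x \<le> i}" using that by auto
    moreover have "{x \<in> columns C. x \<le> i} \<subseteq> {x \<in> columns C. x \<le> j}" using that by auto
    ultimately show "{x \<in> columns C. x \<le> i} \<subset> {x \<in> columns C. x \<le> j}" by blast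
  qed
  then have inj: "inj_on (rank_in C) (columns C)"
    by (intro inj_onI) (metis less_irrefl linorder_neqE_nat)
  moreover have "rank_in C ` columns C \<subseteq> {1..card (columns C)}"
  proof
    fix x assume "x \<in> rank_in C ` columns C"
    then obtain i where i: "i \<in> columns C" "x = rank_in C i" by blast
    have "card {j \<in> columns C. j \<le> i} \<le> card (columns C)" using fin by (intro card_mono) auto
    moreover have "card {j \<in> columns C. j \<le> i} > 0" using fin i by (auto simp: card_gt_0_iff)
    ultimately show "x \<in> {1..card (columns C)}" using i by (simp add: rank_in_def)
  qed
  ultimately show ?thesis
    by (simp add: bij_betw_def card_subset_eq card_image)
qed

context
  fixes k p
  assumes p: "p \<in> partitions k"
begin

private abbreviation (input) "H \<equiv> nonears k p"
private abbreviation (input) "r \<equiv> rank_in (points k - \<Union>(ears p))"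

lemma head_size_eq: "head_size k p = card (nonears k p)"
  by (simp add: head_size_def columns_head[OF p])

lemma head_rank_bij: "bij_betw (rank_in (points k - \<Union>(ears p))) (nonears k p) {1..head_size k p}"
  using rank_in_bij[of "points k - \<Union>(ears p)"] finite_nonears
  by (simp add: columns_head[OF p] head_size_eq)

lemma
  shows head_in_partitions: "head k p \<in> partitions (head_size k p)"
    and joined_head: "\<And>a b. col a \<in> nonears k p \<Longrightarrow> col b \<in> nonears k p \<Longrightarrow>
      joined (head k p) (map_sum (rank_in (points k - \<Union>(ears p))) (rank_in (points k - \<Union>(ears p))) a)
        (map_sum (rank_in (points k - \<Union>(ears p))) (rank_in (points k - \<Union>(ears p))) b) \<longleftrightarrow> joined p a b"
proof -
  let ?C = "points k - \<Union>(ears p)" and ?m = "map_sum r r"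
  let ?q = "(\<lambda>b. b \<inter> ?C) ` p - {{}}"
  have inj_r: "inj_on r H" and im_r: "r ` H = {1..head_size k p}"
    using head_rank_bij by (auto simp: bij_betw_def)
  have inj: "inj_on ?m ?C"
  proof (rule inj_onI)
    fix a b assume "a \<in> ?C" "b \<in> ?C" "?m a = ?m b"
    then show "a = b"
      using inj_onD[OF inj_r] head_points[OF p, of a] head_points[OF p, of b] by (cases a; cases b) auto
  qed
  have "partition_on (?C \<inter> points k) ((\<inter>) ?C ` p - {{}})"
    by (rule partition_on_restrict[OF partitionsD[OF p]])
  moreover have "(\<inter>) ?C ` p = (\<lambda>b. b \<inter> ?C) ` p" by (simp add: Int_commute)
  moreover have "?C \<inter> points k = ?C" by blast
  ultimately have q: "partition_on ?C ?q" by simp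
  have "?m ` ?C = points (head_size k p)"
  proof (intro equalityI subsetI)
    fix x assume "x \<in> ?m ` ?C"
    then obtain a where a: "a \<in> ?C" "x = ?m a" by blast
    then have "r (col a) \<in> {1..head_size k p}" using head_points[OF p] im_r by blast
    then show "x \<in> points (head_size k p)" using a(2) by (simp add: in_points_iff col_map_sum)
  next
    fix x assume "x \<in> points (head_size k p)"
    then have "col x \<in> r ` H" unfolding im_r by (simp add: in_points_iff)
    then obtain i where i: "i \<in> H" "col x = r i" by blast
    have "Inl i \<in> ?C" "Inr i \<in> ?C" using head_points[OF p, of "Inl i"] head_points[OF p, of "Inr i"] i(1) by simp_all
    moreover have "x = ?m (Inl i) \<or> x = ?m (Inr i)" using i(2) by (cases x) auto
    ultimately show "x \<in> ?m ` ?C" by blast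
  qed
  then have h: "partition_on (points (head_size k p)) (head k p)"
    using partition_on_image_blocks[OF q inj] unfolding head_def extraction_def by simp
  then show "head k p \<in> partitions (head_size k p)" by (simp add: partitions_def)
  fix a b assume ab: "col a \<in> H" "col b \<in> H"
  then have C: "a \<in> ?C" "b \<in> ?C" using head_points[OF p] by auto
  have "joined (head k p) (?m a) (?m b) \<longleftrightarrow> (\<exists>c d. ?m a = ?m c \<and> ?m b = ?m d \<and> joined ?q c d)"
    unfolding head_def extraction_def joined_image_blocks ..
  also have "\<dots> \<longleftrightarrow> joined ?q a b"
  proof
    assume "\<exists>c d. ?m a = ?m c \<and> ?m b = ?m d \<and> joined ?q c d"
    then obtain c d where cd: "?m a = ?m c" "?m b = ?m d" "joined ?q c d" by blast
    have "c \<in> ?C" "d \<in> ?C" using joined_in[OF q cd(3)] by auto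
    then have "a = c" "b = d" using inj_onD[OF inj cd(1) C(1)] inj_onD[OF inj cd(2) C(2)] by auto
    then show "joined ?q a b" using cd(3) by simp
  qed blast
  also have "\<dots> \<longleftrightarrow> joined p a b"
  proof
    assume "joined p a b"
    then obtain X where "X \<in> p" "a \<in> X" "b \<in> X" unfolding joined_def by blast
    then show "joined ?q a b" using C unfolding joined_def by (intro bexI[of _ "X \<inter> ?C"]) auto
  qed (auto simp: joined_def)
  finally show "joined (head k p) (?m a) (?m b) \<longleftrightarrow> joined p a b" .
qed

lemma head_like:
  "necklace_like (head k p) {1..head_size k p} s \<longleftrightarrow> necklace_like p (nonears k p) s"
  "chain_like (head k p) {1..head_size k p} s \<longleftrightarrow> chain_like p (nonears k p) s"
  using like_transfer[OF head_rank_bij joined_head] by blast+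

text \<open>The inverse of the renumbering embeds the head into \<open>detach k p\<close> of the
  non-ear columns, and \<open>single_cycle_detach\<close> keeps these columns in one cycle once the
  ears are cut off.\<close>

lemma head_irreducible:
  assumes single: "single_cycle p (nonears k p)" and ne: "nonears k p \<noteq> {}"
  shows "irreducible_part (head_size k p) (head k p)"
proof -
  let ?d = "detach k p H" and ?m = "head_size k p"
  define f where "f = inv_into H r"
  have f: "bij_betw f {1..?m} H" unfolding f_def by (rule bij_betw_inv_into[OF head_rank_bij])
  have rf: "r (f i) = i" if "i \<in> {1..?m}" for i
    using head_rank_bij that unfolding f_def by (auto simp: bij_betw_def f_inv_into_f)
  have "embeds f ?m (head k p) k ?d"
    unfolding embeds_def
  proof (intro conjI ballI)
    show "inj_on f {1..?m}" "f ` {1..?m} \<subseteq> {1..k}" "active k ?d \<subseteq> f ` {1..?m}"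
      using f active_detach_subset[OF p] nonears_subset by (auto simp: bij_betw_def)
    fix a b assume ab: "a \<in> points ?m" "b \<in> points ?m"
    have m: "map_sum r r (map_sum f f x) = x" if "x \<in> points ?m" for x
      using rf that by (cases x) auto
    have B: "col (map_sum f f x) \<in> H" if "x \<in> points ?m" for x
      using f that by (auto simp: bij_betw_def col_map_sum in_points_iff)
    have "joined (head k p) a b \<longleftrightarrow> joined p (map_sum f f a) (map_sum f f b)"
      using joined_head[OF B[OF ab(1)] B[OF ab(2)]] m ab by simp
    then show "joined ?d (map_sum f f a) (map_sum f f b) = joined (head k p) a b"
      using B ab joined_in[OF partitionsD[OF p], of "map_sum f f a" "map_sum f f b"]
      by (auto simp: joined_detach[OF p])
  qed (simp_all add: head_in_partitions detach_in_partitions[OF p])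
  moreover have "single_cycle ?d (f ` {1..?m})"
    using single_cycle_detach[OF p subset_refl subset_refl single] f by (simp add: bij_betw_def)
  ultimately have "single_cycle (head k p) {1..?m}" using embeds_single_cycle by blast
  moreover have "?m \<ge> 1" using ne finite_nonears by (simp add: head_size_eq Suc_le_eq card_gt_0_iff)
  ultimately show ?thesis by (simp add: irreducible_iff head_in_partitions)
qed

end

section \<open>Parures and values for irreducible partitions\<close>

lemma extraction_points:
  assumes p: "p \<in> partitions k"
  shows "extraction (points k) p = p"
proof -
  note P = partitionsD[OF p]
  have rank: "rank_in (points k) i = i" if "i \<in> {1..k}" for i
  proof -
    have "{j \<in> {1..k}. j \<le> i} = {1..i}" using that by auto
    then show ?thesis by (simp add: rank_in_def columns_points)
  qed
  have id: "map_sum (rank_in (points k)) (rank_in (points k)) a = a" if "a \<in> points k" for a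
    using rank that by (cases a) auto
  have "(\<lambda>b. b \<inter> points k) ` p = (\<lambda>b. b) ` p"
    by (rule image_cong) (use block_subset[OF P] in auto)
  then have "extraction (points k) p = (\<lambda>b. map_sum (rank_in (points k)) (rank_in (points k)) ` b) ` p"
    unfolding extraction_def using partition_onD3[OF P] by simp
  also have "\<dots> = (\<lambda>b. b) ` p"
  proof (rule image_cong)
    fix X assume "X \<in> p"
    then have "X \<subseteq> points k" by (rule block_subset[OF P])
    then have "map_sum (rank_in (points k)) (rank_in (points k)) ` X = (\<lambda>a. a) ` X"
      by (intro image_cong) (use id in auto)
    then show "map_sum (rank_in (points k)) (rank_in (points k)) ` X = X" by simp
  qed simp
  finally show ?thesis by simp
qed

lemma parure_irreducible:
  assumes "irreducible_part k p"
  shows "parure k p \<longleftrightarrow> (\<exists>s. chain k p s \<or> necklace k p s)"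
proof -
  have p: "p \<in> partitions k" using assms by (simp add: irreducible_part_def)
  show ?thesis
    unfolding parure_def cycles_of_irreducible[OF assms]
    using p by (simp add: columns_points extraction_points[OF p])
qed

lemma parure_0: "p \<in> partitions 0 \<Longrightarrow> parure 0 p \<and> p = {}"
proof -
  assume p: "p \<in> partitions 0"
  have pt: "points 0 = {}" by (simp add: points_def)
  have "p = {}" using partitionsD[OF p] by (simp add: pt partition_on_empty)
  moreover have "cycles_of 0 p = {}" using partition_on_cycles_of[OF p] by (simp add: pt partition_on_empty)
  ultimately show ?thesis using p by (simp add: parure_def)
qed

text \<open>An inactive column is a cycle by itself. In an irreducible partition it would be the
  only column, and the partition an identity.\<close>

lemma irreducible_active:
  assumes irr: "irreducible_part k p" and ne: "p \<noteq> id_part k"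
  shows "active k p = {1..k}"
proof -
  have p: "p \<in> partitions k" and single: "single_cycle p {1..k}" using irr by (auto simp: irreducible_iff)
  have "i \<in> active k p" if i: "i \<in> {1..k}" for i
  proof (rule ccontr)
    assume ia: "i \<notin> active k p"
    have "closed_cols p {i}"
      unfolding closed_cols_def
    proof (intro allI impI)
      fix a b assume ab: "joined p a b" "col a \<in> {i}"
      then show "col b \<in> {i}"
        using joined_inactive[OF p, of a b] joined_in[OF partitionsD[OF p] ab(1)] ia by simp
    qed
    then have "{1..k} = {i}" using single i unfolding single_cycle_def by blast
    then have "active k p = {}" using ia by (auto simp: active_def)
    then show False using active_empty_iff[OF p] ne by simp
  qed
  then show ?thesis by (auto simp: active_def)
qed

lemma card_ears:
  assumes p: "p \<in> partitions k"
  shows "card (ears p) = card ({1..k} - nonears k p)"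
proof -
  have "ears p = (\<lambda>i. {Inl i, Inr i}) ` ({1..k} - nonears k p)"
  proof (intro equalityI subsetI)
    fix X assume "X \<in> ears p"
    then obtain i where i: "X = {Inl i, Inr i}" "joined p (Inl i) (Inr i)" by (auto simp: ears_def joined_def)
    then show "X \<in> (\<lambda>i. {Inl i, Inr i}) ` ({1..k} - nonears k p)"
      using joined_in[OF partitionsD[OF p] i(2)] by (auto simp: nonears_def)
  qed (auto simp: ears_def nonears_def joined_def)
  moreover have "inj_on (\<lambda>i. {Inl i, Inr i} :: point set) ({1..k} - nonears k p)"
    by (auto simp: inj_on_def doubleton_eq_iff)
  ultimately show ?thesis by (simp add: card_image)
qed

text \<open>The only irreducible identity has one column; its value \<open>- 1\<close> is the sign
  of its single ear. In the other cases all columns are active, so every ear counts for the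
  sign.\<close>

lemma log_cumulant_value_irreducible:
  assumes irr: "irreducible_part k p"
  shows "log_cumulant_value lam k p = (-1) ^ card (ears p) * weight lam p (nonears k p)"
proof (cases "p = id_part k")
  case True
  have p: "p \<in> partitions k" and k: "k \<ge> 1" and single: "single_cycle p {1..k}"
    using irr by (auto simp: irreducible_iff)
  have "closed_cols p {1}" unfolding closed_cols_def True by (auto simp: joined_id_part)
  then have "{1..k} \<subseteq> {1}" using single k unfolding single_cycle_def by fastforce
  then have "k = 1" using k by (metis atLeastAtMost_iff le_antisym order_refl singletonD subsetD)
  moreover have "nonears k p = {}" unfolding True by (rule nonears_id_part)
  ultimately show ?thesis using True card_ears[OF p] by (simp add: log_cumulant_value_def weight_def)
next
  case False
  have "p \<in> partitions k" "single_cycle p {1..k}" using irr by (auto simp: irreducible_iff)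
  then show ?thesis
    using False irreducible_active[OF irr False] card_ears by (simp add: log_cumulant_value_def)
qed

text \<open>An empty head is the necklace of length 0, and \<open>lam 0 = 1\<close> is the value of
  \<open>weight\<close> there. A non-empty head is irreducible, so it is a parure exactly when it is
  itself a necklace or a chain.\<close>

lemma head_weight:
  assumes irr: "irreducible_part k p" and lam0: "lam 0 = 1"
  shows "\<not> parure (head_size k p) (head k p) \<Longrightarrow> weight lam p (nonears k p) = 0"
    and "necklace (head_size k p) (head k p) s \<Longrightarrow> weight lam p (nonears k p) = lam s"
    and "chain (head_size k p) (head k p) s \<Longrightarrow> weight lam p (nonears k p) = 1 - (\<Sum>i=2..s. lam i)"
    and "parure (head_size k p) (head k p) \<Longrightarrow>
      \<exists>s. necklace (head_size k p) (head k p) s \<or> chain (head_size k p) (head k p) s"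
proof -
  have p: "p \<in> partitions k" and single: "single_cycle p {1..k}" using irr by (auto simp: irreducible_iff)
  let ?m = "head_size k p" and ?h = "head k p" and ?B = "nonears k p"
  note h = head_in_partitions[OF p]
  have sB: "single_cycle p ?B" by (rule single_cycle_subset[OF single nonears_subset])
  have m0: "?m = 0 \<longleftrightarrow> ?B = {}" using finite_nonears by (simp add: head_size_eq[OF p])
  have N: "necklace ?m ?h s \<longleftrightarrow> necklace_like p ?B s" if "?B \<noteq> {}" for s
    using necklace_iff[OF h] head_like(1)[OF p] m0 that by simp
  have Ch: "chain ?m ?h s \<longleftrightarrow> chain_like p ?B s" for s
    using chain_iff[OF h] head_like(2)[OF p] by simp
  have h0: "?h = {} \<and> parure ?m ?h" if "?B = {}"
  proof -
    have m: "?m = 0" using m0 that by simp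
    show ?thesis using parure_0[OF h[unfolded m]] unfolding m by blast
  qed
  have par: "parure ?m ?h \<longleftrightarrow> (\<exists>s. necklace ?m ?h s \<or> chain ?m ?h s)"
  proof (cases "?B = {}")
    case True
    then show ?thesis using h0 m0 by (auto simp: necklace_def)
  next
    case False
    show ?thesis using parure_irreducible[OF head_irreducible[OF p sB False]] by blast
  qed
  show "\<exists>s. necklace ?m ?h s \<or> chain ?m ?h s" if "parure ?m ?h" using par that by blast
  show "weight lam p ?B = 0" if np: "\<not> parure ?m ?h"
  proof -
    have "?B \<noteq> {}" using h0 np by blast
    then have "\<nexists>s. necklace_like p ?B s" "\<nexists>s. chain_like p ?B s" using par np N Ch by blast+
    then show ?thesis using \<open>?B \<noteq> {}\<close> unfolding weight_def by auto
  qed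
  show "weight lam p ?B = 1 - (\<Sum>i=2..s. lam i)" if "chain ?m ?h s" using weight_chain Ch that by blast
  show "weight lam p ?B = lam s" if n: "necklace ?m ?h s"
  proof (cases "?B = {}")
    case False
    then show ?thesis using weight_necklace N n by blast
  next
    case True
    have "s = 0"
      using n m0 True unfolding necklace_def necklace_data_def
      by (auto simp: partition_on_empty)
    then show ?thesis using True lam0 by (simp add: weight_def)
  qed
qed

text \<open>For the converse, every irreducible partition is covered because its head is a necklace,
  a chain or no parure. The character conditions then reduce any other partition to an irreducible
  one, to a multiple of the identity on one column, or to 0.\<close>

theorem log_cumulant_value_characterization:
  fixes E :: "point set set \<Rightarrow> complex"
  assumes lam0: "lam 0 = 1"
  shows "(\<forall>k. \<forall>p\<in>partitions k. E p = of_real (log_cumulant_value lam k p)) \<longleftrightarrow>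
      infinitesimal_character E \<and>
      (\<forall>k\<ge>1. \<forall>p. irreducible_part k p \<longrightarrow>
         \<not> parure (head_size k p) (head k p) \<longrightarrow> E p = 0) \<and>
      (\<forall>k\<ge>1. \<forall>p. irreducible_part k p \<longrightarrow>
         (\<forall>s. necklace (head_size k p) (head k p) s \<longrightarrow>
            E p = (-1) ^ card (ears p) * of_real (lam s)) \<and>
         (\<forall>s. chain (head_size k p) (head k p) s \<longrightarrow>
            E p = (-1) ^ card (ears p) * of_real (1 - (\<Sum>i=2..s. lam i))))"
    (is "?L \<longleftrightarrow> ?C \<and> ?N \<and> ?V")
proof
  assume E: ?L
  have irr: "E p = (-1) ^ card (ears p) * of_real (weight lam p (nonears k p))"
    if i: "irreducible_part k p" for k p
  proof -
    have "p \<in> partitions k" using i by (simp add: irreducible_part_def)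
    then show ?thesis using E log_cumulant_value_irreducible[OF i, of lam] by simp
  qed
  show "?C \<and> ?N \<and> ?V"
  proof (intro conjI allI impI)
    show ?C by (rule log_cumulant_value_infinitesimal_character[of _ lam]) (use E in blast)
  next
    fix k p assume "irreducible_part k p" "\<not> parure (head_size k p) (head k p)"
    then show "E p = 0" using irr head_weight(1)[where lam = lam, OF _ lam0] by simp
  next
    fix k p s assume "irreducible_part k p" "necklace (head_size k p) (head k p) s"
    then show "E p = (-1) ^ card (ears p) * of_real (lam s)" using irr head_weight(2)[where lam = lam, OF _ lam0] by simp
  next
    fix k p s assume "irreducible_part k p" "chain (head_size k p) (head k p) s"
    then show "E p = (-1) ^ card (ears p) * of_real (1 - (\<Sum>i=2..s. lam i))"
      using irr head_weight(3)[where lam = lam, OF _ lam0] by simp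
  qed
next
  assume *: "?C \<and> ?N \<and> ?V"
  have irr: "E p = of_real (log_cumulant_value lam k p)" if i: "irreducible_part k p" for k p
  proof -
    have k: "k \<ge> 1" using i by (simp add: irreducible_iff)
    show ?thesis
    proof (cases "parure (head_size k p) (head k p)")
      case False
      then show ?thesis
        using * k i head_weight(1)[where lam = lam, OF i lam0] log_cumulant_value_irreducible[OF i, of lam] by simp
    next
      case True
      then obtain s where "necklace (head_size k p) (head k p) s \<or> chain (head_size k p) (head k p) s"
        using head_weight(4)[where lam = lam, OF i lam0] by blast
      then show ?thesis
      proof
        assume n: "necklace (head_size k p) (head k p) s"
        then have "E p = (-1) ^ card (ears p) * of_real (lam s)" using * k i by blast
        then show ?thesis
          using head_weight(2)[where lam = lam, OF i lam0 n] log_cumulant_value_irreducible[OF i, of lam] by simp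
      next
        assume c: "chain (head_size k p) (head k p) s"
        then have "E p = (-1) ^ card (ears p) * of_real (1 - (\<Sum>i=2..s. lam i))" using * k i by blast
        then show ?thesis
          using head_weight(3)[where lam = lam, OF i lam0 c] log_cumulant_value_irreducible[OF i, of lam] by simp
      qed
    qed
  qed
  have IC: "infinitesimal_character E" using * by blast
  show ?L
  proof (intro allI ballI)
    fix k p assume p: "p \<in> partitions k"
    show "E p = of_real (log_cumulant_value lam k p)"
    proof (cases "p = id_part k")
      case True
      show ?thesis
      proof (cases "k = 0")
        case k0: True
        \<comment> \<open>The condition on identities starts at \<open>k = 1\<close>. The empty
          partition is the juxtaposition of itself with itself, so additivity gives
          \<open>E {} = E {} + E {}\<close>.\<close>
        have 0: "id_part 0 = {}" by (simp add: id_part_def)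
        have p0: "{} \<in> partitions 0" using id_part_in_partitions[of 0] by (simp add: 0)
        have "tensor_part 0 {} {} = {}" by (simp add: tensor_part_def)
        moreover have "eps_box {} = 1" using eps_box_eq[OF id_part_in_partitions, of 0] by (simp add: 0)
        moreover have "E (tensor_part 0 {} {}) = E {} * eps_box {} + eps_box {} * E {}"
          using IC[unfolded infinitesimal_character_def, THEN conjunct1, rule_format, OF p0 p0] .
        ultimately have "E {} = E {} + E {}" by simp
        then show ?thesis using True k0 0 by (simp add: log_cumulant_value_def)
      next
        case False
        have "{1..1} \<subseteq> D \<or> {1..1} \<inter> D = {}" for D :: "nat set" by auto
        then have "irreducible_part 1 (id_part 1)"
          unfolding irreducible_iff single_cycle_def by (simp only: id_part_in_partitions order_refl simp_thms)
        then have "E (id_part 1) = - 1" using irr[of 1 "id_part 1"] by (simp add: log_cumulant_value_def)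
        moreover have "E (id_part k) = of_nat k * E (id_part 1)"
          using IC[unfolded infinitesimal_character_def, THEN conjunct2, THEN conjunct1, rule_format, of k] False
          by simp
        ultimately show ?thesis using True by (simp add: log_cumulant_value_def)
      qed
    next
      case ne: False
      show ?thesis
      proof (cases "\<exists>k' p'. irreducible_part k' p' \<and> stabilizes k p k' p'")
        case True
        then obtain k' p' where s: "irreducible_part k' p'" "stabilizes k p k' p'" by blast
        have "E p = E p'"
          using IC[unfolded infinitesimal_character_def, THEN conjunct2, THEN conjunct2, THEN conjunct1,
              rule_format, of p k k' p'] p ne s by blast
        moreover have "p' \<in> partitions k'" using s by (simp add: irreducible_part_def)
        then obtain \<pi> where "embeds \<pi> k' p' k p" using stabilizes_embeds s(2) by blast
        then have "log_cumulant_value lam k p = log_cumulant_value lam k' p'"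
          by (rule embeds_log_cumulant_value) (rule ne)
        ultimately show ?thesis using irr[OF s(1)] by simp
      next
        case False
        then have "E p = 0"
          using IC[unfolded infinitesimal_character_def, THEN conjunct2, THEN conjunct2, THEN conjunct2,
              rule_format, of p k] p ne by blast
        moreover have "\<not> single_cycle p (active k p)" using False single_cycle_stabilizes[OF p ne] by blast
        ultimately show ?thesis using ne by (simp add: log_cumulant_value_def)
      qed
    qed
  qed
qed

text \<open>Convergence is asserted separately because \<open>lim\<close> has no meaning for a
  divergent sequence. The equivalence for all \<open>E\<close> states the characterisation: the
  log-cumulant transform satisfies the conditions, and no other linear form does.\<close>

theorem theorem2p11:
  fixes C :: "nat \<Rightarrow> (nat \<Rightarrow> nat) set"
    and lam :: "nat \<Rightarrow> real"
    and M :: "nat \<Rightarrow> 'a measure"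
    and S :: "nat \<Rightarrow> real \<Rightarrow> 'a \<Rightarrow> nat \<Rightarrow> nat"
  assumes "\<And>N. N \<ge> 2 \<Longrightarrow> nontrivial_class N (C N)"
    and "classes_converge C lam 0"
    and "\<And>N. N \<ge> 2 \<Longrightarrow> class_random_walk N (C N) (M N) (S N)"
    and "lam 0 = 1" and "lam 1 = 1"
  shows "(\<forall>k. \<forall>p\<in>partitions k. (\<lambda>N. log_kappa M S N k p) \<longlonglongrightarrow> log_cumulant M S p) \<and>
    (\<forall>E :: point set set \<Rightarrow> complex.
      (\<forall>k. \<forall>p\<in>partitions k. E p = log_cumulant M S p) \<longleftrightarrow>
      infinitesimal_character E \<and>
      (\<forall>k\<ge>1. \<forall>p. irreducible_part k p \<longrightarrow>
         \<not> parure (head_size k p) (head k p) \<longrightarrow> E p = 0) \<and>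
      (\<forall>k\<ge>1. \<forall>p. irreducible_part k p \<longrightarrow>
         (\<forall>s. necklace (head_size k p) (head k p) s \<longrightarrow>
            E p = (-1) ^ card (ears p) * of_real (lam s)) \<and>
         (\<forall>s. chain (head_size k p) (head k p) s \<longrightarrow>
            E p = (-1) ^ card (ears p) * of_real (1 - (\<Sum>i=2..s. lam i)))))"
proof -
  have lim: "(\<lambda>N. log_kappa M S N k p) \<longlonglongrightarrow> of_real (log_cumulant_value lam k p)"
    if "p \<in> partitions k" for k p
    by (rule log_kappa_limit[OF assms(1-3) that])
  have lcv: "log_cumulant M S p = of_real (log_cumulant_value lam k p)" if p: "p \<in> partitions k" for k p
    unfolding log_cumulant_def Union_partition[OF p] columns_points using limI[OF lim[OF p]] by simp
  have "(\<forall>k. \<forall>p\<in>partitions k. E p = log_cumulant M S p) \<longleftrightarrow>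
      (\<forall>k. \<forall>p\<in>partitions k. E p = of_real (log_cumulant_value lam k p))" for E
    using lcv by auto
  then show ?thesis
    using lim lcv log_cumulant_value_characterization[of lam, OF assms(4)] by simp
qed

end
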